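(* Let $A<\omega$, let $\mathcal{F}$ and $\mathcal{G}$ be classes of $A$-frames, and let $a<A$. If $\mathrm{Sat}(\mathcal{G}^\forall)\le_T^{\mathrm{PSPACE}}\mathrm{Sat}(\mathcal{F}^\forall)$ (in particular, if $\mathrm{Sat}(\mathcal{G}^\forall)$ is in PSPACE), then $\mathrm{Sat}\big((\mathcal{F}\oplus_a\mathcal{G})^\forall\big)\le_T^{\mathrm{PSPACE}}\mathrm{Sat}(\mathcal{F}^\forall)$, and consequently $\mathrm{Sat}(\mathcal{F}\oplus_a\mathcal{G})\le_T^{\mathrm{PSPACE}}\mathrm{Sat}(\mathcal{F}^\forall)$.
   Context: $A$-frames: $(W,(R_c)_{c<A})$, $W\neq\emptyset$; $\mathrm{Sat}(\mathcal{C})$ is the set of formulas (modalities $\Diamond_c$ for the relations of the signature) satisfiable in some Kripke model on a frame of $\mathcal{C}$. For $\mathbf{F}=(W,(R_0,R_1,\dots))$, $\mathbf{F}^\forall=(W,(W\times W,R_0,R_1,\dots))$; $\mathcal{C}^\forall=\{\mathbf{F}^\forall:\mathbf{F}\in\mathcal{C}\}$. For $A$-frames $\mathbf{F}_0,\mathbf{F}_1$, $\mathbf{F}_0\oplus_a\mathbf{F}_1$ is the disjoint union of $\mathbf{F}_0$ and $\mathbf{F}_1$ (domain $\{(i,w): i<2, w\in\mathbf{F}_i\}$) with all pairs $((0,w),(1,v))$ added to the $a$-th relation; $\mathcal{F}\oplus_a\mathcal{G}=\{\mathbf{F}\oplus_a\mathbf{G}:\mathbf{F}\in\mathcal{F},\mathbf{G}\in\mathcal{G}\}$.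 $P\le_T^{\mathrm{PSPACE}}Q$: decided by a deterministic oracle machine with oracle $Q$ using polynomial space on all tapes including the oracle tape. *)

theory Defs
  imports Main "HOL-Computational_Algebra.Polynomial"
begin

section \<open>Modal formulas and Kripke semantics\<close>

datatype fm = Var nat | Bot | Imp fm fm | Dia nat fm

primrec modalities :: "fm \<Rightarrow> nat set" where
  "modalities (Var i) = {}"
| "modalities Bot = {}"
| "modalities (Imp \<phi> \<psi>) = modalities \<phi> \<union> modalities \<psi>"
| "modalities (Dia c \<phi>) = insert c (modalities \<phi>)"

record 'w frame =
  worlds :: "'w set"
  rels :: "'w rel list"

definition is_frame :: "nat \<Rightarrow> 'w frame \<Rightarrow> bool" where
  "is_frame A F \<longleftrightarrow>
     worlds F \<noteq> {} \<and> length (rels F) = A \<and> (\<forall>R \<in> set (rels F). R \<subseteq> worlds F \<times> worlds F)"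

primrec holds :: "'w frame \<Rightarrow> (nat \<Rightarrow> 'w set) \<Rightarrow> 'w \<Rightarrow> fm \<Rightarrow> bool" where
  "holds F V w (Var i) \<longleftrightarrow> w \<in> V i"
| "holds F V w Bot \<longleftrightarrow> False"
| "holds F V w (Imp \<phi> \<psi>) \<longleftrightarrow> (holds F V w \<phi> \<longrightarrow> holds F V w \<psi>)"
| "holds F V w (Dia c \<phi>) \<longleftrightarrow> (\<exists>v. (w, v) \<in> rels F ! c \<and> holds F V v \<phi>)"

definition satisfiable_in :: "'w frame \<Rightarrow> fm \<Rightarrow> bool" where
  "satisfiable_in F \<phi> \<longleftrightarrow>
     (\<exists>V. (\<forall>i. V i \<subseteq> worlds F) \<and> (\<exists>w \<in> worlds F. holds F V w \<phi>))"

text \<open>The signature is an explicit parameter: \<open>Sat A C\<close> only contains formulas whose modalities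
  are among \<open>0, \<dots>, A - 1\<close>, and is meant for classes \<open>C\<close> of \<open>A\<close>-frames.\<close>

definition Sat :: "nat \<Rightarrow> 'w frame set \<Rightarrow> fm set" where
  "Sat A C = {\<phi>. modalities \<phi> \<subseteq> {..<A} \<and> (\<exists>F \<in> C. satisfiable_in F \<phi>)}"

text \<open>The universal relation becomes relation number 0, and \<open>R\<^sub>c\<close> becomes number \<open>c + 1\<close>.\<close>

definition univ_frame :: "'w frame \<Rightarrow> 'w frame" where
  "univ_frame F = \<lparr>worlds = worlds F, rels = (worlds F \<times> worlds F) # rels F\<rparr>"

definition univ_class :: "'w frame set \<Rightarrow> 'w frame set" where
  "univ_class C = univ_frame ` C"

text \<open>In the disjoint union, \<open>(0, w)\<close> is rendered as \<open>Inl w\<close> and \<open>(1, v)\<close> as \<open>Inr v\<close>.\<close>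

definition frame_sum :: "nat \<Rightarrow> 'w frame \<Rightarrow> 'v frame \<Rightarrow> ('w + 'v) frame" where
  "frame_sum a F G =
     \<lparr>worlds = worlds F <+> worlds G,
      rels = map (\<lambda>c. {(Inl w, Inl w') | w w'. (w, w') \<in> rels F ! c} \<union>
                      {(Inr v, Inr v') | v v'. (v, v') \<in> rels G ! c} \<union>
                      (if c = a then Inl ` worlds F \<times> Inr ` worlds G else {}))
                 [0..<length (rels F)]\<rparr>"

definition class_sum :: "nat \<Rightarrow> 'w frame set \<Rightarrow> 'v frame set \<Rightarrow> ('w + 'v) frame set" where
  "class_sum a C D = {frame_sum a F G | F G. F \<in> C \<and> G \<in> D}"

lemma is_frame_univ_frame: "is_frame A F \<Longrightarrow> is_frame (Suc A) (univ_frame F)"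
  by (auto simp: is_frame_def univ_frame_def)

lemma is_frame_frame_sum:
  assumes "is_frame A F" "is_frame A G"
  shows "is_frame A (frame_sum a F G)"
proof -
  have "rels F ! c \<subseteq> worlds F \<times> worlds F" "rels G ! c \<subseteq> worlds G \<times> worlds G" if "c < A" for c
    using assms that by (simp_all add: is_frame_def)
  then show ?thesis
    using assms unfolding is_frame_def frame_sum_def by (auto split: if_splits)
qed


section \<open>Formulas as binary words\<close>

text \<open>Least significant bit first, no leading zeros; 0 is the empty word.\<close>

fun binary :: "nat \<Rightarrow> bool list" where
  "binary n = (if n = 0 then [] else odd n # binary (n div 2))"

declare binary.simps [simp del]

text \<open>A self-delimiting code: every bit is preceded by \<open>True\<close>, and \<open>False\<close> ends the number.\<close>

definition encode_nat :: "nat \<Rightarrow> bool list" where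
  "encode_nat n = concat (map (\<lambda>b. [True, b]) (binary n)) @ [False]"

text \<open>Prefix (Polish) notation with two-bit tags.\<close>

primrec encode :: "fm \<Rightarrow> bool list" where
  "encode Bot = [False, False]"
| "encode (Imp \<phi> \<psi>) = [False, True] @ encode \<phi> @ encode \<psi>"
| "encode (Var i) = [True, False] @ encode_nat i"
| "encode (Dia c \<phi>) = [True, True] @ encode_nat c @ encode \<phi>"

lemma binary_0 [simp]: "binary 0 = []"
  by (subst binary.simps) simp

lemma binary_pos: "n > 0 \<Longrightarrow> binary n = odd n # binary (n div 2)"
  by (subst binary.simps) simp

lemma binary_eq_Nil_iff: "binary n = [] \<longleftrightarrow> n = 0"
  using binary_pos[of n] by (cases "n = 0") auto

lemma binary_inject: "binary m = binary n \<Longrightarrow> m = n"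
proof (induction m arbitrary: n rule: less_induct)
  case (less m)
  show ?case
  proof (cases "m = 0 \<or> n = 0")
    case True
    then show ?thesis using less.prems by (metis binary_eq_Nil_iff)
  next
    case False
    then have "odd m # binary (m div 2) = odd n # binary (n div 2)"
      using less.prems binary_pos[of m] binary_pos[of n] by (metis gr0I)
    then have *: "odd m = odd n" "binary (m div 2) = binary (n div 2)" by simp_all
    from False have "m div 2 < m" by simp
    then have "m div 2 = n div 2" using *(2) by (rule less.IH)
    then show ?thesis using *(1) by presburger
  qed
qed

lemma encode_nat_prefix_free: "encode_nat m @ r = encode_nat n @ s \<longleftrightarrow> m = n \<and> r = s"
proof -
  have *: "concat (map (\<lambda>b. [True, b]) xs) @ False # r = concat (map (\<lambda>b. [True, b]) ys) @ False # s
           \<longleftrightarrow> xs = ys \<and> r = s" for xs ys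
  proof (induction xs arbitrary: ys)
    case Nil
    then show ?case by (cases ys) auto
  next
    case (Cons x xs)
    then show ?case by (cases ys) auto
  qed
  have "binary m = binary n \<longleftrightarrow> m = n"
    using binary_inject by blast
  then show ?thesis by (simp add: encode_nat_def *)
qed

lemma encode_prefix_free: "encode \<phi> @ r = encode \<psi> @ s \<longleftrightarrow> \<phi> = \<psi> \<and> r = s"
proof (induction \<phi> arbitrary: \<psi> r s)
  case (Var i)
  then show ?case by (cases \<psi>) (auto simp: encode_nat_prefix_free)
next
  case Bot
  then show ?case by (cases \<psi>) auto
next
  case (Imp \<phi>1 \<phi>2)
  then show ?case by (cases \<psi>) auto
next
  case (Dia c \<phi>)
  then show ?case by (cases \<psi>) (auto simp: encode_nat_prefix_free)
qed

lemma inj_encode: "inj encode"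
  using encode_prefix_free[of _ "[]" _ "[]"] by (auto intro: injI)


section \<open>Oracle Turing machines and polynomial space\<close>

text \<open>Deterministic machines with finitely many tapes, infinite to the right. Tape 0 initially
  carries the input and tape 1 is the oracle tape.\<close>

datatype symbol = Blank | Bit bool | Aux nat

datatype state = Start | Query | Yes | No | Accept | Reject | Work nat

datatype move = MLeft | MStay | MRight

record otm =
  num_tapes :: nat
  states :: "state set"
  alphabet :: "symbol set"
  delta :: "state \<Rightarrow> symbol list \<Rightarrow> state \<times> (symbol \<times> move) list"

definition otm_wf :: "otm \<Rightarrow> bool" where
  "otm_wf M \<longleftrightarrow>
     2 \<le> num_tapes M \<and>
     finite (states M) \<and> {Start, Query, Yes, No, Accept, Reject} \<subseteq> states M \<and>
     finite (alphabet M) \<and> {Blank, Bit False, Bit True} \<subseteq> alphabet M \<and>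
     (\<forall>q \<in> states M. \<forall>xs. length xs = num_tapes M \<and> set xs \<subseteq> alphabet M \<longrightarrow>
        (case delta M q xs of (q', as) \<Rightarrow>
           q' \<in> states M \<and> length as = num_tapes M \<and> fst ` set as \<subseteq> alphabet M))"

type_synonym tape = "(nat \<Rightarrow> symbol) \<times> nat"

type_synonym config = "state \<times> tape list"

definition blank_tape :: tape where
  "blank_tape = ((\<lambda>_. Blank), 0)"

definition input_tape :: "bool list \<Rightarrow> tape" where
  "input_tape x = ((\<lambda>i. if i < length x then Bit (x ! i) else Blank), 0)"

definition init_config :: "otm \<Rightarrow> bool list \<Rightarrow> config" where
  "init_config M x = (Start, input_tape x # replicate (num_tapes M - 1) blank_tape)"

definition read_tape :: "tape \<Rightarrow> symbol" where
  "read_tape t = fst t (snd t)"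

text \<open>Moving left on the first cell has no effect, since \<open>0 - 1 = 0\<close> for natural numbers.\<close>

fun act :: "symbol \<times> move \<Rightarrow> tape \<Rightarrow> tape" where
  "act (s, d) (f, h) =
     (f(h := s), case d of MLeft \<Rightarrow> h - 1 | MStay \<Rightarrow> h | MRight \<Rightarrow> h + 1)"

text \<open>The queried word is the longest initial segment of bits; it is finite in all
  configurations reachable from an initial one.\<close>

definition query_word :: "tape \<Rightarrow> bool list" where
  "query_word t = map (\<lambda>i. fst t i = Bit True) [0..<(LEAST i. fst t i \<notin> range Bit)]"

text \<open>Halting configurations are fixed points. A query takes one step, which also erases the
  oracle tape and returns its head to the first cell. The values of \<open>delta\<close> at the states
  \<open>Accept\<close>, \<open>Reject\<close> and \<open>Query\<close> are never used.\<close>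

fun step :: "otm \<Rightarrow> bool list set \<Rightarrow> config \<Rightarrow> config" where
  "step M Q (q, ts) =
     (if q = Accept \<or> q = Reject then (q, ts)
      else if q = Query then
        (if query_word (ts ! 1) \<in> Q then Yes else No, ts[1 := blank_tape])
      else
        (case delta M q (map read_tape ts) of (q', as) \<Rightarrow> (q', map2 act as ts)))"

definition run :: "otm \<Rightarrow> bool list set \<Rightarrow> bool list \<Rightarrow> nat \<Rightarrow> config" where
  "run M Q x n = (step M Q ^^ n) (init_config M x)"

definition decides :: "otm \<Rightarrow> bool list set \<Rightarrow> bool list set \<Rightarrow> bool" where
  "decides M Q P \<longleftrightarrow> (\<forall>x. \<exists>n. fst (run M Q x n) = (if x \<in> P then Accept else Reject))"

text \<open>The bound applies to each tape, including the input tape and the oracle tape. A cell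
  counts as used once it is visited by a head. As the number of tapes is constant, bounding each
  tape and bounding the sum over all tapes by a polynomial amount to the same.\<close>

definition poly_space :: "otm \<Rightarrow> bool list set \<Rightarrow> bool" where
  "poly_space M Q \<longleftrightarrow>
     (\<exists>p :: nat poly. \<forall>x n. \<forall>t \<in> set (snd (run M Q x n)). snd t < poly p (length x))"

definition PSPACE_Turing_reducible :: "bool list set \<Rightarrow> bool list set \<Rightarrow> bool" where
  "PSPACE_Turing_reducible P Q \<longleftrightarrow> (\<exists>M. otm_wf M \<and> decides M Q P \<and> poly_space M Q)"

text \<open>An ordinary Turing machine is an oracle machine without transitions into the query state;
  its runs do not depend on the oracle, for which we take the empty set.\<close>

definition query_free :: "otm \<Rightarrow> bool" where
  "query_free M \<longleftrightarrow>
     (\<forall>q \<in> states M. \<forall>xs. length xs = num_tapes M \<and> set xs \<subseteq> alphabet M \<longrightarrow>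
        fst (delta M q xs) \<noteq> Query)"

definition PSPACE :: "bool list set set" where
  "PSPACE = {P. \<exists>M. otm_wf M \<and> query_free M \<and> decides M {} P \<and> poly_space M {}}"

abbreviation fm_PSPACE_reducible :: "fm set \<Rightarrow> fm set \<Rightarrow> bool"
  (infix \<open>\<le>\<^sub>T\<^sub>P\<^sub>S\<^sub>P\<^sub>A\<^sub>C\<^sub>E\<close> 50) where
  "\<Phi> \<le>\<^sub>T\<^sub>P\<^sub>S\<^sub>P\<^sub>A\<^sub>C\<^sub>E \<Psi> \<equiv> PSPACE_Turing_reducible (encode ` \<Phi>) (encode ` \<Psi>)"

end

theory Submission
  imports Defs "HOL-Library.Countable"
begin

text \<open>Let \<open>\<alpha>\<close> be \<open>Dia 0 \<phi>\<close> with a guess attached to every diamond \<open>Dia c \<psi>\<close>, saying for each of the two summands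
  whether \<open>\<psi>\<close> holds somewhere in it. Given the guesses, the truth of \<open>\<phi>\<close> at a point of one summand can be
  expressed in that summand alone: a diamond looking into the other summand is replaced by a constant. With the universal
  modality one formula states that the guesses about the summand are right. So \<open>\<phi>\<close> is satisfiable
  in the sum iff for some guess two formulas of polynomial size are satisfiable, one over each class.
  Running through all guesses takes polynomial space.

  For the machine, space-bounded programs over tapes are compiled to oracle machines, the residual
  program serving as control state and being kept on an additional tape, where it survives a query.
  The translations rewrite Polish notation token by token, from right to left.\<close>

section \<open>Structured programs and their compilation to oracle machines\<close>

text \<open>The outer \<open>Dia 0\<close> is there because \<open>\<phi>\<close> may hold in one
  summand only, whereas \<open>Dia 0 \<phi>\<close>, if satisfied at all, is true at every world of
  both summands. One annotated formula is then tested on both sides, with no case distinction on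
  where the witness lies. A guess about one side is checked on that side only and consulted on the
  other side only. Hence the two translations have to agree with truth in the sum simultaneously, in
  one joint induction. The length of the two formulas matters as much as their truth. The translated
  argument of every diamond is repeated, but the copies stand side by side and are never nested, so
  the length is quadratic in the number of tokens. The two tests differ in kind: the first is an
  oracle query, the second a simulation of the machine behind the assumed reduction, which asks the
  same oracle. It is called for exponentially many guesses, so every call has to leave its tapes
  blank.\<close>

datatype com =
    Done
  | Act "(nat \<Rightarrow> symbol) \<Rightarrow> nat \<Rightarrow> symbol \<times> move"
  | Seq com com
  | Branch "(nat \<Rightarrow> symbol) \<Rightarrow> com"
  | Loop "(nat \<Rightarrow> symbol) \<Rightarrow> bool" com
  | Ask com com

primrec asks :: "com \<Rightarrow> bool" where
  "asks Done = False"
| "asks (Act f) = False"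
| "asks (Seq c d) = asks c"
| "asks (Branch f) = False"
| "asks (Loop p c) = False"
| "asks (Ask c d) = True"

primrec ops :: "com \<Rightarrow> (nat \<Rightarrow> symbol) \<Rightarrow> nat \<Rightarrow> symbol \<times> move" where
  "ops Done s = (\<lambda>r. (s r, MStay))"
| "ops (Act f) s = f s"
| "ops (Seq c d) s = ops c s"
| "ops (Branch f) s = (\<lambda>r. (s r, MStay))"
| "ops (Loop p c) s = (\<lambda>r. (s r, MStay))"
| "ops (Ask c d) s = (\<lambda>r. (s r, MStay))"

primrec nxt :: "com \<Rightarrow> (nat \<Rightarrow> symbol) \<Rightarrow> bool \<Rightarrow> com" where
  "nxt Done s b = Done"
| "nxt (Act f) s b = Done"
| "nxt (Seq c d) s b = (if c = Done then d else Seq (nxt c s b) d)"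
| "nxt (Branch f) s b = f s"
| "nxt (Loop p c) s b = (if p s then Seq c (Loop p c) else Done)"
| "nxt (Ask c d) s b = (if b then c else d)"

text \<open>Tests, branches and actions are arbitrary functions of the scanned symbols, so a program
  term may branch infinitely; only branches for readings in \<open>U\<close> are followed here.
  Unrolling a loop adds just \<open>Seq c' (Loop p c)\<close> with \<open>c'\<close> a residual of
  the body, so the control never grows and the set stays finite for finite \<open>U\<close>.\<close>

primrec residuals :: "(nat \<Rightarrow> symbol) set \<Rightarrow> com \<Rightarrow> com set" where
  "residuals U Done = {Done}"
| "residuals U (Act f) = {Act f, Done}"
| "residuals U (Seq c d) = (\<lambda>c'. Seq c' d) ` residuals U c \<union> residuals U d"
| "residuals U (Branch f) = insert (Branch f) (\<Union>s \<in> U. residuals U (f s))"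
| "residuals U (Loop p c) = {Loop p c, Done} \<union> (\<lambda>c'. Seq c' (Loop p c)) ` residuals U c"
| "residuals U (Ask c d) = insert (Ask c d) (residuals U c \<union> residuals U d)"

lemma finite_residuals: "finite U \<Longrightarrow> finite (residuals U c)"
  by (induction c) auto

lemma self_in_residuals: "c \<in> residuals U c"
  by (induction c) auto

text \<open>Closure under a step, together with finiteness, is what lets residual programs serve as
  tape symbols.\<close>

lemma nxt_in_residuals: "c' \<in> residuals U c \<Longrightarrow> s \<in> U \<Longrightarrow> nxt c' s b \<in> residuals U c"
proof (induction c arbitrary: c')
  case (Seq c d)
  then show ?case by (auto simp: self_in_residuals)
next
  case (Loop p c)
  then show ?case by (auto simp: self_in_residuals split: if_splits)
next
  case (Branch f)
  from Branch.prems(1) consider "c' = Branch f" | t where "t \<in> U" "c' \<in> residuals U (f t)"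
    by auto
  then show ?case
  proof cases
    case 1
    then show ?thesis using Branch.prems(2) self_in_residuals[of "f s" U] by auto
  next
    case 2
    then show ?thesis using Branch.IH[of "f t" c'] Branch.prems(2) by auto
  qed
next
  case (Ask c d)
  then show ?case by (auto simp: self_in_residuals)
qed auto

section \<open>Big-step semantics of programs with a built-in space bound\<close>

locale oracle_programs =
  fixes k :: nat and \<Gamma> :: "symbol set" and Q :: "bool list set"
  assumes two_le: "2 \<le> k" and finite_alphabet: "finite \<Gamma>"
    and basic_symbols: "{Blank, Bit False, Bit True} \<subseteq> \<Gamma>"
begin

text \<open>The fixed value \<open>Blank\<close> from tape \<open>k\<close> on leaves only finitely
  many readings over the finite alphabet.\<close>

definition reads :: "(nat \<Rightarrow> tape) \<Rightarrow> nat \<Rightarrow> symbol" where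
  "reads T = (\<lambda>r. if r < k then read_tape (T r) else Blank)"

definition perform :: "(nat \<Rightarrow> symbol \<times> move) \<Rightarrow> (nat \<Rightarrow> tape) \<Rightarrow> nat \<Rightarrow> tape" where
  "perform \<alpha> T = (\<lambda>r. if r < k then act (\<alpha> r) (T r) else T r)"

definition ok :: "nat \<Rightarrow> (nat \<Rightarrow> tape) \<Rightarrow> bool" where
  "ok S T \<longleftrightarrow> (\<forall>r<k. snd (T r) < S \<and> range (fst (T r)) \<subseteq> \<Gamma>)"

text \<open>A derivation certifies termination, the final tapes, and that on the way all heads stay
  below \<open>S\<close> and all symbols in \<Gamma>. So there is no separate analysis of time or
  space.\<close>

inductive ex :: "nat \<Rightarrow> com \<Rightarrow> (nat \<Rightarrow> tape) \<Rightarrow> (nat \<Rightarrow> tape) \<Rightarrow> bool" for S where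
  ex_Done: "ok S T \<Longrightarrow> ex S Done T T"
| ex_Act: "ok S T \<Longrightarrow> T' = perform (f (reads T)) T \<Longrightarrow> ok S T' \<Longrightarrow> ex S (Act f) T T'"
| ex_Seq: "ex S c T T' \<Longrightarrow> ex S d T' T'' \<Longrightarrow> ex S (Seq c d) T T''"
| ex_Branch: "ok S T \<Longrightarrow> ex S (f (reads T)) T T' \<Longrightarrow> ex S (Branch f) T T'"
| ex_Loop_False: "ok S T \<Longrightarrow> \<not> p (reads T) \<Longrightarrow> ex S (Loop p c) T T"
| ex_Loop_True: "p (reads T) \<Longrightarrow> ex S c T T' \<Longrightarrow> ex S (Loop p c) T' T'' \<Longrightarrow> ex S (Loop p c) T T''"
| ex_Ask: "ok S T \<Longrightarrow> ex S (if query_word (T 1) \<in> Q then c else d) (T(1 := blank_tape)) T'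
           \<Longrightarrow> ex S (Ask c d) T T'"

lemma ex_ok: "ex S c T T' \<Longrightarrow> ok S T \<and> ok S T'"
  by (induction rule: ex.induct) auto

text \<open>For loops whose intermediate tapes can be written down in advance; the derivation is
  assembled from the last iteration backwards.\<close>

lemma ex_Loop_iterate:
  assumes "\<And>i. i < n \<Longrightarrow> p (reads (T i)) \<and> ex S c (T i) (T (Suc i))"
    and "\<not> p (reads (T n))" and "ok S (T n)"
  shows "ex S (Loop p c) (T 0) (T n)"
proof -
  have "ex S (Loop p c) (T (n - i)) (T n)" if "i \<le> n" for i
    using that
  proof (induction i)
    case 0
    then show ?case using assms by (simp add: ex_Loop_False)
  next
    case (Suc i)
    then have "ex S (Loop p c) (T (n - i)) (T n)" by simp
    moreover have "Suc (n - Suc i) = n - i" "n - Suc i < n" using Suc.prems by auto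
    ultimately show ?case using assms(1)[of "n - Suc i"] ex_Loop_True by metis
  qed
  from this[of n] show ?thesis by simp
qed

definition small_step :: "nat \<Rightarrow> com \<times> (nat \<Rightarrow> tape) \<Rightarrow> com \<times> (nat \<Rightarrow> tape) \<Rightarrow> bool" where
  "small_step S = (\<lambda>(c, T) (c', T'). c \<noteq> Done \<and> ok S T \<and> ok S T' \<and>
     (if asks c then T' = T(1 := blank_tape) \<and> c' = nxt c (reads T) (query_word (T 1) \<in> Q)
      else T' = perform (ops c (reads T)) T \<and> c' = nxt c (reads T) True))"

lemma perform_stay [simp]: "perform (\<lambda>r. (reads T r, MStay)) T = T"
proof
  fix r
  show "perform (\<lambda>r. (reads T r, MStay)) T r = T r"
    by (cases "T r") (simp add: perform_def reads_def read_tape_def)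
qed

lemma small_step_Seq:
  assumes "(small_step S)\<^sup>*\<^sup>* (c, T) (c', T')"
  shows "(small_step S)\<^sup>*\<^sup>* (Seq c d, T) (Seq c' d, T')"
  using assms
proof (induction rule: rtranclp_induct2)
  case (step c1 T1 c2 T2)
  then have "small_step S (Seq c1 d, T1) (Seq c2 d, T2)"
    by (auto simp: small_step_def)
  then show ?case using step.IH by (meson rtranclp.rtrancl_into_rtrancl)
qed simp

lemma ok_reset: "ok S T \<Longrightarrow> ok S (T(1 := blank_tape))"
  using basic_symbols two_le unfolding ok_def blank_tape_def by (auto; fastforce)

text \<open>Pure control steps (choosing a branch, testing a loop, leaving a finished first half)
  rewrite the scanned symbols, so each costs one step and leaves the tapes as they are.\<close>

lemma ex_small_steps: "ex S c T T' \<Longrightarrow> (small_step S)\<^sup>*\<^sup>* (c, T) (Done, T')"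
proof (induction rule: ex.induct)
  case (ex_Act T T' f)
  then have "small_step S (Act f, T) (Done, T')" by (simp add: small_step_def)
  then show ?case by blast
next
  case (ex_Seq c T T' d T'')
  have "small_step S (Seq Done d, T') (d, T')"
    using ex_ok[OF ex_Seq.hyps(1)] by (simp add: small_step_def)
  then show ?case using small_step_Seq[OF ex_Seq.IH(1)] ex_Seq.IH(2)
    by (meson converse_rtranclp_into_rtranclp rtranclp_trans)
next
  case (ex_Branch T f T')
  then have "small_step S (Branch f, T) (f (reads T), T)" by (simp add: small_step_def)
  then show ?case using ex_Branch.IH by (rule converse_rtranclp_into_rtranclp)
next
  case (ex_Loop_False T p c)
  then have "small_step S (Loop p c, T) (Done, T)" by (simp add: small_step_def)
  then show ?case by blast
next
  case (ex_Loop_True p T c T' T'')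
  then have "small_step S (Loop p c, T) (Seq c (Loop p c), T)"
    using ex_ok[OF ex_Loop_True.hyps(2)] by (simp add: small_step_def)
  moreover have "small_step S (Seq Done (Loop p c), T') (Loop p c, T')"
    using ex_ok[OF ex_Loop_True.hyps(2)] by (simp add: small_step_def)
  ultimately show ?case using small_step_Seq[OF ex_Loop_True.IH(1)] ex_Loop_True.IH(2)
    by (meson converse_rtranclp_into_rtranclp rtranclp_trans)
next
  case (ex_Ask T c d T')
  then have "small_step S (Ask c d, T) (if query_word (T 1) \<in> Q then c else d, T(1 := blank_tape))"
    using ok_reset by (simp add: small_step_def)
  then show ?case using ex_Ask.IH by (rule converse_rtranclp_into_rtranclp)
qed simp

definition read_range :: "(nat \<Rightarrow> symbol) set" where
  "read_range = {s. \<forall>r. (r \<in> {..<k} \<longrightarrow> s r \<in> \<Gamma>) \<and> (r \<notin> {..<k} \<longrightarrow> s r = Blank)}"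

lemma finite_read_range: "finite read_range"
  unfolding read_range_def by (rule finite_set_of_finite_funs) (auto simp: finite_alphabet)

lemma reads_in_range: "ok S T \<Longrightarrow> reads T \<in> read_range"
  unfolding ok_def reads_def read_range_def read_tape_def by auto

end

section \<open>The oracle machine of a program\<close>

locale compiled_program = oracle_programs +
  fixes main :: com
begin

definition points :: "com set" where
  "points = residuals read_range main"

text \<open>Residual programs contain functions, so no canonical numbering is at hand; any injection
  of the finite set \<open>points\<close> gives distinct symbols.\<close>

definition code :: "com \<Rightarrow> nat" where
  "code = (SOME f. inj_on f points)"

definition mark :: "com \<Rightarrow> symbol" where
  "mark c = Aux (code c)"

text \<open>A symbol that marks no residual stands for \<open>main\<close>, so the blank extra tape
  of the initial configuration already points to the start of the program.\<close>

definition point :: "symbol \<Rightarrow> com" where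
  "point x = (if x \<in> mark ` points then inv_into points mark x else main)"

lemma finite_points: "finite points"
  unfolding points_def by (rule finite_residuals[OF finite_read_range])

lemma inj_on_mark: "inj_on mark points"
proof -
  have "\<exists>f :: com \<Rightarrow> nat. inj_on f points"
    using finite_imp_inj_to_nat_seg[OF finite_points] by blast
  then have "inj_on code points" unfolding code_def by (rule someI_ex)
  then show ?thesis by (auto simp: inj_on_def mark_def)
qed

lemma point_mark [simp]: "c \<in> points \<Longrightarrow> point (mark c) = c"
  by (simp add: point_def inj_on_mark)

lemma point_Blank [simp]: "point Blank = main"
  by (auto simp: point_def mark_def)

lemma point_in_points: "point x \<in> points"
  by (auto simp: point_def points_def self_in_residuals inv_into_into)

text \<open>Clipping has no effect on configurations satisfying \<open>ok\<close>; it makes the machine well-formed for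
  arbitrary programs.\<close>

definition clip :: "symbol \<times> move \<Rightarrow> symbol \<times> move" where
  "clip x = (if fst x \<in> \<Gamma> then x else (Blank, snd x))"

text \<open>All control sits on tape \<open>k\<close>, so \<open>Start\<close> is the only working
  state. A query passes through \<open>Query\<close> and then \<open>Yes\<close> or
  \<open>No\<close>, and tape \<open>k\<close> is left alone until the answer selects the next
  residual. Readings outside \<open>read_range\<close> reject, so that \<open>nxt\<close> is only
  applied where the residuals are closed under it.\<close>

definition tm_delta :: "state \<Rightarrow> symbol list \<Rightarrow> state \<times> (symbol \<times> move) list" where
  "tm_delta q xs =
     (let c = point (xs ! k); s = (\<lambda>r. if r < k then xs ! r else Blank);
          stay = map (\<lambda>x. (x, MStay)) xs
      in if s \<notin> read_range then (Reject, stay)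
         else if q = Yes \<or> q = No then (Start, stay[k := (mark (nxt c s (q = Yes)), MStay)])
         else if c = Done then (if s 0 = Bit True then Accept else Reject, stay)
         else if asks c then (Query, stay)
         else (Start, map (\<lambda>r. clip (ops c s r)) [0..<k] @ [(mark (nxt c s True), MStay)]))"

definition tm :: otm where
  "tm = \<lparr>num_tapes = Suc k, states = {Start, Query, Yes, No, Accept, Reject},
         alphabet = \<Gamma> \<union> mark ` points, delta = tm_delta\<rparr>"

lemma otm_wf_tm: "otm_wf tm"
proof -
  have main: "q' \<in> states tm \<and> length as = Suc k \<and> fst ` set as \<subseteq> alphabet tm"
    if len: "length xs = Suc k" and sub: "set xs \<subseteq> alphabet tm" and eq: "tm_delta q xs = (q', as)"
    for q xs q' as
  proof -
    let ?s = "\<lambda>r. if r < k then xs ! r else Blank"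
    have *: "mark (nxt (point x) ?s b) \<in> alphabet tm" if "?s \<in> read_range" for x b
      using nxt_in_residuals[OF _ that] point_in_points by (auto simp: tm_def points_def)
    have stay: "length (map (\<lambda>x. (x, MStay)) xs) = Suc k" "fst ` set (map (\<lambda>x. (x, MStay)) xs) \<subseteq> alphabet tm"
      using len sub by (auto simp: image_image)
    have upd: "fst ` set (ys[k := (x, m)]) \<subseteq> alphabet tm" if "fst ` set ys \<subseteq> alphabet tm" "x \<in> alphabet tm" for ys x m
      using that set_update_subset_insert[of ys k "(x, m)"] by (force simp: image_subset_iff subset_iff)
    have clip: "fst (clip x) \<in> alphabet tm" for x
      using basic_symbols by (auto simp: clip_def tm_def)
    let ?c = "point (xs ! k)" and ?stay = "map (\<lambda>x. (x, MStay)) xs"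
    consider "as = ?stay" "q' \<in> {Reject, Accept, Query}"
      | "as = ?stay[k := (mark (nxt ?c ?s (q = Yes)), MStay)]" "q' = Start" "?s \<in> read_range"
      | "as = map (\<lambda>r. clip (ops ?c ?s r)) [0..<k] @ [(mark (nxt ?c ?s True), MStay)]" "q' = Start" "?s \<in> read_range"
      using eq by (auto simp: tm_delta_def Let_def split: if_splits)
    then show ?thesis
    proof cases
      case 1
      then show ?thesis using stay by (auto simp: tm_def)
    next
      case 2
      then show ?thesis using upd[OF stay(2) *] stay(1) by (simp add: tm_def)
    next
      case 3
      have clip_ops: "fst (clip (ops ?c ?s r)) \<in> alphabet tm" for r using clip by blast
      have "fst ` set as \<subseteq> alphabet tm"
        unfolding 3(1) using *[OF 3(3)] clip_ops by (auto simp: image_image)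
      then show ?thesis using 3 by (simp add: tm_def)
    qed
  qed
  show ?thesis
    unfolding otm_wf_def
  proof (intro conjI ballI allI impI)
    fix q xs
    assume "length xs = num_tapes tm \<and> set xs \<subseteq> alphabet tm"
    then show "case delta tm q xs of (q', as) \<Rightarrow>
        q' \<in> states tm \<and> length as = num_tapes tm \<and> fst ` set as \<subseteq> alphabet tm"
      using main[of xs q] by (cases "tm_delta q xs") (simp add: tm_def)
  qed (use two_le finite_alphabet finite_points basic_symbols in \<open>auto simp: tm_def\<close>)
qed

definition pc_tape :: "symbol \<Rightarrow> tape" where
  "pc_tape x = ((\<lambda>_. Blank)(0 := x), 0)"

definition conf :: "state \<Rightarrow> (nat \<Rightarrow> tape) \<Rightarrow> symbol \<Rightarrow> config" where
  "conf q T x = (q, map T [0..<k] @ [pc_tape x])"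

definition bounded :: "nat \<Rightarrow> config \<Rightarrow> bool" where
  "bounded S cf \<longleftrightarrow> (\<forall>t \<in> set (snd cf). snd t < S)"

definition leads :: "nat \<Rightarrow> config \<Rightarrow> config \<Rightarrow> bool" where
  "leads S cf cf' \<longleftrightarrow> (\<exists>n. (step tm Q ^^ n) cf = cf' \<and> (\<forall>i\<le>n. bounded S ((step tm Q ^^ i) cf)))"

lemma leads_refl: "bounded S cf \<Longrightarrow> leads S cf cf"
  unfolding leads_def by (rule exI[of _ 0]) simp

lemma leads_step: "bounded S cf \<Longrightarrow> leads S (step tm Q cf) cf' \<Longrightarrow> leads S cf cf'"
proof -
  assume b: "bounded S cf" and "leads S (step tm Q cf) cf'"
  then obtain n where n: "(step tm Q ^^ n) (step tm Q cf) = cf'"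
    "\<forall>i\<le>n. bounded S ((step tm Q ^^ i) (step tm Q cf))" unfolding leads_def by blast
  have "bounded S ((step tm Q ^^ i) cf)" if "i \<le> Suc n" for i
    using that b n(2) by (cases i) (auto simp: funpow_Suc_right simp del: funpow.simps)
  then show ?thesis unfolding leads_def
    by (intro exI[of _ "Suc n"]) (simp add: funpow_Suc_right n(1) del: funpow.simps)
qed

lemma leads_trans: "leads S x y \<Longrightarrow> leads S y z \<Longrightarrow> leads S x z"
proof -
  assume "leads S x y" "leads S y z"
  then obtain m n where m: "(step tm Q ^^ m) x = y" "\<forall>i\<le>m. bounded S ((step tm Q ^^ i) x)"
    and n: "(step tm Q ^^ n) y = z" "\<forall>i\<le>n. bounded S ((step tm Q ^^ i) y)"
    unfolding leads_def by blast
  have "bounded S ((step tm Q ^^ i) x)" if "i \<le> n + m" for i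
  proof (cases "i \<le> m")
    case False
    then obtain j where "i = j + m" by (metis le_add_diff_inverse2 nat_le_linear)
    then show ?thesis using n(2) m(1) that by (simp add: funpow_add)
  qed (use m in simp)
  then show ?thesis unfolding leads_def
    by (intro exI[of _ "n + m"]) (simp add: funpow_add m(1) n(1))
qed

lemma bounded_conf: "ok S T \<Longrightarrow> bounded S (conf q T x)"
  \<comment> \<open>The head of the program tape stays on cell 0, and \<open>S\<close> is positive
    because it exceeds the head position on some tape of the program.\<close>
  using two_le by (auto simp: bounded_def conf_def ok_def pc_tape_def) (metis gr0I not_less0 order_less_le_trans zero_less_numeral)

lemma reads_conf:
  "map read_tape (snd (conf q T x)) = map (reads T) [0..<k] @ [x]"
  "(\<lambda>r. if r < k then (map (reads T) [0..<k] @ [x]) ! r else Blank) = reads T"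
  by (auto simp: conf_def pc_tape_def read_tape_def reads_def nth_append)

lemma tm_delta_conf:
  assumes "ok S T"
  shows "tm_delta q (map (reads T) [0..<k] @ [x]) =
     (let c = point x; stay = map (\<lambda>r. (reads T r, MStay)) [0..<k]
      in if q = Yes \<or> q = No then (Start, stay @ [(mark (nxt c (reads T) (q = Yes)), MStay)])
         else if c = Done then (if reads T 0 = Bit True then Accept else Reject, stay @ [(x, MStay)])
         else if asks c then (Query, stay @ [(x, MStay)])
         else (Start, map (\<lambda>r. clip (ops c (reads T) r)) [0..<k] @ [(mark (nxt c (reads T) True), MStay)]))"
proof -
  have 1: "(map (reads T) [0..<k] @ [x]) ! k = x" by (simp add: nth_append)
  have 2: "(map f [0..<k] @ [y])[k := z] = map f [0..<k] @ [z]" for f :: "nat \<Rightarrow> symbol \<times> move" and y z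
    by (simp add: list_update_append)
  show ?thesis
    unfolding tm_delta_def 1 reads_conf(2)
    by (simp add: reads_in_range[OF assms] Let_def 2 comp_def)
qed

lemma map2_act:
  "map2 act (map f [0..<k] @ [(y, MStay)]) (map T [0..<k] @ [pc_tape x]) = map (perform f T) [0..<k] @ [pc_tape y]"
proof -
  have "map2 act (map f [0..<k]) (map T [0..<k]) = map (perform f T) [0..<k]"
    by (rule nth_equalityI) (auto simp: perform_def)
  then show ?thesis by (simp add: pc_tape_def fun_eq_iff)
qed

lemma step_conf:
  assumes "ok S T" "q = Start \<or> q = Yes \<or> q = No"
  shows "step tm Q (conf q T x) =
    (let c = point x
     in if q = Yes \<or> q = No then conf Start T (mark (nxt c (reads T) (q = Yes)))
        else if c = Done then conf (if reads T 0 = Bit True then Accept else Reject) T x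
        else if asks c then conf Query T x
        else conf Start (perform (\<lambda>r. clip (ops c (reads T) r)) T) (mark (nxt c (reads T) True)))"
proof -
  have "step tm Q (conf q T x) = (case tm_delta q (map (reads T) [0..<k] @ [x]) of (q', as) \<Rightarrow> (q', map2 act as (map T [0..<k] @ [pc_tape x])))"
    using assms(2) reads_conf(1)[of q T x] unfolding conf_def snd_conv step.simps
    by (auto simp only: tm_def otm.simps symbol.simps state.simps if_False simp_thms)
  then show ?thesis
    unfolding tm_delta_conf[OF assms(1)]
    by (simp add: Let_def map2_act conf_def del: zip_append map_append)
qed

text \<open>The symbol just written occurs on the resulting tape, so \<open>ok\<close> after the
  step already forces it into \<Gamma>.\<close>

lemma clip_perform:
  assumes "ok S (perform f T)"
  shows "perform (\<lambda>r. clip (f r)) T = perform f T"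
proof
  fix r
  have "fst (f r) \<in> \<Gamma>" if "r < k"
  proof -
    obtain u h where T: "T r = (u, h)" by fastforce
    obtain s d where f: "f r = (s, d)" by fastforce
    have "range (fst (perform f T r)) \<subseteq> \<Gamma>" using assms that by (simp add: ok_def)
    then have "range (u(h := s)) \<subseteq> \<Gamma>" using that by (simp add: perform_def T f)
    then show ?thesis by (auto simp: f fun_upd_def image_subset_iff split: if_splits)
  qed
  then show "perform (\<lambda>r. clip (f r)) T r = perform f T r"
    by (auto simp: perform_def clip_def)
qed

lemma small_step_leads:
  assumes "small_step S (c, T) (c', T')" "point x = c"
  shows "\<exists>y. point y = c' \<and> leads S (conf Start T x) (conf Start T' y)"
proof -
  have c: "c \<in> points" using point_in_points assms(2) by blast
  have ok: "ok S T" "ok S T'" "c \<noteq> Done" using assms(1) by (simp_all add: small_step_def)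
  have nxt: "nxt c (reads T) b \<in> points" for b
    using c nxt_in_residuals[OF _ reads_in_range[OF ok(1)]] by (simp add: points_def)
  note b = bounded_conf[OF ok(1)] bounded_conf[OF ok(2)]
  show ?thesis
  proof (cases "asks c")
    case True
    let ?a = "query_word (T 1) \<in> Q"
    let ?y = "mark (nxt c (reads T) ?a)"
    have T': "T' = T(1 := blank_tape)" "c' = nxt c (reads T) ?a"
      using assms(1) True by (simp_all add: small_step_def)
    \<comment> \<open>The answer is processed when the oracle tape is already erased; this does no
      harm, as the successor of an asking program depends on the answer but not on the scanned
      symbols.\<close>
    have nr: "nxt c (reads T') v = nxt c (reads T) v" if "asks c" for v
      using that by (induction c) auto
    have "step tm Q (conf Start T x) = conf Query T x"
      using step_conf[OF ok(1)] True ok(3) assms(2) by simp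
    moreover have "step tm Q (conf Query T x) = conf (if ?a then Yes else No) T' x"
    proof -
      have "(map T [0..<k] @ [pc_tape x]) ! 1 = T 1" using two_le by (simp add: nth_append)
      moreover have "(map T [0..<k] @ [pc_tape x])[1 := blank_tape] = map T' [0..<k] @ [pc_tape x]"
        using two_le by (auto simp: T' list_update_append intro!: nth_equalityI)
      ultimately show ?thesis by (simp add: conf_def)
    qed
    moreover have "step tm Q (conf (if ?a then Yes else No) T' x) = conf Start T' ?y"
      using step_conf[OF ok(2)] assms(2) nr[OF True] by simp
    ultimately have "leads S (conf Start T x) (conf Start T' ?y)"
      by (metis leads_step leads_refl b)
    then show ?thesis using nxt T'(2) by (metis point_mark)
  next
    case False
    have T': "T' = perform (ops c (reads T)) T" "c' = nxt c (reads T) True"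
      using assms(1) False by (simp_all add: small_step_def)
    have "step tm Q (conf Start T x) = conf Start T' (mark (nxt c (reads T) True))"
      using step_conf[OF ok(1), of Start x] False ok(3) assms(2) clip_perform ok(2) T'(1) by (simp add: Let_def)
    then have "leads S (conf Start T x) (conf Start T' (mark (nxt c (reads T) True)))"
      by (metis leads_step leads_refl b)
    then show ?thesis using nxt T'(2) by (metis point_mark)
  qed
qed

lemma small_steps_leads:
  assumes "(small_step S)\<^sup>*\<^sup>* (c, T) (c', T')" "point x = c" "ok S T"
  shows "\<exists>y. point y = c' \<and> leads S (conf Start T x) (conf Start T' y)"
  using assms(1)
proof (induction rule: rtranclp_induct2)
  case refl
  then show ?case using assms leads_refl bounded_conf by blast
next
  case (step c1 T1 c2 T2)
  then show ?case by (meson small_step_leads leads_trans)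
qed

lemma run_halts:
  assumes "ex (poly p (length x)) main (\<lambda>r. if r = 0 then input_tape x else blank_tape) T'"
  defines "q \<equiv> if read_tape (T' 0) = Bit True then Accept else Reject"
  shows "\<exists>n. fst (run tm Q x n) = q" and "\<forall>t \<in> set (snd (run tm Q x n)). snd t < poly p (length x)"
proof -
  let ?S = "poly p (length x)"
  let ?T = "\<lambda>r. if r = 0 then input_tape x else blank_tape"
  have ok: "ok ?S ?T" "ok ?S T'" using ex_ok[OF assms(1)] by auto
  obtain y where y: "point y = Done" "leads ?S (conf Start ?T Blank) (conf Start T' y)"
    using small_steps_leads[OF ex_small_steps[OF assms(1)], of Blank] ok by auto
  have "step tm Q (conf Start T' y) = conf q T' y"
    using step_conf[OF ok(2), of Start y] y(1) two_le by (simp add: q_def reads_def)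
  then have "leads ?S (conf Start T' y) (conf q T' y)"
    by (metis leads_step leads_refl bounded_conf ok(2))
  then have "leads ?S (conf Start ?T Blank) (conf q T' y)" using leads_trans y(2) by blast
  moreover have "conf Start ?T Blank = init_config tm x"
  proof -
    have "map ?T [0..<k] @ [pc_tape Blank] = input_tape x # replicate k blank_tape"
      using two_le by (intro nth_equalityI) (auto simp: nth_append nth_Cons pc_tape_def blank_tape_def split: nat.split)
    then show ?thesis by (simp add: conf_def init_config_def tm_def)
  qed
  ultimately obtain m where m: "run tm Q x m = conf q T' y" "\<forall>i\<le>m. bounded ?S (run tm Q x i)"
    unfolding leads_def run_def by auto
  \<comment> \<open>Halting configurations are fixed points, so the space bound up to step
    \<open>m\<close> extends to all later steps.\<close>
  have halted: "run tm Q x (m + j) = conf q T' y" for j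
    by (induction j) (use m(1) in \<open>auto simp: run_def conf_def q_def\<close>)
  show "\<exists>n. fst (run tm Q x n) = q" using m(1) by (intro exI[of _ m]) (simp add: conf_def)
  have "bounded ?S (run tm Q x n)"
  proof (cases "n \<le> m")
    case False
    then show ?thesis using halted[of "n - m"] m by force
  qed (use m in blast)
  then show "\<forall>t \<in> set (snd (run tm Q x n)). snd t < ?S" by (simp add: bounded_def)
qed

end

text \<open>What remains of machine construction is to exhibit one program and, for each input, an
  \<open>ex\<close> derivation in polynomial space. Tapes, alphabet and program are fixed before the
  input is known.\<close>

theorem (in oracle_programs) program_reduces:
  assumes "\<And>x. \<exists>T. ex (poly p (length x)) main (\<lambda>r. if r = 0 then input_tape x else blank_tape) T
                  \<and> (read_tape (T 0) = Bit True \<longleftrightarrow> x \<in> P)"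
  shows "PSPACE_Turing_reducible P Q"
proof -
  interpret compiled_program k \<Gamma> Q main by unfold_locales
  have "\<exists>n. fst (run tm Q x n) = (if x \<in> P then Accept else Reject)" for x
  proof -
    obtain T where T: "ex (poly p (length x)) main (\<lambda>r. if r = 0 then input_tape x else blank_tape) T"
      "read_tape (T 0) = Bit True \<longleftrightarrow> x \<in> P" using assms by blast
    show ?thesis using run_halts(1)[OF T(1)] T(2) by simp
  qed
  moreover have "\<forall>t \<in> set (snd (run tm Q x n)). snd t < poly p (length x)" for x n
    using assms[of x] run_halts(2)[of p x] by blast
  ultimately show ?thesis
    unfolding PSPACE_Turing_reducible_def decides_def poly_space_def using otm_wf_tm by blast
qed

section \<open>Tapes as stacks\<close>

instance symbol :: countable by countable_datatype
instance state :: countable by countable_datatype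

datatype phase = Tag | Tag2 bool | Index bool | IndexBit | Mod nat nat bool | ModBit nat nat | Fail

instance phase :: countable by countable_datatype

text \<open>One type for whatever a stack holds: bits, formula tokens (with the guess digit in
  \<open>TDia\<close>), the parser's phase, a state or symbol of the simulated machine, and a marked
  first input bit.\<close>

datatype tok = TBit bool | TSep | TEnd | TVar | TBot | TImp | TDia nat nat
  | TPhase phase | TState state | TSym symbol | TMark bool

instance tok :: countable by countable_datatype

text \<open>Bits stand for themselves, so a stack of bits is a query word as it is. Everything else
  becomes an \<open>Aux\<close> symbol; nothing becomes \<open>Blank\<close>, which signals the
  empty stack.\<close>

definition enc :: "tok \<Rightarrow> symbol" where
  "enc t = (case t of TBit b \<Rightarrow> Bit b | _ \<Rightarrow> Aux (to_nat t))"

lemma enc_TBit [simp]: "enc (TBit b) = Bit b"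
  by (simp add: enc_def)

lemma enc_eq_iff [simp]: "enc t = enc u \<longleftrightarrow> t = u"
  by (auto simp: enc_def split: tok.splits)

lemma enc_neq_Blank [simp]: "enc t \<noteq> Blank" "Blank \<noteq> enc t"
  by (auto simp: enc_def split: tok.splits)

lemma enc_eq_Bit_iff [simp]: "enc t = Bit b \<longleftrightarrow> t = TBit b"
  by (auto simp: enc_def split: tok.splits)

definition dec :: "symbol \<Rightarrow> tok option" where
  "dec x = (if x \<in> range enc then Some (inv enc x) else None)"

lemma dec_enc [simp]: "dec (enc t) = Some t"
  by (simp add: dec_def inj_def)

lemma dec_Blank [simp]: "dec Blank = None"
  by (auto simp: dec_def)

fun peek :: "tok list \<Rightarrow> tok option" where
  "peek [] = None"
| "peek (t # ts) = Some t"

text \<open>The top of the stack is the rightmost nonblank cell.\<close>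

definition stk :: "tok list \<Rightarrow> tape" where
  "stk xs = ((\<lambda>i. if i < length xs then enc (rev xs ! i) else Blank), length xs - 1)"

lemma stk_Nil [simp]: "stk [] = blank_tape"
  by (simp add: stk_def blank_tape_def)

lemma read_stk: "read_tape (stk xs) = (case xs of [] \<Rightarrow> Blank | x # _ \<Rightarrow> enc x)"
  by (auto simp: stk_def read_tape_def nth_append split: list.split)

lemma dec_read_stk [simp]: "dec (read_tape (stk xs)) = peek xs"
  by (cases xs) (simp_all add: read_stk del: stk_Nil)

lemma stk_pop: "act (Blank, MLeft) (stk xs) = stk (tl xs)"
  by (cases xs) (auto simp: stk_def nth_append fun_eq_iff)

text \<open>On the empty stack the head already stands on the free cell 0; otherwise it stands on
  the top, one cell to the left of the free one. The first action moves accordingly.\<close>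

lemma stk_push:
  "act (enc t, MStay) (act (read_tape (stk xs), if read_tape (stk xs) = Blank then MStay else MRight) (stk xs))
   = stk (t # xs)"
  by (cases xs) (auto simp: stk_def read_tape_def nth_append fun_eq_iff less_Suc_eq)

text \<open>The shape that allows a tape to be erased with the head at an unknown place: run right
  to the first blank, then erase leftwards until a blank is read.\<close>

definition filled :: "nat \<Rightarrow> tape \<Rightarrow> bool" where
  "filled m t \<longleftrightarrow> snd t \<le> m \<and> (\<forall>i. fst t i = Blank \<longleftrightarrow> m \<le> i)"

section \<open>Stack operations as programs\<close>

context oracle_programs
begin

lemma ok_upd:
  "ok S T \<Longrightarrow> ok S (T(r := t)) \<longleftrightarrow> (r < k \<longrightarrow> snd t < S \<and> range (fst t) \<subseteq> \<Gamma>)"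
  by (auto simp: ok_def)

definition single :: "nat \<Rightarrow> (symbol \<Rightarrow> symbol \<times> move) \<Rightarrow> com" where
  "single r f = Act (\<lambda>s r'. if r' = r then f (s r) else (s r', MStay))"

lemma ex_single:
  assumes "r < k" "ok S T" "T' = T(r := act (f (read_tape (T r))) (T r))" "ok S T'"
  shows "ex S (single r f) T T'"
  unfolding single_def
proof (rule ex_Act[OF assms(2) _ assms(4)])
  have "act (read_tape t, MStay) t = t" for t
    by (cases t) (simp add: read_tape_def)
  then show "T' = perform (\<lambda>r'. if r' = r then f (reads T r) else (reads T r', MStay)) T"
    unfolding assms(3) using assms(1) by (auto simp: perform_def reads_def fun_eq_iff)
qed

definition Pop :: "nat \<Rightarrow> com" where
  "Pop r = single r (\<lambda>_. (Blank, MLeft))"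

definition Push :: "nat \<Rightarrow> tok \<Rightarrow> com" where
  "Push r t = Seq (single r (\<lambda>x. (x, if x = Blank then MStay else MRight))) (single r (\<lambda>_. (enc t, MStay)))"

definition On :: "nat \<Rightarrow> (tok option \<Rightarrow> com) \<Rightarrow> com" where
  "On r f = Branch (\<lambda>s. f (dec (s r)))"

definition While :: "nat \<Rightarrow> (tok option \<Rightarrow> bool) \<Rightarrow> com \<Rightarrow> com" where
  "While r p c = Loop (\<lambda>s. p (dec (s r))) c"

definition legal :: "tok set" where
  "legal = {t. enc t \<in> \<Gamma>}"

lemma TBit_legal [simp]: "TBit b \<in> legal"
  using basic_symbols by (cases b) (auto simp: legal_def)

text \<open>A nonempty stack of length \<open>l\<close> has its head on cell \<open>l - 1\<close>,
  so lengths up to \<open>S\<close> are allowed; the empty stack has it on cell 0, whence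
  \<open>0 < S\<close>.\<close>

definition good :: "nat \<Rightarrow> (nat \<Rightarrow> tok list) \<Rightarrow> bool" where
  "good S s \<longleftrightarrow> 0 < S \<and> (\<forall>r<k. length (s r) \<le> S \<and> set (s r) \<subseteq> legal)"

lemma good_upd [simp]:
  "good S s \<Longrightarrow> good S (s(r := xs)) \<longleftrightarrow> (r < k \<longrightarrow> length xs \<le> S \<and> set xs \<subseteq> legal)"
  by (auto simp: good_def)

lemma goodD: "good S s \<Longrightarrow> r < k \<Longrightarrow> length (s r) \<le> S" "good S s \<Longrightarrow> r < k \<Longrightarrow> set (s r) \<subseteq> legal"
  by (auto simp: good_def)

definition stacks :: "(nat \<Rightarrow> tok list) \<Rightarrow> nat \<Rightarrow> tape" where
  "stacks s = (\<lambda>r. stk (s r))"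

lemma stacks_upd: "stacks (s(r := xs)) = (stacks s)(r := stk xs)"
  by (auto simp: stacks_def)

lemma ok_stacks: "good S s \<Longrightarrow> ok S (stacks s)"
proof -
  assume g: "good S s"
  have "snd (stk (s r)) < S \<and> range (fst (stk (s r))) \<subseteq> \<Gamma>" if "r < k" for r
  proof -
    have "length (s r) \<le> S" "set (s r) \<subseteq> legal" "0 < S" using g that by (auto simp: good_def)
    moreover have "enc (rev (s r) ! i) \<in> \<Gamma>" if "i < length (s r)" for i
      using \<open>set (s r) \<subseteq> legal\<close> that nth_mem[of i "rev (s r)"] by (auto simp: legal_def)
    ultimately show ?thesis using basic_symbols by (auto simp: stk_def)
  qed
  then show ?thesis by (simp add: ok_def stacks_def)
qed

text \<open>Only the end points have to be stacks. In between, for instance during a simulation, the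
  tapes may have any form permitted by \<open>ok\<close>.\<close>

definition sx :: "nat \<Rightarrow> com \<Rightarrow> (nat \<Rightarrow> tok list) \<Rightarrow> (nat \<Rightarrow> tok list) \<Rightarrow> bool" where
  "sx S c s s' \<longleftrightarrow> good S s \<and> good S s' \<and> ex S c (stacks s) (stacks s')"

lemma sx_good: "sx S c s s' \<Longrightarrow> good S s" "sx S c s s' \<Longrightarrow> good S s'"
  by (simp_all add: sx_def)

lemma sx_eq: "sx S c s s' \<Longrightarrow> s' = s'' \<Longrightarrow> sx S c s s''"
  by simp

lemma sx_Done: "good S s \<Longrightarrow> sx S Done s s"
  by (simp add: sx_def ex_Done ok_stacks)

lemma sx_Seq: "sx S c s s' \<Longrightarrow> sx S d s' s'' \<Longrightarrow> sx S (Seq c d) s s''"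
  by (auto simp: sx_def intro: ex_Seq)

lemma sx_Pop:
  assumes "r < k" "good S s"
  shows "sx S (Pop r) s (s(r := tl (s r)))"
proof -
  have "set (tl (s r)) \<subseteq> set (s r)" by (cases "s r") auto
  then have g: "good S (s(r := tl (s r)))"
    using goodD[OF assms(2,1)] assms by auto
  have "ex S (Pop r) (stacks s) (stacks (s(r := tl (s r))))"
    unfolding Pop_def
    by (rule ex_single[OF assms(1) ok_stacks[OF assms(2)] _ ok_stacks[OF g]])
      (simp add: stacks_upd stk_pop, simp add: stacks_def stk_pop)
  then show ?thesis using g assms by (simp add: sx_def)
qed

lemma sx_Push:
  assumes "r < k" "good S s" "length (s r) < S" "t \<in> legal"
  shows "sx S (Push r t) s (s(r := t # s r))"
proof -
  let ?T = "stacks s"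
  let ?x = "read_tape (?T r)"
  let ?t = "act (?x, if ?x = Blank then MStay else MRight) (?T r)"
  have g: "good S (s(r := t # s r))"
    using goodD[OF assms(2,1)] assms by auto
  have "?T r = stk (s r)" by (simp add: stacks_def)
  have "snd ?t < S" using assms(3)
    by (cases "s r") (auto simp: \<open>?T r = _\<close> read_stk stk_def read_tape_def)
  moreover have "fst ?t = fst (?T r)" by (auto simp: stacks_def stk_def read_tape_def)
  moreover have "range (fst (?T r)) \<subseteq> \<Gamma>"
    using ok_stacks[OF assms(2)] assms(1) by (simp add: ok_def)
  ultimately have ok: "ok S (?T(r := ?t))"
    using ok_stacks[OF assms(2)] by (simp add: ok_upd)
  have eq: "stacks (s(r := t # s r)) = (?T(r := ?t))(r := act (enc t, MStay) ?t)"
    using stk_push[of t "s r"] by (simp add: stacks_upd \<open>?T r = _\<close>)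
  have "ex S (Push r t) ?T (stacks (s(r := t # s r)))"
    unfolding Push_def
  proof (rule ex_Seq)
    show "ex S (single r (\<lambda>x. (x, if x = Blank then MStay else MRight))) ?T (?T(r := ?t))"
      by (rule ex_single[OF assms(1) ok_stacks[OF assms(2)] _ ok]) simp
    show "ex S (single r (\<lambda>_. (enc t, MStay))) (?T(r := ?t)) (stacks (s(r := t # s r)))"
      by (rule ex_single[OF assms(1) ok _ ok_stacks[OF g]]) (simp add: eq)
  qed
  then show ?thesis using g assms by (simp add: sx_def)
qed

lemma dec_reads [simp]: "r < k \<Longrightarrow> dec (reads (stacks s) r) = peek (s r)"
  by (simp add: reads_def stacks_def)

lemma sx_On:
  assumes "r < k" "sx S (f (peek (s r))) s s'"
  shows "sx S (On r f) s s'"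
  using assms by (auto simp: sx_def On_def intro!: ex_Branch ok_stacks)

lemma sx_While_False:
  "r < k \<Longrightarrow> good S s \<Longrightarrow> \<not> p (peek (s r)) \<Longrightarrow> sx S (While r p c) s s"
  by (auto simp: sx_def While_def intro!: ex_Loop_False ok_stacks)

lemma sx_While_True:
  "r < k \<Longrightarrow> p (peek (s r)) \<Longrightarrow> sx S c s s' \<Longrightarrow> sx S (While r p c) s' s'' \<Longrightarrow> sx S (While r p c) s s''"
  unfolding sx_def While_def by (auto intro: ex_Loop_True)

primrec pushes :: "nat \<Rightarrow> tok list \<Rightarrow> com" where
  "pushes r [] = Done"
| "pushes r (t # ts) = Seq (pushes r ts) (Push r t)"

lemma sx_pushes:
  assumes "r < k" "good S s" "length ts + length (s r) \<le> S" "set ts \<subseteq> legal"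
  shows "sx S (pushes r ts) s (s(r := ts @ s r))"
  using assms(3,4)
proof (induction ts)
  case (Cons t ts)
  then have "sx S (pushes r ts) s (s(r := ts @ s r))" by (simp del: fun_upd_apply)
  moreover from sx_good(2)[OF this]
  have "sx S (Push r t) (s(r := ts @ s r)) (s(r := t # ts @ s r))"
    using sx_Push[of r S "s(r := ts @ s r)" t] Cons.prems assms(1) by simp
  ultimately show ?case unfolding pushes.simps append.simps by (rule sx_Seq)
qed (simp add: sx_Done assms)

definition Move :: "nat \<Rightarrow> (tok option \<Rightarrow> bool) \<Rightarrow> nat \<Rightarrow> com" where
  "Move r p r' = While r p (On r (\<lambda>t. Seq (Pop r) (Push r' (the t))))"

lemma sx_Move:
  assumes "r < k" "r' < k" "r \<noteq> r'" "good S s" "s r = xs @ ys" "\<forall>x \<in> set xs. p (Some x)" "\<not> p (peek ys)"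
    and "length xs + length (s r') \<le> S"
  shows "sx S (Move r p r') s (s(r := ys, r' := rev xs @ s r'))"
  using assms(4-)
proof (induction xs arbitrary: s)
  case Nil
  then have "s(r := ys, r' := rev [] @ s r') = s" by auto
  then show ?case using Nil assms(1) by (simp add: Move_def sx_While_False del: fun_upd_apply)
next
  case (Cons x xs)
  have IH: "sx S (Move r p r') t (t(r := ys, r' := rev xs @ t r'))"
    if "good S t" "t r = xs @ ys" "length xs + length (t r') \<le> S" for t
    using Cons.IH[of t] that Cons.prems(3,4) by (simp del: fun_upd_apply)
  let ?s = "s(r := xs @ ys, r' := x # s r')"
  have legal: "x \<in> legal" using goodD(2)[OF Cons.prems(1) assms(1)] Cons.prems(2) by auto
  have step: "sx S (On r (\<lambda>t. Seq (Pop r) (Push r' (the t)))) s ?s"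
  proof (rule sx_On[OF assms(1)], rule sx_Seq)
    show "sx S (Pop r) s (s(r := xs @ ys))"
      using sx_Pop[OF assms(1) Cons.prems(1)] Cons.prems(2) by simp
    from sx_good(2)[OF this] show "sx S (Push r' (the (peek (s r)))) (s(r := xs @ ys)) ?s"
      using sx_Push[OF assms(2), of S "s(r := xs @ ys)" x] assms(3) Cons.prems(2,5) legal by simp
  qed
  have "sx S (Move r p r') ?s (?s(r := ys, r' := rev xs @ ?s r'))"
  proof (rule IH)
    show "good S ?s" using step by (rule sx_good(2))
    show "?s r = xs @ ys" "length xs + length (?s r') \<le> S" using assms(3) Cons.prems(5) by simp_all
  qed
  moreover have "?s(r := ys, r' := rev xs @ ?s r') = s(r := ys, r' := rev (x # xs) @ s r')"
    using assms(3) by (auto simp: fun_eq_iff)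
  ultimately have "sx S (Move r p r') ?s (s(r := ys, r' := rev (x # xs) @ s r'))" by (rule back_subst)
  with step show ?case unfolding Move_def
    by (rule sx_While_True[OF assms(1), rotated]) (use Cons.prems(2,3) in simp)
qed

text \<open>Reading a stack destroys it, so copying a part means moving it aside and then restoring
  it together with its duplicate.\<close>

definition Move2 :: "nat \<Rightarrow> (tok option \<Rightarrow> bool) \<Rightarrow> nat \<Rightarrow> nat \<Rightarrow> com" where
  "Move2 r p r' r'' = While r p (On r (\<lambda>t. Seq (Pop r) (Seq (Push r' (the t)) (Push r'' (the t)))))"

lemma sx_Move2:
  assumes "r < k" "r' < k" "r'' < k" "distinct [r, r', r'']" "good S s" "s r = xs @ ys" "\<forall>x \<in> set xs. p (Some x)" "\<not> p (peek ys)"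
    and "length xs + length (s r') \<le> S" "length xs + length (s r'') \<le> S"
  shows "sx S (Move2 r p r' r'') s (s(r := ys, r' := rev xs @ s r', r'' := rev xs @ s r''))"
  using assms(5-)
proof (induction xs arbitrary: s)
  case Nil
  then have "s(r := ys, r' := rev [] @ s r', r'' := rev [] @ s r'') = s" by auto
  then show ?case using Nil assms(1) by (simp add: Move2_def sx_While_False del: fun_upd_apply)
next
  case (Cons x xs)
  have IH: "sx S (Move2 r p r' r'') t (t(r := ys, r' := rev xs @ t r', r'' := rev xs @ t r''))"
    if "good S t" "t r = xs @ ys" "length xs + length (t r') \<le> S" "length xs + length (t r'') \<le> S" for t
    using Cons.IH[of t] that Cons.prems(3,4) by (simp del: fun_upd_apply)
  let ?s1 = "s(r := xs @ ys)" let ?s2 = "?s1(r' := x # s r')" let ?s = "?s2(r'' := x # s r'')"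
  have legal: "x \<in> legal" using goodD(2)[OF Cons.prems(1) assms(1)] Cons.prems(2) by auto
  have step: "sx S (On r (\<lambda>t. Seq (Pop r) (Seq (Push r' (the t)) (Push r'' (the t))))) s ?s"
  proof (rule sx_On[OF assms(1)], rule sx_Seq, rule_tac [2] sx_Seq)
    show 1: "sx S (Pop r) s ?s1"
      using sx_Pop[OF assms(1) Cons.prems(1)] Cons.prems(2) by simp
    show 2: "sx S (Push r' (the (peek (s r)))) ?s1 ?s2"
      using sx_Push[OF assms(2) sx_good(2)[OF 1], of x] assms(4) Cons.prems(2,5) legal by simp
    show "sx S (Push r'' (the (peek (s r)))) ?s2 ?s"
      using sx_Push[OF assms(3) sx_good(2)[OF 2], of x] assms(4) Cons.prems(2,6) legal by simp
  qed
  have "sx S (Move2 r p r' r'') ?s (?s(r := ys, r' := rev xs @ ?s r', r'' := rev xs @ ?s r''))"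
  proof (rule IH)
    show "good S ?s" using step by (rule sx_good(2))
    show "?s r = xs @ ys" "length xs + length (?s r') \<le> S" "length xs + length (?s r'') \<le> S"
      using assms(4) Cons.prems(5,6) by simp_all
  qed
  moreover have "?s(r := ys, r' := rev xs @ ?s r', r'' := rev xs @ ?s r'') = s(r := ys, r' := rev (x # xs) @ s r', r'' := rev (x # xs) @ s r'')"
    using assms(4) by (auto simp: fun_eq_iff)
  ultimately have "sx S (Move2 r p r' r'') ?s (s(r := ys, r' := rev (x # xs) @ s r', r'' := rev (x # xs) @ s r''))"
    by (rule back_subst)
  with step show ?case unfolding Move2_def
    by (rule sx_While_True[OF assms(1), rotated]) (use Cons.prems(2,3) in simp)
qed

definition To_end :: "nat \<Rightarrow> com" where
  "To_end r = Seq (Loop (\<lambda>s. s r \<noteq> Blank) (single r (\<lambda>x. (x, MRight)))) (single r (\<lambda>x. (x, MLeft)))"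

text \<open>Used to turn an input tape, with its head on cell 0, into a stack. The blank cell
  \<open>m\<close> is visited, which explains \<open>m < S\<close>; for \<open>m = 0\<close> the
  truncated \<open>m - 1\<close> is again cell 0.\<close>

lemma ex_To_end:
  assumes "r < k" "ok S T" "filled m (T r)" "m < S"
  shows "ex S (To_end r) T (T(r := (fst (T r), m - 1)))"
proof -
  obtain f h where T: "T r = (f, h)" by fastforce
  have f: "f i = Blank \<longleftrightarrow> m \<le> i" and h: "h \<le> m" for i using assms(3) by (auto simp: filled_def T)
  have range: "range f \<subseteq> \<Gamma>" using assms(1,2) T by (force simp: ok_def)
  define U where "U i = T(r := (f, h + i))" for i
  have ok: "ok S (U i)" if "h + i \<le> m" for i
    using that assms range by (simp add: U_def ok_upd)
  have "ex S (Loop (\<lambda>s. s r \<noteq> Blank) (single r (\<lambda>x. (x, MRight)))) (U 0) (U (m - h))"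
  proof (rule ex_Loop_iterate)
    fix i
    assume i: "i < m - h"
    then have "reads (U i) r \<noteq> Blank" using assms(1) by (simp add: U_def reads_def read_tape_def f)
    moreover have "ex S (single r (\<lambda>x. (x, MRight))) (U i) (U (Suc i))"
      by (rule ex_single[OF assms(1)]) (use i ok[of i] ok[of "Suc i"] in \<open>auto simp: U_def read_tape_def\<close>)
    ultimately show "reads (U i) r \<noteq> Blank \<and> ex S (single r (\<lambda>x. (x, MRight))) (U i) (U (Suc i))" ..
  next
    show "\<not> reads (U (m - h)) r \<noteq> Blank"
      using h assms(1) by (simp add: U_def reads_def read_tape_def f)
    show "ok S (U (m - h))" using h ok by simp
  qed
  moreover have "ex S (single r (\<lambda>x. (x, MLeft))) (U (m - h)) (T(r := (f, m - 1)))"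
    by (rule ex_single[OF assms(1)])
      (use ok h assms range in \<open>auto simp: U_def read_tape_def ok_upd\<close>)
  moreover have "U 0 = T" by (auto simp: U_def T)
  ultimately show ?thesis unfolding To_end_def by (auto simp: T intro: ex_Seq)
qed

definition Clean :: "nat \<Rightarrow> com" where
  "Clean r = Seq (To_end r) (Loop (\<lambda>s. s r \<noteq> Blank) (Pop r))"

lemma ex_Clean:
  assumes "r < k" "ok S T" "filled m (T r)" "m < S"
  shows "ex S (Clean r) T (T(r := blank_tape))"
proof -
  obtain f h where T: "T r = (f, h)" by fastforce
  have f: "f i = Blank \<longleftrightarrow> m \<le> i" for i using assms(3) by (auto simp: filled_def T)
  have range: "range f \<subseteq> \<Gamma>" using assms(1,2) T by (force simp: ok_def)
  define U where "U i = T(r := ((\<lambda>j. if j < m - i then f j else Blank), m - i - 1))" for i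
  have "(\<lambda>j. if j < m then f j else Blank) = f" by (rule ext) (metis f not_less)
  then have 0: "U 0 = T(r := (f, m - 1))" by (auto simp: U_def)
  have m: "U m = T(r := blank_tape)" by (simp add: U_def blank_tape_def)
  have ok: "ok S (U i)" for i
    using assms range basic_symbols by (auto simp: U_def ok_upd)
  have "ex S (Loop (\<lambda>s. s r \<noteq> Blank) (Pop r)) (U 0) (U m)"
  proof (rule ex_Loop_iterate)
    fix i
    assume i: "i < m"
    then have "m - Suc i < m - i" "\<not> m \<le> m - Suc i" by auto
    then have "reads (U i) r \<noteq> Blank" using assms(1) by (simp add: U_def reads_def read_tape_def f)
    moreover have "ex S (Pop r) (U i) (U (Suc i))"
      unfolding Pop_def
      by (rule ex_single[OF assms(1)]) (use i ok in \<open>auto simp: U_def fun_eq_iff\<close>)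
    ultimately show "reads (U i) r \<noteq> Blank \<and> ex S (Pop r) (U i) (U (Suc i))" ..
  next
    show "\<not> reads (U m) r \<noteq> Blank"
      using assms(1) by (simp add: U_def reads_def read_tape_def)
  qed (rule ok)
  then show ?thesis unfolding Clean_def using ex_To_end[OF assms] 0 m T by (auto intro: ex_Seq)
qed

end

section \<open>Calling a decision procedure\<close>

text \<open>Blanks written by the simulated machine are recorded as a nonblank symbol, so that the
  visited part of each tape stays recognisable and can be erased afterwards. Bits are kept, hence
  the oracle tape can be shared.\<close>

definition wr :: "symbol \<Rightarrow> symbol" where
  "wr x = (case x of Bit b \<Rightarrow> Bit b | _ \<Rightarrow> enc (TSym x))"

text \<open>\<open>wr\<close> never produces \<open>TSym (Bit b)\<close>. Reading such a symbol as
  \<open>Blank\<close> makes \<open>rd x = Bit b\<close> equivalent to \<open>x = Bit b\<close> for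
  every \<open>x\<close>, which is what makes query words agree.\<close>

definition rd :: "symbol \<Rightarrow> symbol" where
  "rd x = (case dec x of Some (TBit b) \<Rightarrow> Bit b | Some (TSym y) \<Rightarrow> (if y \<in> range Bit then Blank else y) | _ \<Rightarrow> Blank)"

lemma dec_Bit [simp]: "dec (Bit b) = Some (TBit b)"
  using dec_enc[of "TBit b"] by simp

lemma dec_Some: "dec x = Some t \<Longrightarrow> x = enc t"
  by (auto simp: dec_def f_inv_into_f split: if_splits)

lemma rd_simps [simp]: "rd (wr x) = x" "rd Blank = Blank" "rd (Bit b) = Bit b"
  by (auto simp: rd_def wr_def split: symbol.split)

lemma wr_neq_Blank [simp]: "wr x \<noteq> Blank"
  by (auto simp: wr_def split: symbol.split)

lemma rd_eq_Bit_iff: "rd x = Bit b \<longleftrightarrow> x = Bit b"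
  by (auto simp: rd_def dest!: dec_Some split: option.splits tok.splits if_splits)

text \<open>\<open>t\<close> is the tape of the simulated machine and \<open>t'\<close> its image on
  a program tape, where the first \<open>m\<close> cells, and no others, are nonblank even if the
  machine has written blanks there.\<close>

definition shadows :: "nat \<Rightarrow> tape \<Rightarrow> tape \<Rightarrow> bool" where
  "shadows m t t' \<longleftrightarrow> snd t' = snd t \<and> filled m t' \<and> (\<forall>i. rd (fst t' i) = fst t i)"

text \<open>The head is at most one cell past the filled part, so writing a nonblank symbol stays
  inside this part or extends it by exactly one cell.\<close>

lemma shadows_act:
  assumes "shadows m t t'"
  shows "shadows (max m (Suc (snd t))) (act (x, d) t) (act (wr x, d) t')"
proof -
  obtain f h where t: "t = (f, h)" by fastforce
  obtain f' where t': "t' = (f', h)" using assms by (cases t') (auto simp: shadows_def t)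
  have "h \<le> m" "f' i = Blank \<longleftrightarrow> m \<le> i" for i using assms by (auto simp: shadows_def filled_def t')
  then show ?thesis
    using assms by (cases d) (auto simp: shadows_def filled_def t t')
qed

lemma shadows_read: "shadows m t t' \<Longrightarrow> rd (read_tape t') = read_tape t"
  by (simp add: shadows_def read_tape_def)

lemma shadows_blank: "shadows 0 blank_tape blank_tape"
  by (simp add: shadows_def filled_def blank_tape_def)

lemma shadows_input: "shadows (length y) (input_tape y) (input_tape y)"
  by (auto simp: shadows_def filled_def input_tape_def)

text \<open>A query word depends only on the positions of the bits, and these are stored verbatim;
  so the simulated machine may use the real oracle tape.\<close>

lemma shadows_query:
  assumes "shadows m t t'"
  shows "query_word t' = query_word t"
proof -
  have *: "fst t' i = Bit b \<longleftrightarrow> fst t i = Bit b" for i b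
    using assms rd_eq_Bit_iff[of "fst t' i" b] by (auto simp: shadows_def)
  then have "fst t' i \<notin> range Bit \<longleftrightarrow> fst t i \<notin> range Bit" for i by (metis image_iff)
  then show ?thesis by (simp add: query_word_def *)
qed

section \<open>Simulating a machine with the same oracle\<close>

locale simulated_machine = oracle_programs k \<Gamma> Q for k \<Gamma> Q +
  fixes M :: otm and base st src :: nat
  assumes wf: "otm_wf M"
    and registers: "base + num_tapes M \<le> k" "st < base" "src < base" "1 < base" "st \<noteq> 1" "src \<noteq> 1" "src \<noteq> st"
    and symbols: "x \<in> alphabet M \<Longrightarrow> wr x \<in> \<Gamma>" "q \<in> states M \<Longrightarrow> TState q \<in> legal" "TMark b \<in> legal"
begin

text \<open>Tape 1 is shared, since the oracle only looks at the real tape 1; the other tapes of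
  \<open>M\<close> are moved to \<open>base\<close> and beyond.\<close>

definition reg :: "nat \<Rightarrow> nat" where
  "reg j = (if j = 1 then 1 else base + j)"

definition unreg :: "nat \<Rightarrow> nat" where
  "unreg r = (if r = 1 then 1 else r - base)"

lemma machine_facts:
  "2 \<le> num_tapes M" "Start \<in> states M" "Accept \<in> states M" "Reject \<in> states M"
  "Blank \<in> alphabet M" "Bit v \<in> alphabet M"
proof -
  have *: "2 \<le> num_tapes M \<and> {Start, Query, Yes, No, Accept, Reject} \<subseteq> states M
      \<and> {Blank, Bit False, Bit True} \<subseteq> alphabet M"
    using wf unfolding otm_wf_def by (elim conjE) (intro conjI)
  then show "2 \<le> num_tapes M" "Start \<in> states M" "Accept \<in> states M" "Reject \<in> states M"
    "Blank \<in> alphabet M" by simp_all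
  show "Bit v \<in> alphabet M" using * by (cases v) simp_all
qed

lemma unreg_reg [simp]: "unreg (reg j) = j"
  by (simp add: unreg_def reg_def) (use registers in auto)

lemma reg_bounds: "j < num_tapes M \<Longrightarrow> reg j < k" "reg j \<noteq> st" "reg j \<noteq> src"
  using registers two_le by (auto simp: reg_def)

lemma st_src: "st < k" "src < k" "base < k" "base \<noteq> src" "base \<noteq> st"
  using registers wf by (auto simp: otm_wf_def)

lemma inj_reg: "inj reg"
  by (metis injI unreg_reg)

definition Sim_act :: "state \<Rightarrow> com" where
  "Sim_act q = Act (\<lambda>s r. case delta M q (map (\<lambda>j. rd (s (reg j))) [0..<num_tapes M]) of (q', as) \<Rightarrow>
     if r = st then (enc (TState q'), MStay)
     else if r \<in> reg ` {..<num_tapes M} then (wr (fst (as ! unreg r)), snd (as ! unreg r))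
     else (s r, MStay))"

definition Set_state :: "state \<Rightarrow> com" where
  "Set_state q = single st (\<lambda>_. (enc (TState q), MStay))"

definition Sim_step :: com where
  "Sim_step = On st (\<lambda>t. case t of Some (TState q) \<Rightarrow>
       if q = Query then Ask (Set_state Yes) (Set_state No) else Sim_act q | _ \<Rightarrow> Done)"

definition running :: "tok option \<Rightarrow> bool" where
  "running t \<longleftrightarrow> t \<notin> {Some (TState Accept), Some (TState Reject)}"

text \<open>\<open>B\<close> bounds the filled part of every simulated tape, which is erased later.
  The last conjunct is a frame condition: tapes not owned by the simulation are as they were in the
  starting store.\<close>

definition tracks :: "nat \<Rightarrow> (nat \<Rightarrow> tape) \<Rightarrow> config \<Rightarrow> (nat \<Rightarrow> tape) \<Rightarrow> bool" where
  "tracks B T\<^sub>0 cf T \<longleftrightarrow> fst cf \<in> states M \<and> length (snd cf) = num_tapes M \<and>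
     T st = stk [TState (fst cf)] \<and>
     (\<forall>j<num_tapes M. range (fst (snd cf ! j)) \<subseteq> alphabet M \<and> (\<exists>m\<le>B. shadows m (snd cf ! j) (T (reg j)))) \<and>
     (\<forall>r. r \<noteq> st \<longrightarrow> r \<notin> reg ` {..<num_tapes M} \<longrightarrow> T r = T\<^sub>0 r)"

lemma tracks_step:
  assumes tr: "tracks B T\<^sub>0 (q, ts) T" and run: "q \<noteq> Accept" "q \<noteq> Reject"
    and ok: "ok S T" and B: "B < S"
    and heads: "\<forall>t \<in> set ts. snd t < B" "\<forall>t \<in> set (snd (step M Q (q, ts))). snd t < B"
  shows "\<exists>T'. ex S Sim_step T T' \<and> tracks B T\<^sub>0 (step M Q (q, ts)) T' \<and> ok S T'"
proof -
  have q: "q \<in> states M" "length ts = num_tapes M" "T st = stk [TState q]"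
    using tr by (simp_all add: tracks_def)
  have alph: "range (fst (ts ! j)) \<subseteq> alphabet M" if "j < num_tapes M" for j
    using tr that by (simp add: tracks_def)
  have "\<exists>m. j < num_tapes M \<longrightarrow> m \<le> B \<and> shadows m (ts ! j) (T (reg j))" for j
    using tr by (auto simp: tracks_def)
  then obtain m where m: "m j \<le> B" "shadows (m j) (ts ! j) (T (reg j))" if "j < num_tapes M" for j
    by metis
  have rest: "T r = T\<^sub>0 r" if "r \<noteq> st" "r \<notin> reg ` {..<num_tapes M}" for r
    using tr that by (simp add: tracks_def)
  have n: "2 \<le> num_tapes M" using wf by (simp add: otm_wf_def)
  have dec: "dec (reads T st) = Some (TState q)"
    using q(3) st_src by (simp add: reads_def)
  have enter: "ex S Sim_step T T'"
    if "ex S (if q = Query then Ask (Set_state Yes) (Set_state No) else Sim_act q) T T'" for T'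
    unfolding Sim_step_def On_def by (rule ex_Branch[OF ok]) (use that dec in simp)
  have st1: "st < k" "st \<noteq> 1" "reg 1 = 1" using st_src registers by (auto simp: reg_def)
  have put: "act (enc (TState q'), MStay) (stk [TState q]) = stk [TState q']" for q'
    by (auto simp: stk_def)
  have sub: "range (fst (stk [TState q'])) \<subseteq> \<Gamma>" "snd (stk [TState q']) < S" if "q' \<in> states M" for q'
    using symbols(2)[OF that] basic_symbols B by (auto simp: stk_def legal_def)
  show ?thesis
  proof (cases "q = Query")
    case True
    define v where "v \<longleftrightarrow> query_word (ts ! 1) \<in> Q"
    let ?q = "if v then Yes else No"
    let ?T1 = "T(1 := blank_tape)" and ?T' = "T(1 := blank_tape, st := stk [TState ?q])"
    have step: "step M Q (q, ts) = (?q, ts[1 := blank_tape])" using True by (simp add: v_def)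
    have q': "?q \<in> states M" using wf by (auto simp: otm_wf_def)
    have word: "query_word (T 1) \<in> Q \<longleftrightarrow> v"
      using m(2)[of 1] n shadows_query st1(3) by (auto simp: v_def)
    have ok1: "ok S ?T1" using ok_reset[OF ok] .
    then have ok': "ok S ?T'" using sub[OF q'] by (simp add: ok_upd)
    have "ex S (Set_state ?q) ?T1 ?T'"
      unfolding Set_state_def
      by (rule ex_single[OF st1(1) ok1 _ ok']) (use st1 q(3) in \<open>simp add: put\<close>)
    then have "ex S (Ask (Set_state Yes) (Set_state No)) T ?T'"
      by (intro ex_Ask[OF ok]) (simp only: word, cases v, simp_all)
    moreover have "tracks B T\<^sub>0 (?q, ts[1 := blank_tape]) ?T'"
    proof -
      have "\<exists>m\<le>B. shadows m (ts[1 := blank_tape] ! j) (?T' (reg j))" if j: "j < num_tapes M" for j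
      proof (cases "j = 1")
        case True
        then show ?thesis using shadows_blank j q(2) st1 by (intro exI[of _ 0]) simp
      next
        case False
        then have "reg j \<noteq> 1" using inj_reg st1(3) by (metis unreg_reg)
        then show ?thesis using m[OF j] False reg_bounds(2)[of j] by auto
      qed
      moreover have "range (fst (ts[1 := blank_tape] ! j)) \<subseteq> alphabet M" if "j < num_tapes M" for j
        using alph[OF that] wf that q(2) by (cases "j = 1") (auto simp: otm_wf_def blank_tape_def)
      moreover have "?T' r = T\<^sub>0 r" if "r \<noteq> st" "r \<notin> reg ` {..<num_tapes M}" for r
      proof -
        have "r \<noteq> 1" using that(2) st1(3) n by (metis image_eqI lessThan_iff less_le_trans one_less_numeral_iff semiring_norm(76))
        then show ?thesis using rest that by simp
      qed
      ultimately show ?thesis using q' q(2) st1(2) by (simp add: tracks_def)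
    qed
    ultimately show ?thesis
      unfolding step using enter[of ?T'] True ok' by (intro exI[of _ ?T']) simp
  next
    case False
    obtain q' as where delta: "delta M q (map read_tape ts) = (q', as)" by fastforce
    have step: "step M Q (q, ts) = (q', map2 act as ts)" using False run delta by simp
    have read: "set (map read_tape ts) \<subseteq> alphabet M"
      using alph q(2) by (fastforce simp: in_set_conv_nth read_tape_def image_subset_iff)
    have len: "length (map read_tape ts) = num_tapes M" using q(2) by simp
    have *: "\<forall>q \<in> states M. \<forall>xs. length xs = num_tapes M \<and> set xs \<subseteq> alphabet M \<longrightarrow>
        (case delta M q xs of (q', as) \<Rightarrow>
           q' \<in> states M \<and> length as = num_tapes M \<and> fst ` set as \<subseteq> alphabet M)"
      using wf unfolding otm_wf_def by (elim conjE)
    have "case delta M q (map read_tape ts) of (q', as) \<Rightarrow>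
        q' \<in> states M \<and> length as = num_tapes M \<and> fst ` set as \<subseteq> alphabet M"
      by (rule mp[OF spec[OF bspec[OF * q(1)]] conjI[OF len read]])
    then have as: "q' \<in> states M" "length as = num_tapes M" "fst ` set as \<subseteq> alphabet M"
      unfolding delta by simp_all
    have reads: "map (\<lambda>j. rd (reads T (reg j))) [0..<num_tapes M] = map read_tape ts"
      by (rule nth_equalityI) (simp_all add: q(2) reads_def reg_bounds(1) shadows_read[OF m(2)])
    define T' where "T' = (\<lambda>r. if r = st then stk [TState q']
      else if r \<in> reg ` {..<num_tapes M} then act (wr (fst (as ! unreg r)), snd (as ! unreg r)) (T r) else T r)"
    have stay: "act (read_tape t, MStay) t = t" for t by (cases t) (simp add: read_tape_def)
    have T': "T' = perform (\<lambda>r. case delta M q (map (\<lambda>j. rd (reads T (reg j))) [0..<num_tapes M]) of (q', as) \<Rightarrow>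
     if r = st then (enc (TState q'), MStay)
     else if r \<in> reg ` {..<num_tapes M} then (wr (fst (as ! unreg r)), snd (as ! unreg r))
     else (reads T r, MStay)) T"
      unfolding reads delta T'_def perform_def prod.case
      using st1(1) q(3) put reg_bounds(1) by (auto simp: fun_eq_iff stay reads_def)
    have sh: "shadows (max (m j) (Suc (snd (ts ! j)))) (map2 act as ts ! j) (T' (reg j))"
      if "j < num_tapes M" for j
    proof -
      have "map2 act as ts ! j = act (fst (as ! j), snd (as ! j)) (ts ! j)" using that as q(2) by simp
      moreover have "T' (reg j) = act (wr (fst (as ! j)), snd (as ! j)) (T (reg j))"
        using that reg_bounds(2)[of j] by (simp add: T'_def)
      ultimately show ?thesis using shadows_act[OF m(2)[OF that], of "fst (as ! j)" "snd (as ! j)"] by simp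
    qed
    \<comment> \<open>The filled part grows only where the head is, and the head stays below
      \<open>B\<close> during the whole run; so \<open>B\<close> remains a bound.\<close>
    have mB: "max (m j) (Suc (snd (ts ! j))) \<le> B" if "j < num_tapes M" for j
      using m(1)[OF that] heads(1) that q(2) by (simp add: Suc_le_eq)
    have ok': "ok S T'"
      unfolding ok_def
    proof (intro allI impI)
      fix r
      assume r: "r < k"
      consider "r = st" | j where "r \<noteq> st" "j < num_tapes M" "r = reg j"
        | "r \<noteq> st" "r \<notin> reg ` {..<num_tapes M}" by auto
      then show "snd (T' r) < S \<and> range (fst (T' r)) \<subseteq> \<Gamma>"
      proof cases
        case 1
        then show ?thesis using sub[OF as(1)] by (simp add: T'_def)
      next
        case 2
        have "snd (T' r) = snd (map2 act as ts ! j)" using sh[OF 2(2)] 2(3) by (simp add: shadows_def)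
        also have "\<dots> < B" using heads(2) 2(2) as(2) q(2) unfolding step snd_conv by (metis length_map length_zip min.idem nth_mem)
        finally have "snd (T' r) < S" using B by simp
        moreover have "range (fst (T r)) \<subseteq> \<Gamma>" using ok r by (simp add: ok_def)
        moreover have "wr (fst (as ! j)) \<in> \<Gamma>" using as(2,3) 2(2) by (intro symbols(1)) auto
        moreover obtain f h where "T r = (f, h)" by fastforce
        ultimately show ?thesis using 2 by (auto simp: T'_def fun_upd_def)
      next
        case 3
        then show ?thesis using ok r by (simp add: T'_def ok_def)
      qed
    qed
    have "ex S (Sim_act q) T T'" unfolding Sim_act_def by (rule ex_Act[OF ok _ ok']) (rule T')
    moreover have "tracks B T\<^sub>0 (q', map2 act as ts) T'"
    proof -
      have "range (fst (map2 act as ts ! j)) \<subseteq> alphabet M" if j: "j < num_tapes M" for j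
      proof -
        have "map2 act as ts ! j = act (as ! j) (ts ! j)" using j as q(2) by simp
        moreover have "fst (as ! j) \<in> alphabet M" using as j by auto
        moreover obtain f h where "ts ! j = (f, h)" by fastforce
        moreover obtain x d where "as ! j = (x, d)" by fastforce
        ultimately show ?thesis using alph[OF j] by (auto simp: fun_upd_def)
      qed
      moreover have "\<exists>m\<le>B. shadows m (map2 act as ts ! j) (T' (reg j))" if "j < num_tapes M" for j
        using sh[OF that] mB[OF that] by blast
      moreover have "T' st = stk [TState q']" by (simp add: T'_def)
      moreover have "T' r = T\<^sub>0 r" if "r \<noteq> st" "r \<notin> reg ` {..<num_tapes M}" for r
        using rest[OF that] that by (simp add: T'_def)
      ultimately show ?thesis
        unfolding tracks_def fst_conv snd_conv using as q(2) by simp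
    qed
    ultimately show ?thesis using enter False ok' step by auto
  qed
qed

text \<open>Loop derivations are built from the last iteration backwards, hence the descending
  induction from the halting time \<open>n\<close>.\<close>

lemma tracks_run:
  assumes "tracks B T\<^sub>0 (run M Q y i) T" "ok S T" "B < S"
    and "\<And>i. \<forall>t \<in> set (snd (run M Q y i)). snd t < B"
    and "i \<le> n" "fst (run M Q y n) \<in> {Accept, Reject}" "\<And>i. i < n \<Longrightarrow> fst (run M Q y i) \<notin> {Accept, Reject}"
  shows "\<exists>T'. ex S (While st running Sim_step) T T' \<and> tracks B T\<^sub>0 (run M Q y n) T'"
  using assms(5,1,2)
proof (induction arbitrary: T rule: inc_induct)
  case base
  have "dec (reads T st) = Some (TState (fst (run M Q y n)))"
    using base(1) st_src by (simp add: reads_def tracks_def)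
  then have "ex S (While st running Sim_step) T T"
    unfolding While_def using assms(6) base(2) by (intro ex_Loop_False) (auto simp: running_def)
  then show ?case using base by blast
next
  case (step i)
  obtain q ts where cf: "run M Q y i = (q, ts)" by fastforce
  have next_cf: "run M Q y (Suc i) = step M Q (q, ts)" using cf by (simp add: run_def)
  have q: "q \<noteq> Accept" "q \<noteq> Reject" using assms(7)[of i] step.hyps cf by auto
  have tr: "tracks B T\<^sub>0 (q, ts) T" using step.prems cf by simp
  have "\<forall>t \<in> set ts. snd t < B" using assms(4)[of i] cf by simp
  moreover have "\<forall>t \<in> set (snd (step M Q (q, ts))). snd t < B"
    using assms(4)[of "Suc i"] unfolding next_cf .
  ultimately obtain T1 where T1: "ex S Sim_step T T1" "tracks B T\<^sub>0 (run M Q y (Suc i)) T1" "ok S T1"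
    using tracks_step[OF tr q step.prems(2) assms(3)] unfolding next_cf by blast
  obtain T2 where T2: "ex S (While st running Sim_step) T1 T2" "tracks B T\<^sub>0 (run M Q y n) T2"
    using step.IH[OF T1(2,3)] by blast
  have "dec (reads T st) = Some (TState q)"
    using tr st_src by (simp add: reads_def tracks_def)
  then have "running (dec (reads T st))" using q by (simp add: running_def)
  then have "ex S (While st running Sim_step) T T2"
    using T2(1) unfolding While_def by (rule ex_Loop_True[OF _ T1(1)])
  then show ?case using T2(2) by blast
qed

text \<open>Moving a stack reverses it, so a word with its first bit on top arrives in reading
  order, but with the head on its last bit. The left end of a tape cannot be sensed; therefore the
  first bit is stored as a mark, the head runs left to it, and the mark becomes a bit again. This
  needs a nonempty word.\<close>

definition Load :: com where
  "Load = Seq (On src (\<lambda>t. case t of Some (TBit b) \<Rightarrow> Seq (Pop src) (Push base (TMark b)) | _ \<Rightarrow> Done))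
    (Seq (Move src (\<lambda>t. t \<noteq> None) base)
    (Seq (Push st (TState Start))
    (Seq (While base (\<lambda>t. t \<notin> range (Some \<circ> TMark)) (single base (\<lambda>x. (x, MLeft))))
         (single base (\<lambda>x. (case dec x of Some (TMark b) \<Rightarrow> Bit b | _ \<Rightarrow> x, MStay))))))"

lemma ex_Load:
  assumes "good S s" "s src = map TBit y" "y \<noteq> []" "s st = []" "s base = []"
  shows "ex S Load (stacks s) ((stacks (s(src := [], st := [TState Start])))(base := input_tape y))"
proof -
  obtain b z where y: "y = b # z" using assms(3) by (cases y) auto
  let ?s1 = "s(src := map TBit z, base := [TMark b])"
  let ?l = "rev (map TBit z) @ [TMark b]"
  let ?s2 = "s(src := [], base := ?l)"
  let ?s3 = "?s2(st := [TState Start])"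
  have len: "length y \<le> S" using goodD(1)[OF assms(1) st_src(2)] assms(2) by simp
  have Start: "TState Start \<in> legal" using symbols(2) wf by (simp add: otm_wf_def)
  note ne = st_src registers
  have "sx S (Pop src) s (s(src := map TBit z))"
    using sx_Pop[OF st_src(2) assms(1)] assms(2) y by simp
  moreover have "sx S (Push base (TMark b)) (s(src := map TBit z)) ?s1"
    using sx_Push[OF st_src(3) sx_good(2)[OF calculation], of "TMark b"] ne assms len y symbols(3) by simp
  ultimately have 1: "sx S (On src (\<lambda>t. case t of Some (TBit b) \<Rightarrow> Seq (Pop src) (Push base (TMark b)) | _ \<Rightarrow> Done)) s ?s1"
    by (intro sx_On[OF st_src(2)]) (simp add: assms(2) y sx_Seq)
  have "sx S (Move src (\<lambda>t. t \<noteq> None) base) ?s1 (?s1(src := [], base := rev (map TBit z) @ ?s1 base))"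
    by (rule sx_Move[OF st_src(2,3)]) (use sx_good(2)[OF 1] ne len y in auto)
  moreover have "?s1(src := [], base := rev (map TBit z) @ ?s1 base) = ?s2"
    using ne by (auto simp: fun_eq_iff)
  ultimately have 2: "sx S (Move src (\<lambda>t. t \<noteq> None) base) ?s1 ?s2" by simp
  have "0 < S" using assms(1) by (simp add: good_def)
  then have 3: "sx S (Push st (TState Start)) ?s2 ?s3"
    using sx_Push[OF st_src(1) sx_good(2)[OF 2] _ Start] ne assms(4) by simp
  define f where "f = fst (stk ?l)"
  define U where "U i = (stacks ?s3)(base := (f, length z - i))" for i
  have f0: "f 0 = enc (TMark b)" by (simp add: f_def stk_def)
  have f1: "f i = Bit (z ! (i - 1))" if "0 < i" "i \<le> length z" for i
    using that by (cases i) (auto simp: f_def stk_def)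
  have f2: "f i = Blank" if "length z < i" for i using that by (simp add: f_def stk_def)
  have ok3: "ok S (stacks ?s3)" using sx_good(2)[OF 3] by (rule ok_stacks)
  have range: "range f \<subseteq> \<Gamma>"
    using ok3 ne unfolding ok_def f_def by (auto simp: stacks_def dest!: spec[of _ base])
  have ok: "ok S (U i)" for i
    using ok3 range len y by (auto simp: U_def ok_upd)
  have fin: "(stacks (s(src := [], st := [TState Start])))(base := input_tape y) = (stacks ?s3)(base := (f(0 := Bit b), 0))"
  proof -
    have "f(0 := Bit b) = fst (input_tape y)"
      using f1 f2 by (auto simp: fun_eq_iff input_tape_def y nth_Cons split: nat.split)
    then have "input_tape y = (f(0 := Bit b), 0)" by (simp add: input_tape_def)
    then show ?thesis by (auto simp: stacks_def fun_eq_iff)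
  qed
  have U0: "U 0 = stacks ?s3"
    using ne by (auto simp: U_def f_def stacks_def stk_def fun_eq_iff)
  have "ex S (While base (\<lambda>t. t \<notin> range (Some \<circ> TMark)) (single base (\<lambda>x. (x, MLeft)))) (U 0) (U (length z))"
    unfolding While_def
  proof (rule ex_Loop_iterate)
    fix i
    assume i: "i < length z"
    then have "reads (U i) base = Bit (z ! (length z - i - 1))"
      using st_src(3) f1[of "length z - i"] by (simp add: U_def reads_def read_tape_def)
    then have "dec (reads (U i) base) \<notin> range (Some \<circ> TMark)" by auto
    moreover have "ex S (single base (\<lambda>x. (x, MLeft))) (U i) (U (Suc i))"
      by (rule ex_single[OF st_src(3) ok _ ok]) (simp add: U_def read_tape_def)
    ultimately show "dec (reads (U i) base) \<notin> range (Some \<circ> TMark)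
        \<and> ex S (single base (\<lambda>x. (x, MLeft))) (U i) (U (Suc i))" ..
  next
    have "reads (U (length z)) base = enc (TMark b)"
      using st_src(3) f0 by (simp add: U_def reads_def read_tape_def)
    then show "\<not> dec (reads (U (length z)) base) \<notin> range (Some \<circ> TMark)" by simp
  qed (rule ok)
  moreover have "ex S (single base (\<lambda>x. (case dec x of Some (TMark b) \<Rightarrow> Bit b | _ \<Rightarrow> x, MStay))) (U (length z))
      ((stacks (s(src := [], st := [TState Start])))(base := input_tape y))"
    unfolding fin
  proof (rule ex_single[OF st_src(3) ok])
    show "ok S ((stacks ?s3)(base := (f(0 := Bit b), 0)))"
      using ok3 range sx_good(1)[OF 3] TBit_legal[of b] by (auto simp: ok_upd good_def legal_def)
  qed (simp add: U_def read_tape_def f0)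
  ultimately show ?thesis
    using 1 2 3 unfolding Load_def sx_def U0 by (auto intro: ex_Seq)
qed

text \<open>Erasing all tapes of the machine makes the call repeatable; only the verdict on
  \<open>st\<close> remains.\<close>

definition Call :: com where
  "Call = Seq Load (Seq (While st running Sim_step) (foldr (\<lambda>j. Seq (Clean (reg j))) [0..<num_tapes M] Done))"

lemma ex_Clean_all:
  assumes "ok S T" "distinct js" "\<And>j. j \<in> set js \<Longrightarrow> j < num_tapes M \<and> (\<exists>m<S. filled m (T (reg j)))"
  shows "ex S (foldr (\<lambda>j. Seq (Clean (reg j))) js Done) T (\<lambda>r. if r \<in> reg ` set js then blank_tape else T r)"
  using assms
proof (induction js arbitrary: T)
  case Nil
  then show ?case by (simp add: ex_Done)
next
  case (Cons j js)
  obtain m where m: "m < S" "filled m (T (reg j))" using Cons.prems(3)[of j] by auto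
  let ?T = "T(reg j := blank_tape)"
  have 1: "ex S (Clean (reg j)) T ?T"
    using ex_Clean[OF _ Cons.prems(1) m(2,1)] reg_bounds(1) Cons.prems(3)[of j] by simp
  have "ex S (foldr (\<lambda>j. Seq (Clean (reg j))) js Done) ?T (\<lambda>r. if r \<in> reg ` set js then blank_tape else ?T r)"
  proof (rule Cons.IH)
    show "i < num_tapes M \<and> (\<exists>m<S. filled m (?T (reg i)))" if "i \<in> set js" for i
      using Cons.prems(2,3) that inj_reg by (auto simp: inj_eq)
    show "ok S ?T" using ex_ok[OF 1] by blast
    show "distinct js" using Cons.prems(2) by simp
  qed
  moreover have "(\<lambda>r. if r \<in> reg ` set js then blank_tape else ?T r)
      = (\<lambda>r. if r \<in> reg ` set (j # js) then blank_tape else T r)"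
    by (auto simp: fun_eq_iff)
  ultimately have 2: "ex S (foldr (\<lambda>j. Seq (Clean (reg j))) js Done) ?T (\<lambda>r. if r \<in> reg ` set (j # js) then blank_tape else T r)"
    by (simp only:)
  show ?case using ex_Seq[OF 1 2] by simp
qed

lemma sx_Call:
  assumes "decides M Q R" "\<And>i. \<forall>t \<in> set (snd (run M Q y i)). snd t < B" "B < S" "length y \<le> B"
    and "good S s" "s src = map TBit y" "y \<noteq> []" "s st = []" "\<And>j. j < num_tapes M \<Longrightarrow> s (reg j) = []"
  shows "sx S Call s (s(src := [], st := [TState (if y \<in> R then Accept else Reject)]))"
proof -
  let ?T0 = "(stacks (s(src := [], st := [TState Start])))(base := input_tape y)"
  let ?q = "if y \<in> R then Accept else Reject"
  let ?s' = "s(src := [], st := [TState ?q])"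
  have reg0: "reg 0 = base" "s base = []" using assms(9)[of 0] machine_facts(1) by (simp_all add: reg_def)
  have load: "ex S Load (stacks s) ?T0" by (rule ex_Load[OF assms(5,6,7,8) reg0(2)])
  obtain n0 where n0: "fst (run M Q y n0) = ?q" using assms(1) unfolding decides_def by blast
  \<comment> \<open>The simulating loop ends at the first halting time, while \<open>decides\<close>
    only provides some halting time. Since halting configurations are fixed points, the verdict is
    the same at both.\<close>
  define n where "n = (LEAST n. fst (run M Q y n) \<in> {Accept, Reject})"
  have nn: "fst (run M Q y n) \<in> {Accept, Reject}" "n \<le> n0"
    unfolding n_def by (rule LeastI[of _ n0], simp add: n0) (rule Least_le, simp add: n0)
  have less: "fst (run M Q y i) \<notin> {Accept, Reject}" if "i < n" for i
    using that not_less_Least unfolding n_def by blast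
  have "run M Q y (n + j) = run M Q y n" for j
  proof (induction j)
    case (Suc j)
    then show ?case using nn(1) by (cases "run M Q y n") (auto simp: run_def)
  qed simp
  then have q: "fst (run M Q y n) = ?q" using nn(2) n0 by (metis le_add_diff_inverse)
  have "tracks B ?T0 (run M Q y 0) ?T0"
  proof -
    have cf: "run M Q y 0 = (Start, input_tape y # replicate (num_tapes M - 1) blank_tape)"
      by (simp add: run_def init_config_def)
    have "range (fst ((input_tape y # replicate (num_tapes M - 1) blank_tape) ! j)) \<subseteq> alphabet M"
      if "j < num_tapes M" for j
    proof -
      show ?thesis using that machine_facts(5,6) by (cases j) (auto simp: input_tape_def blank_tape_def)
    qed
    moreover have "\<exists>m\<le>B. shadows m ((input_tape y # replicate (num_tapes M - 1) blank_tape) ! j) (?T0 (reg j))"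
      if "j < num_tapes M" for j
    proof (cases j)
      case 0
      then show ?thesis using shadows_input[of y] assms(4) reg0 by auto
    next
      case (Suc i)
      have "reg j \<noteq> base" using inj_reg reg0 Suc by (metis inj_eq nat.distinct(1))
      then show ?thesis
        using Suc that assms(9)[OF that] reg_bounds[of j] shadows_blank by (auto simp: stacks_def)
    qed
    ultimately show ?thesis
      unfolding tracks_def cf fst_conv snd_conv using machine_facts(1,2) st_src by (simp add: stacks_def)
  qed
  from tracks_run[OF this _ assms(3) assms(2) _ nn(1) less]
  obtain T where T: "ex S (While st running Sim_step) ?T0 T" "tracks B ?T0 (run M Q y n) T"
    using ex_ok[OF load] by auto
  have "ex S (foldr (\<lambda>j. Seq (Clean (reg j))) [0..<num_tapes M] Done) T
      (\<lambda>r. if r \<in> reg ` set [0..<num_tapes M] then blank_tape else T r)"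
  proof (rule ex_Clean_all)
    show "j < num_tapes M \<and> (\<exists>m<S. filled m (T (reg j)))" if "j \<in> set [0..<num_tapes M]" for j
    proof -
      have j: "j < num_tapes M" using that by simp
      then obtain m where "m \<le> B" "shadows m (snd (run M Q y n) ! j) (T (reg j))"
        using T(2) unfolding tracks_def by (elim conjE) blast
      then have "m < S \<and> filled m (T (reg j))" using assms(3) by (simp add: shadows_def)
      then show ?thesis using j by blast
    qed
  qed (use ex_ok[OF T(1)] in auto)
  moreover have "(\<lambda>r. if r \<in> reg ` set [0..<num_tapes M] then blank_tape else T r) = stacks ?s'"
  proof
    fix r
    consider j where "j < num_tapes M" "r = reg j" | "r = st" | "r \<noteq> st" "r \<notin> reg ` {..<num_tapes M}" by auto
    then show "(if r \<in> reg ` set [0..<num_tapes M] then blank_tape else T r) = stacks ?s' r"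
    proof cases
      case 1
      then show ?thesis using assms(9) reg_bounds(2,3)[of j] by (auto simp: stacks_def)
    next
      case 2
      then have "r \<notin> reg ` set [0..<num_tapes M]" using reg_bounds(2) by blast
      then show ?thesis using 2 T(2) q by (auto simp: tracks_def stacks_def)
    next
      case 3
      have "base \<in> reg ` {..<num_tapes M}"
        using reg0(1) machine_facts(1) by (intro image_eqI[of _ _ 0]) auto
      then have "r \<noteq> base" using 3 by blast
      moreover have "T r = ?T0 r" using T(2) 3 by (simp add: tracks_def)
      ultimately show ?thesis using 3 by (auto simp: stacks_def)
    qed
  qed
  ultimately have "ex S (foldr (\<lambda>j. Seq (Clean (reg j))) [0..<num_tapes M] Done) T (stacks ?s')"
    by (simp only:)
  then have "ex S Call (stacks s) (stacks ?s')"
    unfolding Call_def by (rule ex_Seq[OF load ex_Seq[OF T(1)]])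
  moreover have "good S ?s'"
    using assms(3,5) symbols(2)[OF machine_facts(3)] symbols(2)[OF machine_facts(4)] by (simp add: good_def)
  ultimately show ?thesis using assms(5) by (simp add: sx_def)
qed

end

section \<open>Satisfiability in a sum of two frames\<close>

datatype afm = AVar nat | ABot | AImp afm afm | ADia nat nat afm

primrec erase :: "afm \<Rightarrow> fm" where
  "erase (AVar i) = Var i"
| "erase ABot = Bot"
| "erase (AImp \<alpha> \<beta>) = Imp (erase \<alpha>) (erase \<beta>)"
| "erase (ADia c d \<alpha>) = Dia c (erase \<alpha>)"

primrec digits_ok :: "afm \<Rightarrow> bool" where
  "digits_ok (AVar i) = True"
| "digits_ok ABot = True"
| "digits_ok (AImp \<alpha> \<beta>) = (digits_ok \<alpha> \<and> digits_ok \<beta>)"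
| "digits_ok (ADia c d \<alpha>) = (d < 4 \<and> digits_ok \<alpha>)"

text \<open>The digit of a diamond guesses whether its argument is satisfied somewhere in the first
  summand (side \<open>True\<close>, low bit) and somewhere in the second one (side \<open>False\<close>, high bit).\<close>

definition flag :: "bool \<Rightarrow> nat \<Rightarrow> bool" where
  "flag s d = (if s then odd d else 2 \<le> d)"

definition digit :: "bool \<Rightarrow> bool \<Rightarrow> nat" where
  "digit f g = of_bool f + 2 * of_bool g"

lemma flag_digit [simp]: "flag True (digit f g) = f" "flag False (digit f g) = g" "digit f g < 4"
  by (auto simp: flag_def digit_def)

text \<open>A diamond that is witnessed in the other summand holds everywhere. As \<open>Imp Bot\<close> is a prefix,
  it can be made true without removing the code of its argument.\<close>

definition absorbed :: "nat \<Rightarrow> bool \<Rightarrow> nat \<Rightarrow> nat \<Rightarrow> bool" where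
  "absorbed a s c d \<longleftrightarrow> (c = 0 \<or> s \<and> c = Suc a) \<and> flag (\<not> s) d"

primrec tr :: "nat \<Rightarrow> bool \<Rightarrow> afm \<Rightarrow> fm" where
  "tr a s (AVar i) = Var i"
| "tr a s ABot = Bot"
| "tr a s (AImp \<alpha> \<beta>) = Imp (tr a s \<alpha>) (tr a s \<beta>)"
| "tr a s (ADia c d \<alpha>) = (if absorbed a s c d then Imp Bot (tr a s \<alpha>) else Dia c (tr a s \<alpha>))"

definition guess_fm :: "bool \<Rightarrow> nat \<Rightarrow> fm \<Rightarrow> fm" where
  "guess_fm s d \<psi> = (if flag s d then Dia 0 \<psi> else Imp (Dia 0 \<psi>) Bot)"

text \<open>With \<open>Imp\<close> and \<open>Bot\<close> as the only Boolean connectives, the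
  conjunction of all guess formulas is written as the negation of an implication chain ending in
  \<open>Bot\<close>. In Polish notation such a chain grows by prepending, which suits a pass from
  right to left; \<open>\<kappa>\<close> is the part already built.\<close>

primrec chain :: "nat \<Rightarrow> bool \<Rightarrow> afm \<Rightarrow> fm \<Rightarrow> fm" where
  "chain a s (AVar i) \<kappa> = \<kappa>"
| "chain a s ABot \<kappa> = \<kappa>"
| "chain a s (AImp \<alpha> \<beta>) \<kappa> = chain a s \<alpha> (chain a s \<beta> \<kappa>)"
| "chain a s (ADia c d \<alpha>) \<kappa> = Imp (guess_fm s d (tr a s \<alpha>)) (chain a s \<alpha> \<kappa>)"

definition query :: "nat \<Rightarrow> bool \<Rightarrow> afm \<Rightarrow> fm" where
  "query a s \<alpha> = Imp (Imp (tr a s \<alpha>) (chain a s \<alpha> Bot)) Bot"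

text \<open>The guesses are compared with the translated subformulas, not with truth in the sum, so
  this is a statement about one summand alone.\<close>

primrec correct :: "nat \<Rightarrow> bool \<Rightarrow> 'w frame \<Rightarrow> (nat \<Rightarrow> 'w set) \<Rightarrow> afm \<Rightarrow> bool" where
  "correct a s F V (AVar i) = True"
| "correct a s F V ABot = True"
| "correct a s F V (AImp \<alpha> \<beta>) = (correct a s F V \<alpha> \<and> correct a s F V \<beta>)"
| "correct a s F V (ADia c d \<alpha>) =
    ((flag s d \<longleftrightarrow> (\<exists>v \<in> worlds F. holds (univ_frame F) V v (tr a s \<alpha>))) \<and> correct a s F V \<alpha>)"

lemma univ_frame_simps [simp]:
  "worlds (univ_frame F) = worlds F" "rels (univ_frame F) ! 0 = worlds F \<times> worlds F"
  "rels (univ_frame F) ! Suc c = rels F ! c"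
  by (simp_all add: univ_frame_def)

text \<open>A guess formula is a possibly negated \<open>Dia 0\<close> formula, so its truth at one
  world speaks about the whole frame.\<close>

lemma holds_chain:
  assumes "w \<in> worlds F"
  shows "holds (univ_frame F) V w (chain a s \<alpha> \<kappa>) \<longleftrightarrow> (correct a s F V \<alpha> \<longrightarrow> holds (univ_frame F) V w \<kappa>)"
  using assms by (induction \<alpha> arbitrary: \<kappa>) (auto simp: guess_fm_def)

lemma holds_query:
  assumes "w \<in> worlds F"
  shows "holds (univ_frame F) V w (query a s \<alpha>) \<longleftrightarrow>
    correct a s F V \<alpha> \<and> holds (univ_frame F) V w (tr a s \<alpha>)"
  by (auto simp: query_def holds_chain[OF assms])

lemma modalities_tr: "modalities (tr a s \<alpha>) \<subseteq> insert 0 (modalities (erase \<alpha>))"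
  by (induction \<alpha>) auto

lemma modalities_chain: "modalities (chain a s \<alpha> \<kappa>) \<subseteq> insert 0 (modalities (erase \<alpha>) \<union> modalities \<kappa>)"
proof (induction \<alpha> arbitrary: \<kappa>)
  case (AImp \<alpha> \<beta>)
  show ?case using AImp.IH(1)[of "chain a s \<beta> \<kappa>"] AImp.IH(2)[of \<kappa>] by auto
next
  case (ADia c d \<alpha>)
  show ?case using ADia.IH[of \<kappa>] modalities_tr[of a s \<alpha>] by (auto simp: guess_fm_def)
qed auto

lemma modalities_query: "modalities (query a s \<alpha>) \<subseteq> insert 0 (modalities (erase \<alpha>))"
  using modalities_tr[of a s \<alpha>] modalities_chain[of a s \<alpha> Bot] by (auto simp: query_def)

lemma worlds_sum [simp]: "worlds (frame_sum a F G) = worlds F <+> worlds G"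
  by (simp add: frame_sum_def)

locale summands =
  fixes A a :: nat and F :: "'w frame" and G :: "'v frame"
    and V :: "nat \<Rightarrow> 'w set" and U :: "nat \<Rightarrow> 'v set"
  assumes frames: "is_frame A F" "is_frame A G" and a_less: "a < A"
begin

abbreviation sum_holds :: "'w + 'v \<Rightarrow> fm \<Rightarrow> bool" where
  "sum_holds \<equiv> holds (univ_frame (frame_sum a F G)) (\<lambda>i. V i <+> U i)"

lemma rels_sum:
  assumes "c < A"
  shows "(Inl w, Inl w') \<in> rels (frame_sum a F G) ! c \<longleftrightarrow> (w, w') \<in> rels F ! c"
    and "(Inr v, Inr v') \<in> rels (frame_sum a F G) ! c \<longleftrightarrow> (v, v') \<in> rels G ! c"
    and "(Inl w, Inr v) \<in> rels (frame_sum a F G) ! c \<longleftrightarrow> c = a \<and> w \<in> worlds F \<and> v \<in> worlds G"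
    and "(Inr v, Inl w) \<notin> rels (frame_sum a F G) ! c"
  using assms frames by (auto simp: frame_sum_def is_frame_def)

lemma rels_worlds:
  "c < A \<Longrightarrow> (w, w') \<in> rels F ! c \<Longrightarrow> w' \<in> worlds F" "c < A \<Longrightarrow> (v, v') \<in> rels G ! c \<Longrightarrow> v' \<in> worlds G"
proof -
  have "rels F ! c \<subseteq> worlds F \<times> worlds F" "rels G ! c \<subseteq> worlds G \<times> worlds G" if "c < A"
    using frames that by (simp_all add: is_frame_def)
  then show "c < A \<Longrightarrow> (w, w') \<in> rels F ! c \<Longrightarrow> w' \<in> worlds F"
    "c < A \<Longrightarrow> (v, v') \<in> rels G ! c \<Longrightarrow> v' \<in> worlds G" by blast+
qed

text \<open>The two sides cannot be separated: a diamond at a world of one side consults the guess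
  about the other side, and this guess, correct in terms of the translation there, speaks about the
  sum only by the induction hypothesis for that side.\<close>

lemma sum_holds_iff:
  assumes "modalities (erase \<alpha>) \<subseteq> {..<Suc A}" "correct a True F V \<alpha>" "correct a False G U \<alpha>"
  shows "(\<forall>w \<in> worlds F. holds (univ_frame F) V w (tr a True \<alpha>) \<longleftrightarrow> sum_holds (Inl w) (erase \<alpha>)) \<and>
         (\<forall>v \<in> worlds G. holds (univ_frame G) U v (tr a False \<alpha>) \<longleftrightarrow> sum_holds (Inr v) (erase \<alpha>))"
  using assms
proof (induction \<alpha>)
  case (ADia c d \<alpha>)
  then have IH: "w \<in> worlds F \<Longrightarrow> holds (univ_frame F) V w (tr a True \<alpha>) \<longleftrightarrow> sum_holds (Inl w) (erase \<alpha>)"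
    "v \<in> worlds G \<Longrightarrow> holds (univ_frame G) U v (tr a False \<alpha>) \<longleftrightarrow> sum_holds (Inr v) (erase \<alpha>)" for w v
    by simp_all
  have flags: "flag True d \<longleftrightarrow> (\<exists>w \<in> worlds F. sum_holds (Inl w) (erase \<alpha>))"
    "flag False d \<longleftrightarrow> (\<exists>v \<in> worlds G. sum_holds (Inr v) (erase \<alpha>))"
    using ADia.prems IH by simp_all
  show ?case
  proof (cases c)
    case 0
    then show ?thesis using IH flags by (auto simp: absorbed_def Plus_def)
  next
    case (Suc c')
    then have c': "c' < A" using ADia.prems by simp
    have "(\<exists>x. (Inl w, x) \<in> rels (frame_sum a F G) ! c' \<and> sum_holds x (erase \<alpha>)) \<longleftrightarrow>
        (\<exists>w'. (w, w') \<in> rels F ! c' \<and> sum_holds (Inl w') (erase \<alpha>)) \<or> c' = a \<and> flag False d"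
      if "w \<in> worlds F" for w
      unfolding flags using rels_sum[OF c'] that by (auto simp: split_sum_ex)
    moreover have "(\<exists>x. (Inr v, x) \<in> rels (frame_sum a F G) ! c' \<and> sum_holds x (erase \<alpha>)) \<longleftrightarrow>
        (\<exists>v'. (v, v') \<in> rels G ! c' \<and> sum_holds (Inr v') (erase \<alpha>))" for v
      using rels_sum[OF c'] by (auto simp: split_sum_ex)
    moreover have "(\<exists>w'. (w, w') \<in> rels F ! c' \<and> holds (univ_frame F) V w' (tr a True \<alpha>)) \<longleftrightarrow>
        (\<exists>w'. (w, w') \<in> rels F ! c' \<and> sum_holds (Inl w') (erase \<alpha>))" for w
      using IH(1) rels_worlds(1)[OF c'] by blast
    moreover have "(\<exists>v'. (v, v') \<in> rels G ! c' \<and> holds (univ_frame G) U v' (tr a False \<alpha>)) \<longleftrightarrow>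
        (\<exists>v'. (v, v') \<in> rels G ! c' \<and> sum_holds (Inr v') (erase \<alpha>))" for v
      using IH(2) rels_worlds(2)[OF c'] by blast
    \<comment> \<open>If \<open>c'\<close> is the linking relation and the argument occurs in the
      second summand, the diamond holds throughout the first one. In all other cases no linking pair
      contributes a witness.\<close>
    ultimately show ?thesis using Suc by (cases "c' = a \<and> flag False d") (auto simp: absorbed_def)
  qed
qed auto

text \<open>The guess read off from the model of the sum itself.\<close>

primrec annotate :: "fm \<Rightarrow> afm" where
  "annotate (Var i) = AVar i"
| "annotate Bot = ABot"
| "annotate (Imp \<phi> \<psi>) = AImp (annotate \<phi>) (annotate \<psi>)"
| "annotate (Dia c \<phi>) =
    ADia c (digit (\<exists>w \<in> worlds F. sum_holds (Inl w) \<phi>) (\<exists>v \<in> worlds G. sum_holds (Inr v) \<phi>)) (annotate \<phi>)"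

lemma erase_annotate [simp]: "erase (annotate \<phi>) = \<phi>"
  by (induction \<phi>) auto

lemma digits_ok_annotate: "digits_ok (annotate \<phi>)"
  by (induction \<phi>) auto

text \<open>When a diamond is reached, its argument is correctly annotated already, so
  \<open>sum_holds_iff\<close> turns truth in the sum, from which the digit was taken, into truth of
  the translation.\<close>

lemma correct_annotate:
  assumes "modalities \<phi> \<subseteq> {..<Suc A}"
  shows "correct a True F V (annotate \<phi>) \<and> correct a False G U (annotate \<phi>)"
  using assms
proof (induction \<phi>)
  case (Dia c \<phi>)
  then show ?case using sum_holds_iff[of "annotate \<phi>"] by auto
qed auto

end

lemma Sat_univ_classI:
  assumes "F \<in> C" "modalities \<phi> \<subseteq> {..<Suc A}" "\<And>i. V i \<subseteq> worlds F" "w \<in> worlds F"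
    "holds (univ_frame F) V w \<phi>"
  shows "\<phi> \<in> Sat (Suc A) (univ_class C)"
  using assms unfolding Sat_def univ_class_def satisfiable_in_def by auto

lemma Sat_sum_iff:
  assumes "\<forall>X \<in> C. is_frame A X" "\<forall>Y \<in> D. is_frame A Y" "a < A"
  shows "\<phi> \<in> Sat (Suc A) (univ_class (class_sum a C D)) \<longleftrightarrow>
    (\<exists>\<alpha>. erase \<alpha> = Dia 0 \<phi> \<and> digits_ok \<alpha> \<and> modalities \<phi> \<subseteq> {..<Suc A} \<and>
      query a True \<alpha> \<in> Sat (Suc A) (univ_class C) \<and> query a False \<alpha> \<in> Sat (Suc A) (univ_class D))"
    (is "?l \<longleftrightarrow> ?r")
proof
  assume ?l
  then obtain F G V x where FG: "F \<in> C" "G \<in> D" and mod: "modalities \<phi> \<subseteq> {..<Suc A}"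
    and V: "\<And>i. V i \<subseteq> worlds F <+> worlds G" and x: "x \<in> worlds F <+> worlds G"
      "holds (univ_frame (frame_sum a F G)) V x \<phi>"
    unfolding Sat_def univ_class_def class_sum_def satisfiable_in_def by clarsimp blast
  define VF VG where "VF i = Inl -` V i" and "VG i = Inr -` V i" for i
  interpret summands A a F G VF VG using assms FG by unfold_locales auto
  have Veq: "V = (\<lambda>i. VF i <+> VG i)"
    by (auto simp: fun_eq_iff VF_def VG_def set_eq_iff Plus_def image_iff) (metis sum.exhaust)
  let ?\<alpha> = "annotate (Dia 0 \<phi>)"
  have corr: "correct a True F VF ?\<alpha>" "correct a False G VG ?\<alpha>"
    using correct_annotate[of "Dia 0 \<phi>"] mod by auto
  \<comment> \<open>Any two worlds will do, because \<open>Dia 0 \<phi>\<close> holds everywhere in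
    the sum; frames being nonempty is essential here.\<close>
  obtain w v where w: "w \<in> worlds F" and v: "v \<in> worlds G" using frames by (auto simp: is_frame_def)
  have "sum_holds (Inl w) (Dia 0 \<phi>)" "sum_holds (Inr v) (Dia 0 \<phi>)"
    using x w v unfolding Veq by auto
  then have "holds (univ_frame F) VF w (tr a True ?\<alpha>)" "holds (univ_frame G) VG v (tr a False ?\<alpha>)"
    using sum_holds_iff[of ?\<alpha>] corr mod w v unfolding erase_annotate by auto
  then have "holds (univ_frame F) VF w (query a True ?\<alpha>)" "holds (univ_frame G) VG v (query a False ?\<alpha>)"
    using corr w v by (simp_all only: holds_query)
  moreover have "VF i \<subseteq> worlds F" "VG i \<subseteq> worlds G" for i using V[of i] by (auto simp: VF_def VG_def)
  moreover have "modalities (query a s ?\<alpha>) \<subseteq> {..<Suc A}" for s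
    using modalities_query[of a s ?\<alpha>] mod unfolding erase_annotate by auto
  ultimately have "query a True ?\<alpha> \<in> Sat (Suc A) (univ_class C)" "query a False ?\<alpha> \<in> Sat (Suc A) (univ_class D)"
    using w v FG by (blast intro: Sat_univ_classI)+
  then show ?r using digits_ok_annotate mod erase_annotate by blast
next
  assume ?r
  then obtain \<alpha> where \<alpha>: "erase \<alpha> = Dia 0 \<phi>" and mod: "modalities \<phi> \<subseteq> {..<Suc A}"
    and q: "query a True \<alpha> \<in> Sat (Suc A) (univ_class C)" "query a False \<alpha> \<in> Sat (Suc A) (univ_class D)" by blast
  obtain F V w where F: "F \<in> C" "\<And>i. V i \<subseteq> worlds F" "w \<in> worlds F" "holds (univ_frame F) V w (query a True \<alpha>)"
    using q(1) by (auto simp: Sat_def univ_class_def satisfiable_in_def)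
  obtain G U v where G: "G \<in> D" "\<And>i. U i \<subseteq> worlds G" "v \<in> worlds G" "holds (univ_frame G) U v (query a False \<alpha>)"
    using q(2) by (auto simp: Sat_def univ_class_def satisfiable_in_def)
  interpret summands A a F G V U using assms F G by unfold_locales auto
  \<comment> \<open>A single world of the first summand suffices, as the universal diamond there
    reaches both summands. The formula over \<open>D\<close> contributes the correctness of its
    guesses.\<close>
  have "sum_holds (Inl w) (Dia 0 \<phi>)"
    using sum_holds_iff[of \<alpha>] F G mod \<alpha> by (simp add: holds_query del: holds.simps)
  then obtain x where "x \<in> worlds F <+> worlds G" "sum_holds x \<phi>" by auto
  moreover have "V i <+> U i \<subseteq> worlds F <+> worlds G" for i using F(2)[of i] G(2)[of i] by auto
  ultimately have "satisfiable_in (univ_frame (frame_sum a F G)) \<phi>"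
    unfolding satisfiable_in_def by (intro exI[of _ "\<lambda>i. V i <+> U i"]) auto
  then show ?l using F(1) G(1) mod by (auto simp: Sat_def univ_class_def class_sum_def)
qed

text \<open>Shifting by 1 makes room for the universal modality number 0, shifting by 0 changes
  nothing. With the amount as a parameter, one program serves the signatures with and without
  universal modality.\<close>

primrec shift :: "nat \<Rightarrow> fm \<Rightarrow> fm" where
  "shift n (Var i) = Var i"
| "shift n Bot = Bot"
| "shift n (Imp \<phi> \<psi>) = Imp (shift n \<phi>) (shift n \<psi>)"
| "shift n (Dia c \<phi>) = Dia (c + n) (shift n \<phi>)"

lemma shift_0 [simp]: "shift 0 \<phi> = \<phi>"
  by (induction \<phi>) auto

lemma modalities_shift: "modalities (shift n \<phi>) = (\<lambda>c. c + n) ` modalities \<phi>"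
  by (induction \<phi>) auto

lemma holds_shift: "holds (univ_frame F) V w (shift 1 \<phi>) \<longleftrightarrow> holds F V w \<phi>"
  by (induction \<phi> arbitrary: w) auto

lemma Sat_shift: "shift 1 \<phi> \<in> Sat (Suc A) (univ_class C) \<longleftrightarrow> \<phi> \<in> Sat A C"
  by (auto simp: Sat_def univ_class_def satisfiable_in_def modalities_shift holds_shift[simplified] holds_shift)

section \<open>The translation as one pass over a token list\<close>

definition index_bits :: "nat \<Rightarrow> bool list" where
  "index_bits n = concat (map (\<lambda>b. [True, b]) (binary n))"

lemma encode_nat_index: "encode_nat n = index_bits n @ [False]"
  by (simp add: encode_nat_def index_bits_def)

text \<open>Modalities are bounded, so each fits into a single token together with its digit;
  variable indices are unbounded and remain bits. \<open>TEnd\<close> takes the place of the final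
  \<open>False\<close> of an index, so that a pass from the right notices where a new subformula
  begins.\<close>

primrec toks :: "afm \<Rightarrow> tok list" where
  "toks (AVar i) = TVar # map TBit (index_bits i) @ [TEnd]"
| "toks ABot = [TBot]"
| "toks (AImp \<alpha> \<beta>) = TImp # toks \<alpha> @ toks \<beta>"
| "toks (ADia c d \<alpha>) = TDia c d # toks \<alpha>"

text \<open>The four bits of an absorbed diamond are the code of \<open>Imp Bot\<close>, with the
  second argument still to come.\<close>

definition dia_prefix :: "nat \<Rightarrow> bool \<Rightarrow> nat \<Rightarrow> nat \<Rightarrow> bool list" where
  "dia_prefix a s c d = (if absorbed a s c d then [False, True, False, False] else [True, True] @ encode_nat c)"

text \<open>The first pair of bits opens the implication of the chain, and
  \<open>[True, True, False]\<close> is \<open>Dia 0\<close>. A negative guess is an implication to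
  \<open>Bot\<close>, opened by the second pair and closed by \<open>guess_suffix\<close>.\<close>

definition guess_prefix :: "bool \<Rightarrow> nat \<Rightarrow> bool list" where
  "guess_prefix s d = [False, True] @ (if flag s d then [] else [False, True]) @ [True, True, False]"

definition guess_suffix :: "bool \<Rightarrow> nat \<Rightarrow> bool list" where
  "guess_suffix s d = (if flag s d then [] else [False, False])"

text \<open>Reading the tokens from right to left, the first stack collects the codes of the
  translated subformulas, each followed by a separator, and the second one the chain.\<close>

fun tstep :: "nat \<Rightarrow> bool \<Rightarrow> tok \<Rightarrow> tok list \<times> tok list \<Rightarrow> tok list \<times> tok list" where
  "tstep a s (TBit b) (x, y) = (TBit b # x, y)"
| "tstep a s TEnd (x, y) = (TBit False # TSep # x, y)"
| "tstep a s TVar (x, y) = (map TBit [True, False] @ x, y)"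
| "tstep a s TBot (x, y) = (map TBit [False, False] @ TSep # x, y)"
| "tstep a s TImp (x, y) =
    (map TBit [False, True] @ takeWhile (\<lambda>t. t \<noteq> TSep) x @ tl (dropWhile (\<lambda>t. t \<noteq> TSep) x), y)"
| "tstep a s (TDia c d) (x, y) = (map TBit (dia_prefix a s c d) @ x,
     map TBit (guess_prefix s d) @ takeWhile (\<lambda>t. t \<noteq> TSep) x @ map TBit (guess_suffix s d) @ y)"
| "tstep a s _ xy = xy"

lemma foldr_TBit: "foldr (tstep a s) (map TBit bs) (x, y) = (map TBit bs @ x, y)"
  by (induction bs) auto

lemma takeWhile_bits [simp]:
  "takeWhile (\<lambda>t. t \<noteq> TSep) (map TBit bs @ TSep # x) = map TBit bs"
  "dropWhile (\<lambda>t. t \<noteq> TSep) (map TBit bs @ TSep # x) = TSep # x"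
  by (induction bs) auto

lemma encode_nat_0: "encode_nat 0 = [False]"
  by (simp add: encode_nat_def)

text \<open>Holds over arbitrary remaining stacks, so that it composes: for an implication the right
  argument is done first and its chain becomes the tail of the left one. Dropping the first
  separator then joins the two codes.\<close>

lemma foldr_tstep:
  "foldr (tstep a s) (toks \<alpha>) (x, map TBit (encode \<kappa>) @ y) =
   (map TBit (encode (tr a s \<alpha>)) @ TSep # x, map TBit (encode (chain a s \<alpha> \<kappa>)) @ y)"
proof (induction \<alpha> arbitrary: x y \<kappa>)
  case (AVar i)
  then show ?case by (simp add: foldr_TBit encode_nat_index)
next
  case (AImp \<alpha> \<beta>)
  show ?case by (simp add: AImp)
next
  case (ADia c d \<alpha>)
  then show ?case
    by (simp add: dia_prefix_def guess_prefix_def guess_suffix_def guess_fm_def encode_nat_0)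
qed auto

definition code_toks :: "fm \<Rightarrow> tok list" where
  "code_toks \<phi> = map TBit (encode \<phi>)"

text \<open>Of the two initial \<open>Bot\<close>, one ends the chain and the other ends the outer
  implication of \<open>query\<close>; the two pairs of bits in front open the two outermost
  implications.\<close>

lemma query_toks:
  "foldr (tstep a s) (toks \<alpha>) ([], code_toks Bot @ code_toks Bot) = (x, y) \<Longrightarrow>
   \<exists>u. x = map TBit u @ [TSep] \<and>
   map TBit [False, True] @ map TBit [False, True] @ map TBit u @ y = code_toks (query a s \<alpha>)"
  using foldr_tstep[of a s \<alpha> "[]" Bot "code_toks Bot"]
  by (auto simp: code_toks_def query_def)

section \<open>Parsing formulas and enumerating guesses\<close>

definition pairs :: "bool list \<Rightarrow> bool list" where
  "pairs bs = concat (map (\<lambda>b. [True, b]) bs)"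

lemma pairs_simps [simp]: "pairs [] = []" "pairs (b # bs) = True # b # pairs bs"
  by (simp_all add: pairs_def)

lemma index_bits_pairs: "index_bits i = pairs (binary i)"
  by (simp add: index_bits_def pairs_def)

definition nat_of :: "bool list \<Rightarrow> nat" where
  "nat_of bs = foldr (\<lambda>b v. of_bool b + 2 * v) bs 0"

lemma nat_of_simps [simp]: "nat_of [] = 0" "nat_of (b # bs) = of_bool b + 2 * nat_of bs"
  by (simp_all add: nat_of_def)

text \<open>Bits come least significant first, so a number has no leading zeros iff its last bit is
  \<open>True\<close>. \<open>l\<close> is the bit before \<open>bs\<close>, and \<open>True\<close>
  at the very start because 0 is the empty word.\<close>

definition proper :: "bool \<Rightarrow> bool list \<Rightarrow> bool" where
  "proper l bs \<longleftrightarrow> (if bs = [] then l else last bs)"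

lemma proper_simps [simp]: "proper l [] = l" "proper l (b # bs) = proper b bs"
  by (auto simp: proper_def)

lemma nat_of_binary: "nat_of (binary n) = n"
proof (induction n rule: less_induct)
  case (less n)
  show ?case
  proof (cases "n = 0")
    case False
    then have "nat_of (binary (n div 2)) = n div 2" by (intro less.IH) simp
    then show ?thesis using False binary_pos[of n] by (cases "odd n") auto
  qed simp
qed

lemma nat_of_pos: "proper False bs \<Longrightarrow> 0 < nat_of bs"
proof (induction bs)
  case (Cons b bs)
  then show ?case by (cases b) simp_all
qed simp

lemma binary_nat_of: "proper True bs \<Longrightarrow> binary (nat_of bs) = bs"
proof (induction bs)
  case (Cons b bs)
  have "proper True bs" using Cons.prems by (cases bs) simp_all
  then have IH: "binary (nat_of bs) = bs" by (rule Cons.IH)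
  have "0 < nat_of (b # bs)" using Cons.prems by (intro nat_of_pos) simp
  from binary_pos[OF this] show ?case using IH by (cases b) simp_all
qed simp

lemma proper_binary: "proper True (binary n)"
proof (induction n rule: less_induct)
  case (less n)
  show ?case
  proof (cases "n = 0")
    case False
    then have IH: "proper True (binary (n div 2))" by (intro less.IH) simp
    show ?thesis
    proof (cases "odd n")
      case False
      then have "binary (n div 2) \<noteq> []" using \<open>n \<noteq> 0\<close> binary_eq_Nil_iff[of "n div 2"] by auto
      then show ?thesis using IH binary_pos[of n] \<open>n \<noteq> 0\<close> by (simp add: proper_def)
    qed (use IH binary_pos[of n] \<open>n \<noteq> 0\<close> in auto)
  qed simp
qed

text \<open>Modalities up to \<open>A\<close> have at most \<open>A\<close> bits; so the parser may
  give up on longer ones, which keeps its phases finite in number.\<close>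

lemma length_binary: "length (binary n) \<le> n"
proof (induction n rule: less_induct)
  case (less n)
  show ?case
  proof (cases "n = 0")
    case False
    then have "length (binary (n div 2)) \<le> n div 2" by (intro less.IH) simp
    then show ?thesis using False binary_pos[of n] by simp
  qed simp
qed

text \<open>One step of the parser: new phase, tokens produced, and the change of the number of formulas
  still to be read (1 for an increment, 2 for a decrement). \<open>Index l\<close> and \<open>Mod v j l\<close> read a number;
  \<open>l\<close> tells whether it may end here, and \<open>v\<close> is the value of the \<open>j\<close> bits read so far.\<close>

fun pact :: "nat \<Rightarrow> nat \<Rightarrow> phase \<Rightarrow> bool \<Rightarrow> bool \<Rightarrow> phase \<times> tok list \<times> nat" where
  "pact A n Tag b nz = (if nz then Tag2 b else Fail, [], 0)"
| "pact A n (Tag2 u) b nz =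
     (if u then (if b then (Mod 0 0 True, [], 0) else (Index True, [TVar], 0))
      else (if b then (Tag, [TImp], 1) else (Tag, [TBot], 2)))"
| "pact A n (Index l) b nz =
     (if b then (IndexBit, [TBit True], 0) else if l then (Tag, [TEnd], 2) else (Fail, [], 0))"
| "pact A n IndexBit b nz = (Index b, [TBit b], 0)"
| "pact A n (Mod v j l) b nz =
     (if b then (if j \<le> A then ModBit v j else Fail, [], 0)
      else if l \<and> v + n \<le> A then (Tag, [TDia (v + n) 0], 0) else (Fail, [], 0))"
| "pact A n (ModBit v j) b nz = (Mod (v + of_bool b * 2 ^ j) (Suc j) b, [], 0)"
| "pact A n Fail b nz = (Fail, [], 0)"

fun pstep :: "nat \<Rightarrow> nat \<Rightarrow> phase \<times> tok list \<times> nat \<Rightarrow> bool \<Rightarrow> phase \<times> tok list \<times> nat" where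
  "pstep A n (ph, B, D) b = (case pact A n ph b (D \<noteq> 0) of (ph', ts, e) \<Rightarrow>
     (ph', ts @ B, if e = 1 then Suc D else if e = 2 then D - 1 else D))"

primrec zero :: "fm \<Rightarrow> afm" where
  "zero (Var i) = AVar i"
| "zero Bot = ABot"
| "zero (Imp \<phi> \<psi>) = AImp (zero \<phi>) (zero \<psi>)"
| "zero (Dia c \<phi>) = ADia c 0 (zero \<phi>)"

lemma erase_zero [simp]: "erase (zero \<phi>) = \<phi>"
  by (induction \<phi>) auto

lemma digits_ok_zero: "digits_ok (zero \<phi>)"
  by (induction \<phi>) auto

lemma parse_index:
  "proper l bs \<Longrightarrow> foldl (pstep A n) (Index l, B, D) (pairs bs @ [False]) =
   (Tag, TEnd # rev (map TBit (pairs bs)) @ B, D - 1)"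
  by (induction bs arbitrary: l B) auto

lemma parse_modality:
  "proper l bs \<Longrightarrow> j + length bs \<le> Suc A \<Longrightarrow> v + 2 ^ j * nat_of bs + n \<le> A \<Longrightarrow>
   foldl (pstep A n) (Mod v j l, B, D) (pairs bs @ [False]) = (Tag, TDia (v + 2 ^ j * nat_of bs + n) 0 # B, D)"
  by (induction bs arbitrary: l v j) (auto simp: algebra_simps)

lemma parse_encode:
  assumes "\<forall>c \<in> modalities \<phi>. c + n \<le> A"
  shows "foldl (pstep A n) (Tag, B, Suc D) (encode \<phi>) = (Tag, rev (toks (zero (shift n \<phi>))) @ B, D)"
  using assms
proof (induction \<phi> arbitrary: B D)
  case (Var i)
  then show ?case
    using parse_index[OF proper_binary, of A n "TVar # B" "Suc D" i]
    by (simp add: encode_nat_index index_bits_pairs)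
next
  case (Dia c \<phi>)
  have "foldl (pstep A n) (Mod 0 0 True, B, Suc D) (encode_nat c) = (Tag, TDia (c + n) 0 # B, Suc D)"
    using parse_modality[OF proper_binary, of 0 c A 0 n B "Suc D"] Dia.prems length_binary[of c]
    by (simp add: encode_nat_index index_bits_pairs nat_of_binary)
  then show ?case using Dia by simp
qed auto

lemma parse_Fail: "foldl (pstep A n) (Fail, B, D) x = (Fail, B, D)"
  by (induction x) auto

text \<open>A run that gets back to \<open>Tag\<close> must have read a complete number. The tokens
  produced are left open, because only acceptance matters in this direction. Two bits are consumed
  at a time, hence induction on the length.\<close>

lemma parse_index_rev:
  "foldl (pstep A n) (Index l, B, D) x = (Tag, B', E) \<Longrightarrow>
   \<exists>bs y B''. x = pairs bs @ False # y \<and> proper l bs \<and> foldl (pstep A n) (Tag, B'', D - 1) y = (Tag, B', E)"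
proof (induction "length x" arbitrary: x l B rule: less_induct)
  case less
  consider "x = []" | y where "x = False # y" | "x = [True]" | b y where "x = True # b # y"
    by (metis list.exhaust)
  then show ?case
  proof cases
    case 2
    then have "proper l [] \<and> foldl (pstep A n) (Tag, TEnd # B, D - 1) y = (Tag, B', E)"
      using less.prems by (auto simp: parse_Fail split: if_splits)
    then show ?thesis using 2 by (metis append_Nil pairs_simps(1))
  next
    case 4
    then have "foldl (pstep A n) (Index b, TBit b # TBit True # B, D) y = (Tag, B', E)" "length y < length x"
      using less.prems by auto
    from less.hyps[OF this(2,1)] obtain bs z B'' where "y = pairs bs @ False # z" "proper b bs"
      "foldl (pstep A n) (Tag, B'', D - 1) z = (Tag, B', E)" by blast
    then show ?thesis using 4 by (intro exI[of _ "b # bs"] exI[of _ z] exI[of _ B'']) simp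
  qed (use less.prems in auto)
qed

lemma parse_modality_rev:
  "foldl (pstep A n) (Mod v j l, B, D) x = (Tag, B', E) \<Longrightarrow>
   \<exists>bs y B''. x = pairs bs @ False # y \<and> proper l bs \<and> v + 2 ^ j * nat_of bs + n \<le> A \<and>
     foldl (pstep A n) (Tag, B'', D) y = (Tag, B', E)"
proof (induction "length x" arbitrary: x v j l rule: less_induct)
  case less
  consider "x = []" | y where "x = False # y" | "x = [True]" | b y where "x = True # b # y"
    by (metis list.exhaust)
  then show ?case
  proof cases
    case 2
    then have "proper l [] \<and> v + n \<le> A \<and> foldl (pstep A n) (Tag, TDia (v + n) 0 # B, D) y = (Tag, B', E)"
      using less.prems by (auto simp: parse_Fail split: if_splits)
    then show ?thesis using 2 by (intro exI[of _ "[]"] exI[of _ y] exI[of _ "TDia (v + n) 0 # B"]) simp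
  next
    case 4
    then have "foldl (pstep A n) (Mod (v + of_bool b * 2 ^ j) (Suc j) b, B, D) y = (Tag, B', E)" "length y < length x"
      using less.prems by (auto simp: parse_Fail split: if_splits)
    from less.hyps[OF this(2,1)] obtain bs z B'' where *: "y = pairs bs @ False # z" "proper b bs"
      "v + of_bool b * 2 ^ j + 2 ^ Suc j * nat_of bs + n \<le> A"
      "foldl (pstep A n) (Tag, B'', D) z = (Tag, B', E)" by blast
    have "v + 2 ^ j * nat_of (b # bs) + n \<le> A" using *(3) by (simp add: algebra_simps)
    then show ?thesis using 4 * by (intro exI[of _ "b # bs"] exI[of _ z] exI[of _ B'']) simp
  qed (use less.prems in \<open>auto split: if_splits\<close>)
qed

text \<open>Generalised to any counter value, since the tag of an implication makes the parser
  expect two formulas in place of one; the list of formulas is regrouped afterwards.\<close>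

lemma parse_formulas:
  "foldl (pstep A n) (Tag, B, D) x = (Tag, B', 0) \<Longrightarrow>
   \<exists>\<phi>s. length \<phi>s = D \<and> x = concat (map encode \<phi>s) \<and> (\<forall>\<phi> \<in> set \<phi>s. \<forall>c \<in> modalities \<phi>. c + n \<le> A)"
proof (induction "length x" arbitrary: x B D rule: less_induct)
  case less
  show ?case
  proof (cases D)
    case 0
    \<comment> \<open>With counter 0 any further bit leads from \<open>Tag\<close> to
      \<open>Fail\<close>, so trailing bits are rejected.\<close>
    then have "x = []" using less.prems by (cases x) (auto simp: parse_Fail)
    then show ?thesis using 0 by simp
  next
    case (Suc D')
    consider "x = []" | u where "x = [u]" | u b y where "x = u # b # y"
      by (metis list.exhaust)
    then show ?thesis
    proof cases
      case (3 u b y)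
      have len: "length y < length x" using 3 by simp
      consider "\<not> u" "\<not> b" | "\<not> u" b | u "\<not> b" | u b by blast
      then show ?thesis
      proof cases
        case 1
        then have "foldl (pstep A n) (Tag, TBot # B, D') y = (Tag, B', 0)" using less.prems 3 Suc by simp
        from less.hyps[OF len this] obtain \<phi>s where "length \<phi>s = D'" "y = concat (map encode \<phi>s)"
          "\<forall>\<phi> \<in> set \<phi>s. \<forall>c \<in> modalities \<phi>. c + n \<le> A" by blast
        then show ?thesis using 1 3 Suc by (intro exI[of _ "Bot # \<phi>s"]) auto
      next
        case 2
        then have "foldl (pstep A n) (Tag, TImp # B, Suc D) y = (Tag, B', 0)" using less.prems 3 Suc by simp
        from less.hyps[OF len this] obtain \<phi>s where *: "length \<phi>s = Suc D" "y = concat (map encode \<phi>s)"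
          "\<forall>\<phi> \<in> set \<phi>s. \<forall>c \<in> modalities \<phi>. c + n \<le> A" by blast
        then obtain \<phi> \<psi> \<phi>s' where "\<phi>s = \<phi> # \<psi> # \<phi>s'" using Suc by (metis length_Suc_conv)
        then show ?thesis using * 2 3 Suc by (intro exI[of _ "Imp \<phi> \<psi> # \<phi>s'"]) auto
      next
        case c: 3
        then have "foldl (pstep A n) (Index True, TVar # B, D) y = (Tag, B', 0)" using less.prems 3 Suc by simp
        from parse_index_rev[OF this] obtain bs z B'' where *: "y = pairs bs @ False # z" "proper True bs"
          "foldl (pstep A n) (Tag, B'', D') z = (Tag, B', 0)" using Suc by auto
        have "length z < length x" using *(1) 3 by simp
        from less.hyps[OF this *(3)] obtain \<phi>s where "length \<phi>s = D'" "z = concat (map encode \<phi>s)"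
          "\<forall>\<phi> \<in> set \<phi>s. \<forall>c \<in> modalities \<phi>. c + n \<le> A" by blast
        then show ?thesis using * c 3 Suc
          by (intro exI[of _ "Var (nat_of bs) # \<phi>s"]) (auto simp: encode_nat_index index_bits_pairs binary_nat_of)
      next
        case 4
        then have "foldl (pstep A n) (Mod 0 0 True, B, D) y = (Tag, B', 0)" using less.prems 3 Suc by simp
        from parse_modality_rev[OF this] obtain bs z B'' where *: "y = pairs bs @ False # z" "proper True bs"
          "nat_of bs + n \<le> A" "foldl (pstep A n) (Tag, B'', D) z = (Tag, B', 0)" by auto
        have "length z < length x" using *(1) 3 by simp
        from less.hyps[OF this *(4)] obtain \<phi>s where **: "length \<phi>s = D" "z = concat (map encode \<phi>s)"
          "\<forall>\<phi> \<in> set \<phi>s. \<forall>c \<in> modalities \<phi>. c + n \<le> A" by blast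
        then obtain \<phi> \<phi>s' where "\<phi>s = \<phi> # \<phi>s'" using Suc by (metis length_Suc_conv)
        then show ?thesis using * ** 4 3 Suc
          by (intro exI[of _ "Dia (nat_of bs) \<phi> # \<phi>s'"]) (auto simp: encode_nat_index index_bits_pairs binary_nat_of)
      qed
    qed (use less.prems Suc in auto)
  qed
qed

lemma parse_iff:
  "(\<exists>B'. foldl (pstep A n) (Tag, B, 1) x = (Tag, B', 0)) \<longleftrightarrow>
   (\<exists>\<phi>. x = encode \<phi> \<and> (\<forall>c \<in> modalities \<phi>. c + n \<le> A))"
proof
  assume "\<exists>B'. foldl (pstep A n) (Tag, B, 1) x = (Tag, B', 0)"
  then obtain \<phi>s where "length \<phi>s = 1" "x = concat (map encode \<phi>s)"
    "\<forall>\<phi> \<in> set \<phi>s. \<forall>c \<in> modalities \<phi>. c + n \<le> A" using parse_formulas by blast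
  then show "\<exists>\<phi>. x = encode \<phi> \<and> (\<forall>c \<in> modalities \<phi>. c + n \<le> A)"
    by (auto simp: length_Suc_conv)
next
  assume "\<exists>\<phi>. x = encode \<phi> \<and> (\<forall>c \<in> modalities \<phi>. c + n \<le> A)"
  then show "\<exists>B'. foldl (pstep A n) (Tag, B, 1) x = (Tag, B', 0)"
    using parse_encode[of _ n A B 0] by auto
qed

text \<open>A phase is stored as one tape symbol, so only finitely many may occur. The number of
  bits read is limited, and \<open>v < 2 ^ j\<close> limits the value with it.\<close>

fun phase_ok :: "nat \<Rightarrow> phase \<Rightarrow> bool" where
  "phase_ok A (Mod v j l) = (v < 2 ^ j \<and> j \<le> A + 1)"
| "phase_ok A (ModBit v j) = (v < 2 ^ j \<and> j \<le> A)"
| "phase_ok A _ = True"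

lemma finite_phase_ok: "finite {ph. phase_ok A ph}"
proof -
  let ?V = "{..<2 ^ Suc A}" and ?J = "{..Suc A}"
  have "(2::nat) ^ j \<le> 2 ^ Suc A" if "j \<le> Suc A" for j using that by (intro power_increasing) auto
  then have "{ph. phase_ok A ph} \<subseteq> {Tag, Tag2 True, Tag2 False, Index True, Index False, IndexBit, Fail}
     \<union> (\<lambda>(v, j, l). Mod v j l) ` (?V \<times> ?J \<times> UNIV) \<union> (\<lambda>(v, j). ModBit v j) ` (?V \<times> ?J)"
  proof (intro subsetI, elim CollectE)
    fix ph
    assume *: "phase_ok A ph" and le: "\<And>j. j \<le> Suc A \<Longrightarrow> (2::nat) ^ j \<le> 2 ^ Suc A"
    show "ph \<in> {Tag, Tag2 True, Tag2 False, Index True, Index False, IndexBit, Fail}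
     \<union> (\<lambda>(v, j, l). Mod v j l) ` (?V \<times> ?J \<times> UNIV) \<union> (\<lambda>(v, j). ModBit v j) ` (?V \<times> ?J)"
    proof (cases ph)
      case (Mod v j l)
      then have "v < 2 ^ Suc A" "j \<le> Suc A" using * le[of j] by auto
      then show ?thesis using Mod by (auto simp: image_iff)
    next
      case (ModBit v j)
      then have "v < 2 ^ Suc A" "j \<le> Suc A" using * le[of j] by auto
      then show ?thesis using ModBit by (auto simp: image_iff)
    qed auto
  qed
  then show ?thesis by (rule finite_subset) auto
qed

definition tok_ok :: "nat \<Rightarrow> tok \<Rightarrow> bool" where
  "tok_ok A t \<longleftrightarrow> (case t of TDia c d \<Rightarrow> c \<le> A \<and> d < 4 | TBit _ \<Rightarrow> True | TEnd \<Rightarrow> True | TVar \<Rightarrow> True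
     | TBot \<Rightarrow> True | TImp \<Rightarrow> True | _ \<Rightarrow> False)"

lemma pact_ok:
  assumes "pact A n ph b nz = (ph', ts, e)" "phase_ok A ph"
  shows "phase_ok A ph' \<and> list_all (tok_ok A) ts \<and> length ts \<le> 1"
  using assms by (cases ph) (auto simp: tok_ok_def split: if_splits)

text \<open>Successor of a counter in base 4 whose digits sit in the diamond tokens, least
  significant first; other tokens are passed over, and \<open>None\<close> is overflow. It is
  applied to the reversed token list, whose head is the top of the token stack.\<close>

fun inc :: "tok list \<Rightarrow> tok list option" where
  "inc [] = None"
| "inc (t # ts) = (case t of
     TDia c d \<Rightarrow> if d < 3 then Some (TDia c (Suc d) # ts) else map_option ((#) (TDia c 0)) (inc ts)
   | _ \<Rightarrow> map_option ((#) t) (inc ts))"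

definition skel :: "tok \<Rightarrow> tok" where
  "skel t = (case t of TDia c d \<Rightarrow> TDia c 0 | _ \<Rightarrow> t)"

fun val :: "tok list \<Rightarrow> nat" where
  "val [] = 0"
| "val (t # ts) = (case t of TDia c d \<Rightarrow> d + 4 * val ts | _ \<Rightarrow> val ts)"

lemma inc_Some:
  "inc ts = Some us \<Longrightarrow> list_all (tok_ok A) ts \<Longrightarrow>
   map skel us = map skel ts \<and> list_all (tok_ok A) us \<and> val us = Suc (val ts) \<and> length us = length ts"
proof (induction ts arbitrary: us)
  case (Cons t ts)
  show ?case
  proof (cases "\<exists>c d. t = TDia c d")
    case True
    then obtain c d where t: "t = TDia c d" by blast
    then have d: "d < 4" "c \<le> A" using Cons.prems by (auto simp: tok_ok_def)
    show ?thesis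
    proof (cases "d < 3")
      case False
      then have "d = 3" using d by simp
      then show ?thesis using Cons t d by (auto simp: skel_def tok_ok_def)
    qed (use Cons t d in \<open>auto simp: skel_def tok_ok_def\<close>)
  next
    case False
    then obtain vs where "inc ts = Some vs" "us = t # vs" using Cons.prems by (cases t) auto
    then show ?thesis using Cons.IH[of vs] Cons.prems False by (cases t) auto
  qed
qed simp

text \<open>Overflow occurs only if all digits are 3, the largest value on the given
  skeleton.\<close>

lemma val_le:
  "inc ts = None \<Longrightarrow> map skel us = map skel ts \<Longrightarrow> list_all (tok_ok A) ts \<Longrightarrow> list_all (tok_ok A) us \<Longrightarrow> val us \<le> val ts"
proof (induction ts arbitrary: us)
  case (Cons t ts)
  then obtain u us' where us: "us = u # us'" "skel u = skel t" "map skel us' = map skel ts" by auto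
  show ?case
  proof (cases "\<exists>c d. t = TDia c d")
    case True
    then obtain c d where t: "t = TDia c d" by blast
    then obtain d' where u: "u = TDia c d'" using us(2) by (cases u) (auto simp: skel_def)
    have "\<not> d < 3" "inc ts = None" using Cons.prems(1) t by (auto split: if_splits)
    moreover have "d' < 4" using Cons.prems us u by (auto simp: tok_ok_def)
    ultimately show ?thesis using Cons.IH[of us'] us t u Cons.prems by auto
  next
    case False
    then have "inc ts = None" "val (t # ts) = val ts" "val us = val us'"
      using Cons.prems(1) us by (cases t; cases u; auto simp: skel_def)+
    then show ?thesis using Cons.IH[of us'] us Cons.prems by auto
  qed
qed simp

lemma val_inject:
  "val ts = val us \<Longrightarrow> map skel us = map skel ts \<Longrightarrow> list_all (tok_ok A) ts \<Longrightarrow> list_all (tok_ok A) us \<Longrightarrow> ts = us"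
proof (induction ts arbitrary: us)
  case (Cons t ts)
  then obtain u us' where us: "us = u # us'" "skel u = skel t" "map skel us' = map skel ts" by auto
  show ?case
  proof (cases "\<exists>c d. t = TDia c d")
    case True
    then obtain c d where t: "t = TDia c d" by blast
    then obtain d' where u: "u = TDia c d'" using us(2) by (cases u) (auto simp: skel_def)
    have "d < 4" "d' < 4" "d + 4 * val ts = d' + 4 * val us'" using Cons.prems t u us(1) by (auto simp: tok_ok_def)
    then have "d = d'" "val ts = val us'" by presburger+
    then show ?thesis using Cons.IH[of us'] us t u Cons.prems by auto
  next
    case False
    then have "t = u" "val ts = val us'"
      using Cons.prems(1) us by (cases t; cases u; auto simp: skel_def)+
    then show ?thesis using Cons.IH[of us'] us Cons.prems by auto
  qed
qed simp

text \<open>A crude bound that counts every token as a digit; it serves the termination of the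
  search.\<close>

lemma val_less: "list_all (tok_ok A) ts \<Longrightarrow> val ts < 4 ^ length ts"
proof (induction ts)
  case (Cons t ts)
  then show ?case by (cases t) (auto simp: tok_ok_def)
qed simp

lemma skel_TBit [simp]: "skel t = TBit b \<longleftrightarrow> t = TBit b"
  by (cases t) (auto simp: skel_def)

lemma map_skel_bits: "map skel ts = map TBit bs \<longleftrightarrow> ts = map TBit bs"
  by (induction bs arbitrary: ts) (auto simp: map_eq_Cons_conv)

lemma skel_bits: "map skel (map TBit bs) = map TBit bs"
  by (simp add: map_skel_bits)

text \<open>Every assignment of digits below 4 to the diamond tokens is a guess, so counting never
  leaves the token lists of annotated formulas.\<close>

lemma toks_skel:
  "map skel ts = map skel (toks \<alpha>) \<Longrightarrow> list_all (tok_ok A) ts \<Longrightarrow>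
   \<exists>\<beta>. ts = toks \<beta> \<and> erase \<beta> = erase \<alpha> \<and> digits_ok \<beta>"
proof (induction \<alpha> arbitrary: ts)
  case (AVar i)
  have eq: "map skel (toks (AVar i)) = TVar # map TBit (index_bits i) @ [TEnd]"
    using skel_bits[of "index_bits i"] by (simp add: skel_def)
  have inv: "skel t = TVar \<Longrightarrow> t = TVar" "skel t = TEnd \<Longrightarrow> t = TEnd" for t by (cases t; simp add: skel_def)+
  obtain t us where ts: "ts = t # us" "skel t = TVar" "map skel us = map TBit (index_bits i) @ [TEnd]"
    using AVar.prems(1) unfolding eq by (cases ts) simp_all
  then obtain vs ws where us: "us = vs @ ws" "map skel vs = map TBit (index_bits i)" "map skel ws = [TEnd]"
    unfolding map_eq_append_conv by metis
  then obtain w where "ws = [w]" "skel w = TEnd" by (cases ws) auto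
  then have "ts = toks (AVar i)" using ts us inv by (simp add: map_skel_bits)
  then show ?case by (intro exI[of _ "AVar i"]) simp
next
  case ABot
  then obtain t where "ts = [t]" "skel t = skel TBot" by auto
  then have "ts = [TBot]" by (cases t) (auto simp: skel_def)
  then show ?case by (intro exI[of _ ABot]) simp
next
  case (AImp \<alpha> \<beta>)
  then obtain t us vs where ts: "ts = t # us @ vs" "skel t = skel TImp" "map skel us = map skel (toks \<alpha>)"
    "map skel vs = map skel (toks \<beta>)" by (auto simp: map_eq_append_conv map_eq_Cons_conv)
  then have "t = TImp" by (cases t) (auto simp: skel_def)
  moreover obtain \<alpha>' \<beta>' where "us = toks \<alpha>'" "erase \<alpha>' = erase \<alpha>" "digits_ok \<alpha>'"
    "vs = toks \<beta>'" "erase \<beta>' = erase \<beta>" "digits_ok \<beta>'"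
    using AImp.IH(1)[OF ts(3)] AImp.IH(2)[OF ts(4)] AImp.prems(2) ts(1) by auto
  ultimately show ?case using ts(1) by (intro exI[of _ "AImp \<alpha>' \<beta>'"]) simp
next
  case (ADia c d \<alpha>)
  then obtain t us where ts: "ts = t # us" "skel t = skel (TDia c d)" "map skel us = map skel (toks \<alpha>)"
    by (auto simp: map_eq_Cons_conv)
  then obtain d' where "t = TDia c d'" by (cases t) (auto simp: skel_def)
  moreover obtain \<alpha>' where "us = toks \<alpha>'" "erase \<alpha>' = erase \<alpha>" "digits_ok \<alpha>'"
    using ADia.IH[OF ts(3)] ADia.prems(2) ts(1) by auto
  moreover have "d' < 4" using ADia.prems(2) ts(1) calculation(1) by (auto simp: tok_ok_def)
  ultimately show ?case using ts(1) by (intro exI[of _ "ADia c d' \<alpha>'"]) simp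
qed

lemma toks_ok: "digits_ok \<alpha> \<Longrightarrow> modalities (erase \<alpha>) \<subseteq> {..A} \<Longrightarrow> list_all (tok_ok A) (toks \<alpha>)"
  by (induction \<alpha>) (auto simp: tok_ok_def list_all_iff)

lemma skel_toks: "map skel (toks \<alpha>) = map skel (toks \<beta>)" if "erase \<alpha> = erase \<beta>"
  using that
proof (induction \<alpha> arbitrary: \<beta>)
  case (AVar i)
  then show ?case by (cases \<beta>) auto
next
  case ABot
  then show ?case by (cases \<beta>) auto
next
  case (AImp \<alpha>1 \<alpha>2)
  then obtain \<beta>1 \<beta>2 where "\<beta> = AImp \<beta>1 \<beta>2" "erase \<alpha>1 = erase \<beta>1" "erase \<alpha>2 = erase \<beta>2"
    by (cases \<beta>) simp_all
  then show ?case using AImp.IH(1)[of \<beta>1] AImp.IH(2)[of \<beta>2] by simp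
next
  case (ADia c d \<alpha>)
  then obtain d' \<gamma> where "\<beta> = ADia c d' \<gamma>" "erase \<alpha> = erase \<gamma>"
    by (cases \<beta>) simp_all
  then show ?case using ADia.IH[of \<gamma>] by (simp add: skel_def)
qed

section \<open>The program\<close>

text \<open>Cell 0 is the bottom of the stack, so the queried word is read from the bottom up and
  ends at the first blank.\<close>

lemma query_word_stk: "query_word (stk (rev (map TBit w))) = w"
proof -
  define f where "f = fst (stk (rev (map TBit w)))"
  have eq: "f i = (if i < length w then Bit (w ! i) else Blank)" for i
    by (simp add: stk_def f_def)
  have "(LEAST i. f i \<notin> range Bit) = length w"
  proof (rule Least_equality)
    show "f (length w) \<notin> range Bit" by (auto simp: eq)
    show "length w \<le> i" if "f i \<notin> range Bit" for i
    proof (rule ccontr)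
      assume "\<not> length w \<le> i"
      then have "f i = Bit (w ! i)" by (simp add: eq)
      then show False using that by simp
    qed
  qed
  moreover have "map (\<lambda>i. f i = Bit True) [0..<length w] = w"
    by (rule nth_equalityI) (simp_all add: eq)
  ultimately show ?thesis
    unfolding query_word_def f_def[symmetric] by (simp only:)
qed

lemma (in oracle_programs) sx_Ask:
  assumes "good S s" "s 1 = rev (map TBit w)" "sx S (if w \<in> Q then c else d) (s(1 := [])) s'"
  shows "sx S (Ask c d) s s'"
proof -
  have "query_word (stacks s 1) = w" using assms(2) query_word_stk[of w] by (simp add: stacks_def)
  moreover have "stacks (s(1 := [])) = (stacks s)(1 := blank_tape)" by (simp add: stacks_upd)
  ultimately have "ex S (Ask c d) (stacks s) (stacks s')"
    using assms(3) unfolding sx_def by (intro ex_Ask ok_stacks[OF assms(1)]) simp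
  then show ?thesis using assms(1,3) by (simp add: sx_def)
qed

text \<open>Tape 0 carries the input and later the result, 1 is the oracle tape, 2 the input being parsed, 3 the
  tokens (last one on top), 4 the tokens already processed, 5 and 7 the two stacks of \<open>tstep\<close>, 6 is auxiliary,
  8 and 9 hold counter and phase of the parser, 10 the state of \<open>M\<close>, and the tapes from 11 on are
  those of \<open>M\<close>.\<close>

locale sum_machine = simulated_machine k \<Gamma> Q M 11 10 7 for k \<Gamma> Q M +
  fixes A a n :: nat and R :: "bool list set"
  assumes decides: "decides M Q R"
    and legal_toks: "tok_ok A t \<Longrightarrow> t \<in> legal" "phase_ok A ph \<Longrightarrow> TPhase ph \<in> legal" "TSep \<in> legal"
begin

lemma k_ge: "13 \<le> k"
  using registers(1) machine_facts(1) by simp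

lemma reg_less [simp]: "i < 13 \<Longrightarrow> i < k" "0 < k" "Suc 0 < k"
  using k_ge by simp_all

lemma bits_legal [simp]: "set (map TBit bs) \<subseteq> legal" "TBit ` X \<subseteq> legal"
  by auto

definition is_tok :: "tok option \<Rightarrow> bool" where
  "is_tok t \<longleftrightarrow> t \<noteq> None"

definition in_part :: "tok option \<Rightarrow> bool" where
  "in_part t \<longleftrightarrow> t \<noteq> None \<and> t \<noteq> Some TSep"

text \<open>The growth allowed per token: the sum covers the code of any modality up to
  \<open>A\<close>, and 10 leaves room for the constant pieces, the longest being prefix and suffix
  of a guess with 9 bits together.\<close>

definition K :: nat where
  "K = 10 + (\<Sum>c\<le>A. length (encode_nat c))"

lemma dia_prefix_le: "c \<le> A \<Longrightarrow> length (dia_prefix a s c d) \<le> K"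
  using member_le_sum[of c "{..A}" "\<lambda>c. length (encode_nat c)"] by (simp add: dia_prefix_def K_def)

lemma K_ge: "10 \<le> K"
  by (simp add: K_def)

text \<open>For \<open>TImp\<close> and \<open>TDia\<close> the topmost code on tape 5 is reversed
  onto tape 6 and back: in the first case to reach the separator below it, in the second to leave a
  copy on tape 7.\<close>

definition Tok :: "bool \<Rightarrow> tok \<Rightarrow> com" where
  "Tok s t = (case t of
     TBit b \<Rightarrow> pushes 5 [TBit b]
   | TEnd \<Rightarrow> pushes 5 [TBit False, TSep]
   | TVar \<Rightarrow> pushes 5 (map TBit [True, False])
   | TBot \<Rightarrow> pushes 5 (map TBit [False, False] @ [TSep])
   | TImp \<Rightarrow> Seq (Move 5 in_part 6) (Seq (Pop 5) (Seq (Move 6 is_tok 5) (pushes 5 (map TBit [False, True]))))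
   | TDia c d \<Rightarrow> Seq (Move 5 in_part 6) (Seq (pushes 7 (map TBit (guess_suffix s d)))
       (Seq (Move2 6 is_tok 5 7) (Seq (pushes 7 (map TBit (guess_prefix s d))) (pushes 5 (map TBit (dia_prefix a s c d))))))
   | _ \<Rightarrow> Done)"

lemma split_part:
  obtains xs ys where "x = xs @ ys" "takeWhile (\<lambda>t. t \<noteq> TSep) x = xs" "dropWhile (\<lambda>t. t \<noteq> TSep) x = ys"
    "\<forall>t \<in> set xs. in_part (Some t)" "\<not> in_part (peek ys)"
proof (rule that)
  show "x = takeWhile (\<lambda>t. t \<noteq> TSep) x @ dropWhile (\<lambda>t. t \<noteq> TSep) x" by simp
  show "\<forall>t \<in> set (takeWhile (\<lambda>t. t \<noteq> TSep) x). in_part (Some t)"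
    by (auto simp: in_part_def dest: set_takeWhileD)
  show "\<not> in_part (peek (dropWhile (\<lambda>t. t \<noteq> TSep) x))"
    by (induction x) (simp_all add: in_part_def)
qed simp_all

lemma sx_Move_all:
  assumes "r < k" "r' < k" "r \<noteq> r'" "good S s" "length (s r) + length (s r') \<le> S"
  shows "sx S (Move r is_tok r') s (s(r := [], r' := rev (s r) @ s r'))"
  by (rule sx_Move[OF assms(1-4), of "s r" "[]"]) (use assms(5) in \<open>simp_all add: is_tok_def\<close>)

text \<open>Nothing is duplicated on tape 5, so it grows by at most \<open>K\<close>; only the chain
  receives a copy of a part of it. That growth is additive is what keeps the formulas short.\<close>

lemma sx_Tok:
  assumes g: "good S s" and t: "tok_ok A t" and s6: "s 6 = []"
    and le: "length (s 5) + K \<le> S" "length (s 7) + length (s 5) + K \<le> S"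
    and step: "tstep a sd t (s 5, s 7) = (x, y)"
  shows "sx S (Tok sd t) s (s(5 := x, 7 := y))"
    and "length x \<le> length (s 5) + K" "length y \<le> length (s 7) + length (s 5) + K"
proof -
  have push: "sx S (pushes 5 ts) s (s(5 := ts @ s 5, 7 := s 7))" if "length ts \<le> 10" "set ts \<subseteq> legal" for ts
  proof -
    have "sx S (pushes 5 ts) s (s(5 := ts @ s 5))"
      by (rule sx_pushes) (use g le K_ge that in auto)
    moreover have "s(5 := ts @ s 5, 7 := s 7) = s(5 := ts @ s 5)" by auto
    ultimately show ?thesis by simp
  qed
  have len_tw: "length (takeWhile P (s 5)) \<le> length (s 5)" for P by (rule length_takeWhile_le)
  have len_dw: "length (takeWhile P (s 5)) + length (dropWhile P (s 5)) = length (s 5)" for P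
    by (metis length_append takeWhile_dropWhile_id)
  have "sx S (Tok sd t) s (s(5 := x, 7 := y)) \<and> length x \<le> length (s 5) + K \<and> length y \<le> length (s 7) + length (s 5) + K"
  proof (cases t)
    case (TBit b)
    then show ?thesis using step push[of "[TBit b]"] K_ge by (auto simp: Tok_def simp del: pushes.simps)
  next
    case TEnd
    then show ?thesis using step push[of "[TBit False, TSep]"] K_ge legal_toks(3)
      by (auto simp: Tok_def simp del: pushes.simps)
  next
    case TVar
    then show ?thesis using step push[of "map TBit [True, False]"] K_ge
      by (auto simp: Tok_def simp del: pushes.simps)
  next
    case TBot
    then show ?thesis using step push[of "map TBit [False, False] @ [TSep]"] K_ge legal_toks(3)
      by (auto simp: Tok_def simp del: pushes.simps)
  next
    case TImp
    obtain xs ys where xy: "s 5 = xs @ ys" "takeWhile (\<lambda>t. t \<noteq> TSep) (s 5) = xs" "dropWhile (\<lambda>t. t \<noteq> TSep) (s 5) = ys"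
      "\<forall>t \<in> set xs. in_part (Some t)" "\<not> in_part (peek ys)" by (rule split_part)
    let ?s1 = "s(5 := ys, 6 := rev xs)" let ?s2 = "s(5 := tl ys, 6 := rev xs)"
    let ?s3 = "s(5 := xs @ tl ys, 6 := [])"
    let ?p = "map TBit [False, True]"
    have len: "length xs + length ys = length (s 5)" using xy(1) by simp
    have 1: "sx S (Move 5 in_part 6) s ?s1"
      by (rule sx_eq[OF sx_Move[of 5 6 S s xs ys]]) (use g xy s6 len le in auto)
    have 2: "sx S (Pop 5) ?s1 ?s2"
      by (rule sx_eq[OF sx_Pop[of 5 S ?s1]]) (use sx_good(2)[OF 1] in auto)
    have 3: "sx S (Move 6 is_tok 5) ?s2 ?s3"
      by (rule sx_eq[OF sx_Move_all[of 6 5 S ?s2]]) (use sx_good(2)[OF 2] len le in \<open>auto simp: fun_eq_iff\<close>)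
    have 4: "sx S (pushes 5 ?p) ?s3 (s(5 := ?p @ xs @ tl ys, 7 := s 7))"
    proof (rule sx_eq[OF sx_pushes[of 5 S ?s3]])
      show "length ?p + length (?s3 5) \<le> S" using len le K_ge by simp
    qed (use sx_good(2)[OF 3] s6 in \<open>auto simp: fun_eq_iff\<close>)
    have "x = ?p @ xs @ tl ys" "y = s 7" using step TImp xy(2,3) by simp_all
    then show ?thesis
      using sx_Seq[OF 1 sx_Seq[OF 2 sx_Seq[OF 3 4]]] TImp len K_ge by (simp add: Tok_def del: pushes.simps)
  next
    case (TDia c d)
    obtain xs ys where xy: "s 5 = xs @ ys" "takeWhile (\<lambda>t. t \<noteq> TSep) (s 5) = xs" "dropWhile (\<lambda>t. t \<noteq> TSep) (s 5) = ys"
      "\<forall>t \<in> set xs. in_part (Some t)" "\<not> in_part (peek ys)" by (rule split_part)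
    let ?u = "map TBit (guess_suffix sd d)" let ?v = "map TBit (guess_prefix sd d)" let ?w = "map TBit (dia_prefix a sd c d)"
    let ?s1 = "s(5 := ys, 6 := rev xs)" let ?s2 = "?s1(7 := ?u @ s 7)"
    let ?s3 = "s(5 := xs @ ys, 6 := [], 7 := xs @ ?u @ s 7)"
    let ?s4 = "s(5 := xs @ ys, 6 := [], 7 := ?v @ xs @ ?u @ s 7)"
    have len: "length xs + length ys = length (s 5)" using xy(1) by simp
    have uv: "length ?u + length ?v \<le> 10" by (simp add: guess_suffix_def guess_prefix_def)
    have w: "length ?w \<le> K" using dia_prefix_le[of c sd d] t TDia by (simp add: tok_ok_def)
    have 1: "sx S (Move 5 in_part 6) s ?s1"
      by (rule sx_eq[OF sx_Move[of 5 6 S s xs ys]]) (use g xy s6 len le in auto)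
    have 2: "sx S (pushes 7 ?u) ?s1 ?s2"
    proof (rule sx_eq[OF sx_pushes[of 7 S ?s1]])
      show "length ?u + length (?s1 7) \<le> S" using uv le K_ge by simp
    qed (use sx_good(2)[OF 1] in auto)
    have 3: "sx S (Move2 6 is_tok 5 7) ?s2 ?s3"
    proof (rule sx_eq[OF sx_Move2[of 6 5 7 S ?s2 "rev xs" "[]"]])
      show "length (rev xs) + length (?s2 5) \<le> S" "length (rev xs) + length (?s2 7) \<le> S"
        using len le uv K_ge by simp_all
    qed (use sx_good(2)[OF 2] in \<open>auto simp: fun_eq_iff is_tok_def\<close>)
    have 4: "sx S (pushes 7 ?v) ?s3 ?s4"
    proof (rule sx_eq[OF sx_pushes[of 7 S ?s3]])
      show "length ?v + length (?s3 7) \<le> S" using len uv le K_ge by simp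
    qed (use sx_good(2)[OF 3] in auto)
    have 5: "sx S (pushes 5 ?w) ?s4 (s(5 := ?w @ s 5, 7 := ?v @ xs @ ?u @ s 7))"
    proof (rule sx_eq[OF sx_pushes[of 5 S ?s4]])
      show "length ?w + length (?s4 5) \<le> S" using len w le by simp
    qed (use sx_good(2)[OF 4] s6 xy(1) in \<open>auto simp: fun_eq_iff\<close>)
    have "x = ?w @ s 5" "y = ?v @ xs @ ?u @ s 7" using step TDia xy(2) by simp_all
    then show ?thesis
      using sx_Seq[OF 1 sx_Seq[OF 2 sx_Seq[OF 3 sx_Seq[OF 4 5]]]] TDia len w uv K_ge by (simp add: Tok_def)
  qed (use t in \<open>simp_all add: tok_ok_def\<close>)
  then show "sx S (Tok sd t) s (s(5 := x, 7 := y))"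
    "length x \<le> length (s 5) + K" "length y \<le> length (s 7) + length (s 5) + K" by simp_all
qed

definition Toks :: "bool \<Rightarrow> com" where
  "Toks sd = While 3 is_tok (On 3 (\<lambda>t. Seq (Pop 3) (Seq (Push 4 (the t)) (Tok sd (the t)))))"

text \<open>\<open>X\<close> bounds tape 5 throughout, so each token adds at most
  \<open>X + K\<close> to tape 7. With \<open>X\<close> linear in the number of tokens this is the
  source of the quadratic bound.\<close>

lemma sx_Toks:
  assumes "good S s" "list_all (tok_ok A) rs" "s 3 = rs" "s 6 = []"
    and "length (s 4) + length rs \<le> S" "length (s 5) + length rs * K \<le> X" "X \<le> S"
    and "length (s 7) + length rs * (X + K) \<le> S"
    and "fold (tstep a sd) rs (s 5, s 7) = (x, y)"
  shows "sx S (Toks sd) s (s(3 := [], 4 := rev rs @ s 4, 5 := x, 7 := y))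
    \<and> length x \<le> length (s 5) + length rs * K \<and> length y \<le> length (s 7) + length rs * (X + K)"
  using assms
proof (induction rs arbitrary: s)
  case Nil
  then have "s(3 := [], 4 := rev [] @ s 4, 5 := x, 7 := y) = s" by (auto simp: fun_eq_iff)
  then show ?case using Nil sx_While_False[of 3 S s is_tok]
    by (simp add: Toks_def is_tok_def del: fun_upd_apply)
next
  case (Cons t rs)
  note prems = Cons.prems
  obtain x1 y1 where xy: "tstep a sd t (s 5, s 7) = (x1, y1)" by fastforce
  let ?s1 = "s(3 := rs)" let ?s2 = "?s1(4 := t # s 4)" let ?s3 = "?s2(5 := x1, 7 := y1)"
  have t: "tok_ok A t" "t \<in> legal" using prems(2) legal_toks(1) by auto
  have 1: "sx S (Pop 3) s ?s1"
    by (rule sx_eq[OF sx_Pop[of 3 S s]]) (use prems(1,3) in auto)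
  have 2: "sx S (Push 4 t) ?s1 ?s2"
    by (rule sx_eq[OF sx_Push[of 4 S ?s1 t]]) (use sx_good(2)[OF 1] prems(5) t in auto)
  have "length (s 5) + K \<le> S" "length (s 7) + length (s 5) + K \<le> S"
    using prems(6,7,8) by (simp_all add: algebra_simps)
  then have le: "length (?s2 5) + K \<le> S" "length (?s2 7) + length (?s2 5) + K \<le> S" by simp_all
  have s6: "?s2 6 = []" and st: "tstep a sd t (?s2 5, ?s2 7) = (x1, y1)" using prems(4) xy by simp_all
  note tok = sx_Tok[OF sx_good(2)[OF 2] t(1) s6 le st]
  have 3: "sx S (Tok sd t) ?s2 ?s3" by (rule tok(1))
  have lens: "length x1 \<le> length (s 5) + K" "length y1 \<le> length (s 7) + length (s 5) + K"
    using tok(2,3) by simp_all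
  have step: "sx S (On 3 (\<lambda>t. Seq (Pop 3) (Seq (Push 4 (the t)) (Tok sd (the t))))) s ?s3"
    by (rule sx_On) (use sx_Seq[OF 1 sx_Seq[OF 2 3]] prems(3) in simp_all)
  have IH: "sx S (Toks sd) ?s3 (?s3(3 := [], 4 := rev rs @ ?s3 4, 5 := x, 7 := y))
    \<and> length x \<le> length (?s3 5) + length rs * K \<and> length y \<le> length (?s3 7) + length rs * (X + K)"
  proof (rule Cons.IH)
    show "good S ?s3" using step by (rule sx_good(2))
    show "length (?s3 5) + length rs * K \<le> X" using lens(1) prems(6) by simp
    show "length (?s3 7) + length rs * (X + K) \<le> S" using lens(2) prems(6,8) by simp
    show "fold (tstep a sd) rs (?s3 5, ?s3 7) = (x, y)" using prems(9) xy by simp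
  qed (use prems in auto)
  have eq: "?s3(3 := [], 4 := rev rs @ ?s3 4, 5 := x, 7 := y) = s(3 := [], 4 := rev (t # rs) @ s 4, 5 := x, 7 := y)"
    by (auto simp: fun_eq_iff)
  have "sx S (Toks sd) s (s(3 := [], 4 := rev (t # rs) @ s 4, 5 := x, 7 := y))"
    using IH step unfolding Toks_def eq[symmetric]
    by (intro sx_While_True[of 3 is_tok s, OF _ _ step]) (use prems(3) in \<open>simp_all add: is_tok_def\<close>)
  moreover have "length x \<le> length (s 5) + length (t # rs) * K" using IH lens(1) by simp
  moreover have "length y \<le> length (s 7) + length (t # rs) * (X + K)" using IH lens(2) prems(6) by simp
  ultimately show ?case by blast
qed


text \<open>The code is completed in place: closing \<open>Bot\<close>s below, the translated
  formula without its separator on top of the chain, the opening implications last. The tokens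
  return to tape 3 for the other side and the next guess.\<close>

definition Trans :: "bool \<Rightarrow> com" where
  "Trans sd = Seq (pushes 7 (code_toks Bot @ code_toks Bot)) (Seq (Toks sd) (Seq (Move 5 in_part 6)
     (Seq (Move 6 is_tok 7) (Seq (Pop 5) (Seq (pushes 7 (map TBit [False, True, False, True])) (Move 4 is_tok 3))))))"

text \<open>For \<open>m\<close> tokens the chain holds at most \<open>m\<close> copies of codes of
  length at most \<open>m * K\<close>; the rest of this polynomial is slack for constant
  pieces.\<close>

definition space :: "nat \<Rightarrow> nat" where
  "space m = 12 + (m + 2) * (m + 2) * K"

lemma space_eq: "space m = 12 + m * (m * K) + 4 * (m * K) + 4 * K"
  by (simp add: space_def algebra_simps)

lemma m_le: "m \<le> m * K"
  using K_ge by simp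

text \<open>The store in which every round of the search starts; a failed round followed by
  \<open>inc\<close> restores this form, so no garbage accumulates.\<close>

definition only :: "tok list \<Rightarrow> nat \<Rightarrow> tok list" where
  "only rs = (\<lambda>_. [])(3 := rs)"

lemma good_only: "0 < S \<Longrightarrow> length rs \<le> S \<Longrightarrow> set rs \<subseteq> legal \<Longrightarrow> good S (only rs)"
  by (auto simp: good_def only_def)

lemma tok_ok_legal: "list_all (tok_ok A) rs \<Longrightarrow> set rs \<subseteq> legal"
  using legal_toks(1) by (auto simp: list_all_iff)

lemma code_toks_legal: "set (code_toks \<phi>) \<subseteq> legal"
  by (auto simp: code_toks_def)

lemma sx_Trans:
  assumes ok: "list_all (tok_ok A) (toks \<alpha>)" and S: "space (length (toks \<alpha>)) \<le> S"
  shows "sx S (Trans sd) (only (rev (toks \<alpha>))) ((only (rev (toks \<alpha>)))(7 := code_toks (query a sd \<alpha>)))"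
    and "length (code_toks (query a sd \<alpha>)) \<le> space (length (toks \<alpha>))"
proof -
  define rs where "rs = rev (toks \<alpha>)"
  define m where "m = length rs"
  define init where "init = code_toks Bot @ code_toks Bot"
  have init: "length init = 4" "set init \<subseteq> legal" using code_toks_legal by (auto simp: init_def code_toks_def)
  obtain x y where xy: "fold (tstep a sd) rs ([], init) = (x, y)" by fastforce
  then have "foldr (tstep a sd) (toks \<alpha>) ([], init) = (x, y)" by (simp add: foldr_conv_fold rs_def)
  from query_toks[OF this[unfolded init_def]] obtain u where u: "x = map TBit u @ [TSep]"
    and query: "map TBit [False, True, False, True] @ map TBit u @ y = code_toks (query a sd \<alpha>)" by auto
  have ok': "list_all (tok_ok A) rs" using ok by (simp add: rs_def)
  have Sm: "12 + m * (m * K) + 4 * (m * K) + 4 * K \<le> S"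
    using S by (simp add: m_def rs_def space_eq)
  then have mS: "m \<le> S" using m_le[of m] by linarith
  let ?s0 = "only rs" let ?s1 = "?s0(7 := init)"
  let ?s2 = "?s1(3 := [], 4 := rev rs, 5 := x, 7 := y)"
  let ?s3 = "?s2(5 := [TSep], 6 := rev (map TBit u))"
  let ?s4 = "?s2(5 := [TSep], 7 := map TBit u @ y)"
  let ?s5 = "?s2(5 := [], 7 := map TBit u @ y)"
  let ?s6 = "?s2(5 := [], 7 := code_toks (query a sd \<alpha>))"
  have 0: "good S ?s0" by (rule good_only) (use Sm mS tok_ok_legal[OF ok'] in \<open>simp_all add: m_def\<close>)
  have 1: "sx S (pushes 7 init) ?s0 ?s1"
    by (rule sx_eq[OF sx_pushes[of 7 S ?s0]]) (use 0 init Sm in \<open>simp_all add: only_def\<close>)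
  have "sx S (Toks sd) ?s1 (?s1(3 := [], 4 := rev rs @ ?s1 4, 5 := x, 7 := y))
    \<and> length x \<le> length (?s1 5) + length rs * K \<and> length y \<le> length (?s1 7) + length rs * (m * K + K)"
    by (rule sx_Toks) (use sx_good(2)[OF 1] ok' Sm mS init xy in \<open>simp_all add: only_def m_def algebra_simps\<close>)
  then have 2: "sx S (Toks sd) ?s1 ?s2" and len: "length x \<le> m * K" "length y \<le> 4 + m * (m * K) + m * K"
    using init(1) by (simp_all add: only_def m_def algebra_simps)
  have lu: "length x = Suc (length u)" using u by simp
  have 3: "sx S (Move 5 in_part 6) ?s2 ?s3"
  proof (rule sx_eq[OF sx_Move[of 5 6 S ?s2 "map TBit u" "[TSep]"]])
    show "length (map TBit u) + length (?s2 6) \<le> S" using len lu Sm by (simp add: only_def)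
  qed (use sx_good(2)[OF 2] u in \<open>auto simp: only_def in_part_def\<close>)
  have 4: "sx S (Move 6 is_tok 7) ?s3 ?s4"
  proof (rule sx_eq[OF sx_Move_all[of 6 7 S ?s3]])
    show "length (?s3 6) + length (?s3 7) \<le> S" using len lu Sm by simp
  qed (use sx_good(2)[OF 3] in \<open>auto simp: only_def fun_eq_iff\<close>)
  have 5: "sx S (Pop 5) ?s4 ?s5"
    by (rule sx_eq[OF sx_Pop[of 5 S ?s4]]) (use sx_good(2)[OF 4] in \<open>auto simp: fun_eq_iff\<close>)
  have 6: "sx S (pushes 7 (map TBit [False, True, False, True])) ?s5 ?s6"
  proof (rule sx_eq[OF sx_pushes[of 7 S ?s5]])
    show "length (map TBit [False, True, False, True]) + length (?s5 7) \<le> S" using len lu Sm by simp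
  qed (use sx_good(2)[OF 5] query in \<open>auto simp: fun_eq_iff\<close>)
  have 7: "sx S (Move 4 is_tok 3) ?s6 (?s0(7 := code_toks (query a sd \<alpha>)))"
  proof (rule sx_eq[OF sx_Move_all[of 4 3 S ?s6]])
    show "length (?s6 4) + length (?s6 3) \<le> S" using mS by (simp add: m_def)
  qed (use sx_good(2)[OF 6] in \<open>auto simp: only_def fun_eq_iff\<close>)
  show "sx S (Trans sd) (only (rev (toks \<alpha>))) ((only (rev (toks \<alpha>)))(7 := code_toks (query a sd \<alpha>)))"
    using sx_Seq[OF 1 sx_Seq[OF 2 sx_Seq[OF 3 sx_Seq[OF 4 sx_Seq[OF 5 sx_Seq[OF 6 7]]]]]]
    unfolding Trans_def init_def rs_def .
  show "length (code_toks (query a sd \<alpha>)) \<le> space (length (toks \<alpha>))"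
    unfolding query[symmetric] using len lu by (simp add: m_def rs_def space_eq)
qed

text \<open>The formula for the first summand goes to the oracle. The one for the second summand is
  left on tape 7, where the simulated machine loads it.\<close>

definition Check :: com where
  "Check = Seq (Trans True) (Seq (Move 7 is_tok 1) (Ask
     (Seq (Trans False) (Seq Call (On 10 (\<lambda>t. Seq (Pop 10) (if t = Some (TState Accept) then Push 0 (TBit True) else Done)))))
     Done))"

definition passes :: "afm \<Rightarrow> bool" where
  "passes \<alpha> \<longleftrightarrow> encode (query a True \<alpha>) \<in> Q \<and> encode (query a False \<alpha>) \<in> R"

text \<open>Phrased with the actual runs of \<open>M\<close>; a polynomial is supplied only at the
  end. \<open>B < S\<close> is strict because erasing a tape visits the blank cell after its filled
  part.\<close>

definition enough :: "nat \<Rightarrow> nat \<Rightarrow> bool" where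
  "enough S m \<longleftrightarrow> (\<exists>B. B < S \<and> space m \<le> B \<and>
     (\<forall>y i. length y \<le> space m \<longrightarrow> (\<forall>t \<in> set (snd (run M Q y i)). snd t < B)))"

lemma encode_neq_Nil: "encode \<phi> \<noteq> []"
  by (cases \<phi>) simp_all

lemma sx_Check:
  assumes ok: "list_all (tok_ok A) (toks \<alpha>)" and S: "enough S (length (toks \<alpha>))"
  shows "sx S Check (only (rev (toks \<alpha>))) ((only (rev (toks \<alpha>)))(0 := if passes \<alpha> then [TBit True] else []))"
proof -
  let ?m = "length (toks \<alpha>)" let ?s = "only (rev (toks \<alpha>))"
  let ?q = "encode (query a True \<alpha>)" and ?r = "encode (query a False \<alpha>)"
  obtain B where B: "B < S" "space ?m \<le> B"
    "\<And>y i. length y \<le> space ?m \<Longrightarrow> \<forall>t \<in> set (snd (run M Q y i)). snd t < B"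
    using S by (auto simp: enough_def)
  have sp: "space ?m \<le> S" using B by simp
  note T = sx_Trans[OF ok sp]
  let ?s1 = "?s(7 := code_toks (query a True \<alpha>))" let ?s2 = "?s(1 := rev (code_toks (query a True \<alpha>)))"
  \<comment> \<open>The reversal is wanted here: on the oracle tape the first bit has to be at the
    bottom.\<close>
  have 2: "sx S (Move 7 is_tok 1) ?s1 ?s2"
  proof (rule sx_eq[OF sx_Move_all[of 7 1 S ?s1]])
    show "length (?s1 7) + length (?s1 1) \<le> S" using T(2)[of True] sp by (simp add: only_def)
  qed (use sx_good(2)[OF T(1)[of True]] in \<open>auto simp: only_def fun_eq_iff\<close>)
  have s2: "?s2 1 = rev (map TBit ?q)" by (simp add: code_toks_def)
  have s2': "?s2(1 := []) = ?s" by (auto simp: only_def fun_eq_iff)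
  have gs: "good S ?s" using T(1) by (rule sx_good(1))
  have ask: "sx S (if ?q \<in> Q then Seq (Trans False) (Seq Call (On 10 (\<lambda>t. Seq (Pop 10) (if t = Some (TState Accept) then Push 0 (TBit True) else Done)))) else Done)
      ?s (?s(0 := if passes \<alpha> then [TBit True] else []))"
  proof (cases "?q \<in> Q")
    case False
    have "?s(0 := []) = ?s" by (auto simp: only_def fun_eq_iff)
    then show ?thesis using False sx_Done[OF gs] by (simp add: passes_def)
  next
    case True
    let ?s3 = "?s(7 := code_toks (query a False \<alpha>))"
    let ?s4 = "?s(10 := [TState (if ?r \<in> R then Accept else Reject)])"
    have leny: "length ?r \<le> space ?m" using T(2)[of False] by (simp add: code_toks_def)
    have regj: "reg j = 1 \<or> 11 \<le> reg j" for j by (auto simp: reg_def)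
    have regs: "reg j \<noteq> 7" "reg j \<noteq> 3" for j using regj[of j] by auto
    have "sx S Call ?s3 (?s3(7 := [], 10 := [TState (if ?r \<in> R then Accept else Reject)]))"
    proof (rule sx_Call[OF decides B(3)[OF leny] B(1)])
      show "length ?r \<le> B" using leny B(2) by simp
      show "good S ?s3" using T(1) by (rule sx_good(2))
      show "?s3 7 = map TBit ?r" by (simp add: code_toks_def)
    qed (use regs encode_neq_Nil in \<open>auto simp: only_def\<close>)
    moreover have "?s3(7 := [], 10 := [TState (if ?r \<in> R then Accept else Reject)]) = ?s4"
      by (auto simp: only_def fun_eq_iff)
    ultimately have 4: "sx S Call ?s3 ?s4" by simp
    have 5: "sx S (Pop 10) ?s4 ?s"
      by (rule sx_eq[OF sx_Pop[of 10 S ?s4]]) (use sx_good(2)[OF 4] in \<open>auto simp: only_def fun_eq_iff\<close>)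
    have 6: "sx S (if peek (?s4 10) = Some (TState Accept) then Push 0 (TBit True) else Done) ?s
        (?s(0 := if passes \<alpha> then [TBit True] else []))"
    proof (cases "?r \<in> R")
      case r: True
      have "sx S (Push 0 (TBit True)) ?s (?s(0 := [TBit True]))"
        by (rule sx_eq[OF sx_Push[of 0 S ?s]]) (use gs B(1) in \<open>auto simp: only_def\<close>)
      then show ?thesis using r True by (simp add: passes_def)
    next
      case r: False
      have "?s(0 := []) = ?s" by (auto simp: only_def fun_eq_iff)
      then show ?thesis using r True sx_Done[OF gs] by (simp add: passes_def)
    qed
    have 7: "sx S (On 10 (\<lambda>t. Seq (Pop 10) (if t = Some (TState Accept) then Push 0 (TBit True) else Done))) ?s4
        (?s(0 := if passes \<alpha> then [TBit True] else []))"
      by (rule sx_On) (simp, rule sx_Seq[OF 5 6])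
    show ?thesis using sx_Seq[OF T(1)[of False] sx_Seq[OF 4 7]] True by simp
  qed
  have 3: "sx S (Ask (Seq (Trans False) (Seq Call (On 10 (\<lambda>t. Seq (Pop 10) (if t = Some (TState Accept) then Push 0 (TBit True) else Done))))) Done)
      ?s2 (?s(0 := if passes \<alpha> then [TBit True] else []))"
    by (rule sx_Ask[OF sx_good(2)[OF 2] s2]) (unfold s2', rule ask)
  show ?thesis unfolding Check_def by (rule sx_Seq[OF T(1) sx_Seq[OF 2 3]])
qed

text \<open>The carry runs over digits 3 and over tokens without a digit. The bottom of the stack
  must stop it, hence \<open>False\<close> for \<open>None\<close>; getting there means
  overflow.\<close>

definition stuck :: "tok option \<Rightarrow> bool" where
  "stuck t \<longleftrightarrow> (case t of None \<Rightarrow> False | Some (TDia c d) \<Rightarrow> 3 \<le> d | Some _ \<Rightarrow> True)"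

definition Carry :: com where
  "Carry = While 3 stuck (On 3 (\<lambda>t. Seq (Pop 3) (Push 4 (skel (the t)))))"

lemma skel_ok: "tok_ok A t \<Longrightarrow> tok_ok A (skel t)"
  by (cases t) (auto simp: tok_ok_def skel_def)

lemma sx_Carry:
  assumes "good S s" "s 3 = xs @ ys" "\<forall>t \<in> set xs. stuck (Some t)" "\<not> stuck (peek ys)"
    and "length (s 4) + length xs \<le> S" "list_all (tok_ok A) xs"
  shows "sx S Carry s (s(3 := ys, 4 := rev (map skel xs) @ s 4))"
  using assms
proof (induction xs arbitrary: s)
  case Nil
  then have "s(3 := ys, 4 := rev (map skel []) @ s 4) = s" by (auto simp: fun_eq_iff)
  then show ?case using Nil sx_While_False[of 3 S s stuck]
    by (simp add: Carry_def del: fun_upd_apply)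
next
  case (Cons x xs)
  note prems = Cons.prems
  let ?s1 = "s(3 := xs @ ys)" let ?s2 = "?s1(4 := skel x # s 4)"
  have x: "skel x \<in> legal" using prems(6) legal_toks(1) skel_ok by simp
  have 1: "sx S (Pop 3) s ?s1"
    by (rule sx_eq[OF sx_Pop[of 3 S s]]) (use prems(1,2) in auto)
  have 2: "sx S (Push 4 (skel x)) ?s1 ?s2"
    by (rule sx_eq[OF sx_Push[of 4 S ?s1 "skel x"]]) (use sx_good(2)[OF 1] prems(5) x in auto)
  have step: "sx S (On 3 (\<lambda>t. Seq (Pop 3) (Push 4 (skel (the t))))) s ?s2"
    by (rule sx_On) (use sx_Seq[OF 1 2] prems(2) in simp_all)
  have IH: "sx S Carry ?s2 (?s2(3 := ys, 4 := rev (map skel xs) @ ?s2 4))"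
  proof (rule Cons.IH)
    show "good S ?s2" using step by (rule sx_good(2))
    show "?s2 3 = xs @ ys" "length (?s2 4) + length xs \<le> S" using prems(5) by simp_all
    show "\<forall>t \<in> set xs. stuck (Some t)" "\<not> stuck (peek ys)" "list_all (tok_ok A) xs" using prems by simp_all
  qed
  have eq: "?s2(3 := ys, 4 := rev (map skel xs) @ ?s2 4) = s(3 := ys, 4 := rev (map skel (x # xs)) @ s 4)"
    by (auto simp: fun_eq_iff)
  show ?case
    using IH unfolding Carry_def eq
    by (intro sx_While_True[of 3 stuck s, OF _ _ step]) (use prems(2,3) in \<open>simp_all del: fun_upd_apply\<close>)
qed

lemma inc_append:
  "\<forall>t \<in> set xs. stuck (Some t) \<Longrightarrow> inc (xs @ ys) = map_option ((@) (map skel xs)) (inc ys)"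
proof (induction xs)
  case Nil
  then show ?case by (cases "inc ys") simp_all
next
  case (Cons x xs)
  then show ?case by (cases x; cases "inc ys") (simp_all add: stuck_def skel_def)
qed

definition Inc :: com where
  "Inc = Seq Carry (On 3 (\<lambda>t. case t of
     Some (TDia c d) \<Rightarrow> Seq (Pop 3) (Seq (Push 3 (TDia c (Suc d))) (Move 4 is_tok 3))
   | _ \<Rightarrow> Push 0 (TBit False)))"

text \<open>After an overflow the tokens are left on tape 4; as the search stops there, only the
  verdict on tape 0 is recorded.\<close>

lemma sx_Inc:
  assumes ok: "list_all (tok_ok A) rs" and S: "length rs \<le> S" "0 < S"
  shows "(case inc rs of Some us \<Rightarrow> sx S Inc (only rs) (only us)
    | None \<Rightarrow> (\<exists>s'. sx S Inc (only rs) s' \<and> s' 0 = [TBit False]))"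
proof -
  define xs where "xs = takeWhile (\<lambda>t. stuck (Some t)) rs"
  define ys where "ys = dropWhile (\<lambda>t. stuck (Some t)) rs"
  have rs: "rs = xs @ ys" by (simp add: xs_def ys_def)
  have xs: "\<forall>t \<in> set xs. stuck (Some t)" by (auto simp: xs_def dest: set_takeWhileD)
  have ys: "\<not> stuck (peek ys)" unfolding ys_def by (induction rs) (simp_all add: stuck_def)
  have g: "good S (only rs)" by (rule good_only[OF S(2,1) tok_ok_legal[OF ok]])
  let ?s1 = "(only rs)(3 := ys, 4 := rev (map skel xs))"
  have 1: "sx S Carry (only rs) ?s1"
    by (rule sx_eq[OF sx_Carry[of S "only rs" xs ys]]) (use g rs xs ys S ok in \<open>simp_all add: only_def\<close>)
  show ?thesis
  proof (cases ys)
    case Nil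
    have "inc rs = None" using inc_append[OF xs, of ys] Nil rs by simp
    moreover have "sx S (Push 0 (TBit False)) ?s1 (?s1(0 := [TBit False]))"
      by (rule sx_eq[OF sx_Push[of 0 S ?s1]]) (use sx_good(2)[OF 1] S in \<open>simp_all add: only_def\<close>)
    then have "sx S Inc (only rs) (?s1(0 := [TBit False]))"
      unfolding Inc_def by (intro sx_Seq[OF 1] sx_On) (simp_all add: Nil)
    ultimately show ?thesis by auto
  next
    case (Cons t zs)
    then obtain c d where t: "t = TDia c d" "d < 3" using ys by (cases t) (auto simp: stuck_def)
    have c: "TDia c (Suc d) \<in> legal" using ok t rs Cons by (intro legal_toks(1)) (simp add: tok_ok_def)
    have inc: "inc rs = Some (map skel xs @ TDia c (Suc d) # zs)"
      using inc_append[OF xs, of ys] Cons rs t by simp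
    have len: "length xs + Suc (length zs) \<le> S" using S rs Cons by simp
    let ?s2 = "?s1(3 := zs)" let ?s3 = "?s1(3 := TDia c (Suc d) # zs)"
    have 2: "sx S (Pop 3) ?s1 ?s2"
      by (rule sx_eq[OF sx_Pop[of 3 S ?s1]]) (use sx_good(2)[OF 1] Cons in \<open>simp_all\<close>)
    have 3: "sx S (Push 3 (TDia c (Suc d))) ?s2 ?s3"
      by (rule sx_eq[OF sx_Push[of 3 S ?s2]]) (use sx_good(2)[OF 2] len c in simp_all)
    have 4: "sx S (Move 4 is_tok 3) ?s3 (only (map skel xs @ TDia c (Suc d) # zs))"
    proof (rule sx_eq[OF sx_Move_all[of 4 3 S ?s3]])
      show "length (?s3 4) + length (?s3 3) \<le> S" using len by simp
    qed (use sx_good(2)[OF 3] in \<open>auto simp: only_def fun_eq_iff\<close>)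
    have "sx S Inc (only rs) (only (map skel xs @ TDia c (Suc d) # zs))"
      unfolding Inc_def by (intro sx_Seq[OF 1] sx_On) (use sx_Seq[OF 2 sx_Seq[OF 3 4]] Cons t in simp_all)
    then show ?thesis using inc by simp
  qed
qed

end

lemma val_zero: "val (rev (toks (zero \<phi>))) = 0"
proof -
  have "list_all (\<lambda>t. skel t = t) ts \<Longrightarrow> val ts = 0" for ts
  proof (induction ts)
    case (Cons t ts)
    then show ?case by (cases t) (simp_all add: skel_def)
  qed simp
  moreover have "list_all (\<lambda>t. skel t = t) (toks (zero \<phi>))"
    by (induction \<phi>) (auto simp: skel_def list_all_iff)
  ultimately show ?thesis by simp
qed

text \<open>The code of the query is the outcome of a pass over the tokens, so it is a function of
  the token list; this takes the place of injectivity of \<open>toks\<close>.\<close>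

lemma query_cong: "toks \<beta> = toks \<gamma> \<Longrightarrow> query a s \<beta> = query a s \<gamma>"
proof -
  assume eq: "toks \<beta> = toks \<gamma>"
  obtain x y where xy: "foldr (tstep a s) (toks \<beta>) ([], code_toks Bot @ code_toks Bot) = (x, y)" by fastforce
  obtain u where u: "x = map TBit u @ [TSep]"
    "map TBit [False, True] @ map TBit [False, True] @ map TBit u @ y = code_toks (query a s \<beta>)"
    using query_toks[OF xy] by blast
  obtain v where v: "x = map TBit v @ [TSep]"
    "map TBit [False, True] @ map TBit [False, True] @ map TBit v @ y = code_toks (query a s \<gamma>)"
    using query_toks[OF xy[unfolded eq]] by blast
  have "map TBit u = map TBit v" using u(1) v(1) by simp
  then have "code_toks (query a s \<beta>) = code_toks (query a s \<gamma>)" using u(2) v(2) by simp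
  then have "map TBit (encode (query a s \<beta>)) = map TBit (encode (query a s \<gamma>))" by (simp add: code_toks_def)
  then have "encode (query a s \<beta>) = encode (query a s \<gamma>)" by (simp add: inj_map_eq_map inj_def)
  then show ?thesis by (rule injD[OF inj_encode])
qed

context sum_machine
begin

section \<open>Exhaustive search over the guesses\<close>

definition Search :: com where
  "Search = While 0 (\<lambda>t. t = None) (Seq Check (On 0 (\<lambda>t. if t = None then Inc else Done)))"

text \<open>The lower bound \<open>v\<close> makes this a loop invariant: its truth value does not
  change when a failed guess is passed over, and with \<open>v = 0\<close> it is the full
  question.\<close>

definition accepts :: "nat \<Rightarrow> fm \<Rightarrow> bool" where
  "accepts v \<rho> \<longleftrightarrow> (\<exists>\<gamma>. erase \<gamma> = \<rho> \<and> digits_ok \<gamma> \<and> v \<le> val (rev (toks \<gamma>)) \<and> passes \<gamma>)"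

lemma space_mono: "m \<le> m' \<Longrightarrow> space m \<le> space m'"
  unfolding space_def by (intro add_mono mult_mono) auto

lemma enough_mono: "enough S m' \<Longrightarrow> m \<le> m' \<Longrightarrow> enough S m"
  unfolding enough_def by (meson space_mono order_trans)

lemma enough_le: "enough S m \<Longrightarrow> m < S"
proof -
  assume "enough S m"
  then have "space m < S" by (auto simp: enough_def)
  moreover have "m \<le> space m" using m_le[of m] unfolding space_eq by linarith
  ultimately show ?thesis by simp
qed

text \<open>Induction on the distance of the counter from its upper bound. There may be
  exponentially many rounds, but \<open>inc\<close> preserves the number of tokens, so one space
  bound serves them all.\<close>

lemma sx_Search:
  assumes "erase \<beta> = \<rho>" "digits_ok \<beta>" "modalities \<rho> \<subseteq> {..A}" "enough S (length (toks \<beta>))"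
  shows "\<exists>s. sx S Search (only (rev (toks \<beta>))) s \<and> s 0 = [TBit (accepts (val (rev (toks \<beta>))) \<rho>)]"
  using assms
proof (induction "4 ^ length (toks \<beta>) - val (rev (toks \<beta>))" arbitrary: \<beta> rule: less_induct)
  case less
  note prems = less.prems
  let ?rs = "rev (toks \<beta>)"
  have ok: "list_all (tok_ok A) (toks \<beta>)" using toks_ok[OF prems(2)] prems(1,3) by simp
  then have okr: "list_all (tok_ok A) ?rs" by simp
  have len: "length ?rs \<le> S" "0 < S" using enough_le[OF prems(4)] by simp_all
  note check = sx_Check[OF ok prems(4)]
  show ?case
  proof (cases "passes \<beta>")
    case True
    let ?s = "(only ?rs)(0 := [TBit True])"
    have 1: "sx S Check (only ?rs) ?s" using check True by simp
    have 2: "sx S (On 0 (\<lambda>t. if t = None then Inc else Done)) ?s ?s"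
      by (rule sx_On) (use sx_Done[OF sx_good(2)[OF 1]] in simp_all)
    have 3: "sx S Search ?s ?s"
      unfolding Search_def by (rule sx_While_False) (use sx_good(2)[OF 1] in simp_all)
    have "sx S Search (only ?rs) ?s"
      using 3 unfolding Search_def
      by (intro sx_While_True[OF _ _ sx_Seq[OF 1 2]]) (simp_all add: only_def del: fun_upd_apply, simp)
    moreover have "accepts (val ?rs) \<rho>" using True prems(1,2) unfolding accepts_def by blast
    ultimately show ?thesis by (intro exI[of _ ?s]) simp
  next
    case False
    have "(only ?rs)(0 := []) = only ?rs" by (auto simp: only_def fun_eq_iff)
    then have 1: "sx S Check (only ?rs) (only ?rs)" using check False by simp
    have step: "sx S (Seq Check (On 0 (\<lambda>t. if t = None then Inc else Done))) (only ?rs) s"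
      if "sx S Inc (only ?rs) s" for s
      by (rule sx_Seq[OF 1 sx_On]) (use that in \<open>simp_all add: only_def\<close>)
    have enter: "sx S Search (only ?rs) s'" if "sx S Inc (only ?rs) s" "sx S Search s s'" for s s'
      using that(2) unfolding Search_def
      by (intro sx_While_True[OF _ _ step[OF that(1)]]) (simp_all add: only_def)
    have skels: "map skel (rev (toks \<gamma>)) = map skel ?rs" if "erase \<gamma> = \<rho>" for \<gamma>
      using skel_toks[of \<gamma> \<beta>] that prems(1) by (simp add: rev_map[symmetric])
    have oks: "list_all (tok_ok A) (rev (toks \<gamma>))" if "erase \<gamma> = \<rho>" "digits_ok \<gamma>" for \<gamma>
      using toks_ok[OF that(2)] that(1) prems(3) by simp
    \<comment> \<open>The present guess has failed, and its queries are the only ones with this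
      counter value; so a passing guess not below it lies strictly above.\<close>
    have strict: "val ?rs < val (rev (toks \<gamma>))"
      if "erase \<gamma> = \<rho>" "digits_ok \<gamma>" "val ?rs \<le> val (rev (toks \<gamma>))" "passes \<gamma>" for \<gamma>
    proof (rule ccontr)
      assume "\<not> ?thesis"
      then have "?rs = rev (toks \<gamma>)"
        using that(3) by (intro val_inject[OF _ skels[OF that(1)] okr oks[OF that(1,2)]]) simp
      then have "toks \<beta> = toks \<gamma>" by simp
      then have "query a v \<beta> = query a v \<gamma>" for v by (rule query_cong)
      then have "passes \<beta> = passes \<gamma>" by (simp add: passes_def)
      then show False using False that(4) by simp
    qed
    note inc = sx_Inc[OF okr len]
    show ?thesis
    proof (cases "inc ?rs")
      case None
      then obtain s where s: "sx S Inc (only ?rs) s" "s 0 = [TBit False]" using inc by auto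
      have "sx S Search s s"
        unfolding Search_def by (rule sx_While_False) (use sx_good(2)[OF s(1)] s(2) in simp_all)
      moreover have "\<not> accepts (val ?rs) \<rho>"
      proof
        assume "accepts (val ?rs) \<rho>"
        then obtain \<gamma> where g: "erase \<gamma> = \<rho>" "digits_ok \<gamma>" "val ?rs \<le> val (rev (toks \<gamma>))" "passes \<gamma>"
          unfolding accepts_def by blast
        show False using strict[OF g] val_le[OF None skels[OF g(1)] okr oks[OF g(1,2)]] by simp
      qed
      ultimately show ?thesis using enter[OF s(1)] s(2) by auto
    next
      case (Some us)
      then have Inc: "sx S Inc (only ?rs) (only us)" using inc by simp
      note us = inc_Some[OF Some okr]
      have "map skel (rev us) = rev (map skel us)" by (simp add: rev_map)
      also have "\<dots> = rev (map skel ?rs)" using us by simp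
      also have "\<dots> = map skel (toks \<beta>)" by (simp add: rev_map)
      finally have "map skel (rev us) = map skel (toks \<beta>)" .
      moreover have "list_all (tok_ok A) (rev us)" using us by simp
      ultimately obtain \<delta> where \<delta>: "rev us = toks \<delta>" "erase \<delta> = \<rho>" "digits_ok \<delta>"
        using toks_skel[of "rev us" \<beta> A] prems(1) by blast
      have us': "us = rev (toks \<delta>)" by (simp add: \<delta>(1)[symmetric])
      have lens: "length (toks \<delta>) = length (toks \<beta>)" using us us' by simp
      have val: "val (rev (toks \<delta>)) = Suc (val ?rs)" using us us' by simp
      have "val (rev (toks \<delta>)) < 4 ^ length (toks \<delta>)"
        using val_less[of A "rev (toks \<delta>)"] oks[OF \<delta>(2,3)] by simp
      then have "4 ^ length (toks \<delta>) - val (rev (toks \<delta>)) < 4 ^ length (toks \<beta>) - val ?rs"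
        using val lens by simp
      from less.hyps[OF this \<delta>(2,3) prems(3)] obtain s where s: "sx S Search (only us) s"
        "s 0 = [TBit (accepts (val (rev (toks \<delta>))) \<rho>)]"
        using prems(4) lens us' by auto
      have "erase \<gamma> = \<rho> \<and> digits_ok \<gamma> \<and> Suc (val ?rs) \<le> val (rev (toks \<gamma>)) \<and> passes \<gamma> \<longleftrightarrow>
          erase \<gamma> = \<rho> \<and> digits_ok \<gamma> \<and> val ?rs \<le> val (rev (toks \<gamma>)) \<and> passes \<gamma>" for \<gamma>
        using strict[of \<gamma>] by (auto simp: Suc_le_eq)
      then have "accepts (val (rev (toks \<delta>))) \<rho> = accepts (val ?rs) \<rho>"
        unfolding accepts_def val by (simp only:)
      then show ?thesis using enter[OF Inc s(1)] s(2) by auto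
    qed
  qed
qed

section \<open>The parser as a program, and the main program\<close>

definition Apply :: "phase \<times> tok list \<times> nat \<Rightarrow> com" where
  "Apply = (\<lambda>(ph, ts, e). Seq (pushes 3 ts) (Seq (Pop 9) (Seq (Push 9 (TPhase ph))
     (if e = 1 then Push 8 TSep else if e = 2 then Pop 8 else Done))))"

definition Parse_bit :: com where
  "Parse_bit = On 2 (\<lambda>t. Seq (Pop 2) (On 9 (\<lambda>p. On 8 (\<lambda>d.
     case (t, p) of (Some (TBit b), Some (TPhase ph)) \<Rightarrow> Apply (pact A n ph b (d \<noteq> None)) | _ \<Rightarrow> Done))))"

definition Parse :: com where
  "Parse = While 2 is_tok Parse_bit"

lemma peek_replicate: "peek (replicate D t) = (if D = 0 then None else Some t)"
  by (cases D) simp_all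

lemma sx_Parse:
  assumes "good S s" "s 2 = map TBit x" "s 8 = replicate D TSep" "s 9 = [TPhase ph]" "phase_ok A ph"
    and "length (s 3) + length x \<le> S" "D + length x \<le> S"
    and "foldl (pstep A n) (ph, s 3, D) x = (ph', B', D')"
  shows "sx S Parse s (s(2 := [], 3 := B', 8 := replicate D' TSep, 9 := [TPhase ph']))"
  using assms
proof (induction x arbitrary: s ph D)
  case Nil
  then have "s(2 := [], 3 := B', 8 := replicate D' TSep, 9 := [TPhase ph']) = s" by (auto simp: fun_eq_iff)
  then show ?case using Nil sx_While_False[of 2 S s is_tok]
    by (simp add: Parse_def is_tok_def del: fun_upd_apply)
next
  case (Cons b x)
  note prems = Cons.prems
  obtain ph1 ts e where act: "pact A n ph b (D \<noteq> 0) = (ph1, ts, e)" by (metis prod_cases3)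
  let ?D = "if e = 1 then Suc D else if e = 2 then D - 1 else D"
  have ok: "phase_ok A ph1" "list_all (tok_ok A) ts" "length ts \<le> 1"
    using pact_ok[OF act prems(5)] by simp_all
  have ts: "set ts \<subseteq> legal" by (rule tok_ok_legal[OF ok(2)])
  let ?s1 = "s(2 := map TBit x)" let ?s2 = "?s1(3 := ts @ s 3)" let ?s3 = "?s2(9 := [])"
  let ?s4 = "?s2(9 := [TPhase ph1])" let ?s5 = "?s4(8 := replicate ?D TSep)"
  have S: "0 < S" using prems(1) by (simp add: good_def)
  have 1: "sx S (Pop 2) s ?s1"
    by (rule sx_eq[OF sx_Pop[of 2 S s]]) (use prems(1,2) in auto)
  have 2: "sx S (pushes 3 ts) ?s1 ?s2"
  proof (rule sx_eq[OF sx_pushes[of 3 S ?s1]])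
    show "length ts + length (?s1 3) \<le> S" using ok(3) prems(6) by simp
  qed (use sx_good(2)[OF 1] ts in auto)
  have 3: "sx S (Pop 9) ?s2 ?s3"
    by (rule sx_eq[OF sx_Pop[of 9 S ?s2]]) (use sx_good(2)[OF 2] prems(4) in auto)
  have 4: "sx S (Push 9 (TPhase ph1)) ?s3 ?s4"
    by (rule sx_eq[OF sx_Push[of 9 S ?s3]]) (use sx_good(2)[OF 3] S legal_toks(2)[OF ok(1)] in auto)
  have 5: "sx S (if e = 1 then Push 8 TSep else if e = 2 then Pop 8 else Done) ?s4 ?s5"
  proof -
    have push: "sx S (Push 8 TSep) ?s4 (?s4(8 := replicate (Suc D) TSep))"
      by (rule sx_eq[OF sx_Push[of 8 S ?s4]]) (use sx_good(2)[OF 4] prems(3,7) legal_toks(3) in auto)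
    have pop: "sx S (Pop 8) ?s4 (?s4(8 := replicate (D - 1) TSep))"
      by (rule sx_eq[OF sx_Pop[of 8 S ?s4]]) (use sx_good(2)[OF 4] prems(3) in auto)
    have "?s4(8 := replicate D TSep) = ?s4" using prems(3) by (auto simp: fun_eq_iff)
    then have "sx S Done ?s4 (?s4(8 := replicate D TSep))" using sx_Done[OF sx_good(2)[OF 4]] by simp
    then show ?thesis using push pop by simp
  qed
  have app: "sx S (Apply (ph1, ts, e)) ?s1 ?s5"
    unfolding Apply_def prod.case by (rule sx_Seq[OF 2 sx_Seq[OF 3 sx_Seq[OF 4 5]]])
  have inner: "sx S (On 9 (\<lambda>p. On 8 (\<lambda>d. case (Some (TBit b), p) of
      (Some (TBit b), Some (TPhase ph)) \<Rightarrow> Apply (pact A n ph b (d \<noteq> None)) | _ \<Rightarrow> Done))) ?s1 ?s5"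
  proof (rule sx_On, simp, rule sx_On, simp)
    have "peek (?s1 9) = Some (TPhase ph)" "(peek (?s1 8) \<noteq> None) = (D \<noteq> 0)"
      using prems(3,4) by (simp_all add: peek_replicate)
    then show "sx S (case (Some (TBit b), peek (?s1 9)) of
        (Some (TBit b), Some (TPhase ph)) \<Rightarrow> Apply (pact A n ph b (peek (?s1 8) \<noteq> None)) | _ \<Rightarrow> Done) ?s1 ?s5"
      by (simp only: option.case prod.case tok.case act app)
  qed
  have step: "sx S Parse_bit s ?s5"
    unfolding Parse_bit_def by (rule sx_On, simp, rule sx_Seq[OF 1]) (use inner prems(2) in simp)
  have IH: "sx S Parse ?s5 (?s5(2 := [], 3 := B', 8 := replicate D' TSep, 9 := [TPhase ph']))"
  proof (rule Cons.IH)
    show "good S ?s5" using step by (rule sx_good(2))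
    show "?s5 2 = map TBit x" "?s5 8 = replicate ?D TSep" "?s5 9 = [TPhase ph1]" by simp_all
    show "length (?s5 3) + length x \<le> S" using ok(3) prems(6) by simp
    have "?D \<le> Suc D" by auto
    moreover have "Suc D + length x \<le> S" using prems(7) by simp
    ultimately show "?D + length x \<le> S" by linarith
    show "foldl (pstep A n) (ph1, ?s5 3, ?D) x = (ph', B', D')" using prems(8) act by simp
  qed (rule ok(1))
  have eq: "?s5(2 := [], 3 := B', 8 := replicate D' TSep, 9 := [TPhase ph'])
      = s(2 := [], 3 := B', 8 := replicate D' TSep, 9 := [TPhase ph'])"
    by (auto simp: fun_eq_iff)
  show ?case
    using IH unfolding Parse_def eq
    by (intro sx_While_True[of 2 is_tok s, OF _ _ step]) (use prems(2) in \<open>simp_all add: is_tok_def del: fun_upd_apply\<close>)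
qed

text \<open>Each bit yields at most one token, which makes the number of tokens linear in the
  input.\<close>

lemma length_parse: "foldl (pstep A n) (ph, B, D) x = (ph', B', D') \<Longrightarrow> phase_ok A ph \<Longrightarrow> length B' \<le> length B + length x"
proof (induction x arbitrary: ph B D)
  case (Cons b x)
  obtain ph1 ts e where act: "pact A n ph b (D \<noteq> 0) = (ph1, ts, e)" by (metis prod_cases3)
  have "phase_ok A ph1" "length ts \<le> 1" using pact_ok[OF act Cons.prems(2)] by simp_all
  moreover have "foldl (pstep A n) (ph1, ts @ B, if e = 1 then Suc D else if e = 2 then D - 1 else D) x = (ph', B', D')"
    using Cons.prems(1) act by simp
  ultimately have "length B' \<le> length (ts @ B) + length x" using Cons.IH by blast
  then show ?case using \<open>length ts \<le> 1\<close> by simp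
qed simp

text \<open>\<open>TDia 0 0\<close>, put below the parsed tokens, supplies the outer
  \<open>Dia 0\<close> that is not part of the input. Emptying tape 0 into tape 2 frees it for the
  verdict and brings the first bit to the top.\<close>

definition Main :: com where
  "Main = Seq (To_end 0) (Seq (Move 0 is_tok 2) (Seq (pushes 3 [TDia 0 0]) (Seq (pushes 8 [TSep])
     (Seq (pushes 9 [TPhase Tag]) (Seq Parse (On 9 (\<lambda>p. On 8 (\<lambda>d.
       if p = Some (TPhase Tag) \<and> d = None then Seq (Pop 9) Search else Push 0 (TBit False)))))))))"

definition language :: "bool list set" where
  "language = {encode \<phi> | \<phi>. (\<forall>c \<in> modalities \<phi>. c + n \<le> A) \<and>
     (\<exists>\<gamma>. erase \<gamma> = Dia 0 (shift n \<phi>) \<and> digits_ok \<gamma> \<and> passes \<gamma>)}"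

lemma ex_Main:
  assumes "enough S (Suc (length x))" "length x + 2 \<le> S"
  shows "\<exists>T. ex S Main (\<lambda>r. if r = 0 then input_tape x else blank_tape) T \<and> (read_tape (T 0) = Bit True \<longleftrightarrow> x \<in> language)"
proof -
  let ?T = "\<lambda>r. if r = 0 then input_tape x else blank_tape"
  let ?e = "\<lambda>_ :: nat. [] :: tok list"
  let ?s0 = "?e(0 := rev (map TBit x))" let ?s1 = "?e(2 := map TBit x)"
  let ?s2 = "?s1(3 := [TDia 0 0])" let ?s3 = "?s2(8 := [TSep])" let ?s4 = "?s3(9 := [TPhase Tag])"
  have "ok S ?T" using assms(2) basic_symbols unfolding ok_def input_tape_def blank_tape_def
    by (auto simp: legal_def[symmetric]) (metis TBit_legal enc_TBit legal_def mem_Collect_eq)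
  moreover have "filled (length x) (input_tape x)" using shadows_input[of x] by (simp add: shadows_def)
  ultimately have "ex S (To_end 0) ?T (?T(0 := (fst (input_tape x), length x - 1)))"
    using ex_To_end[of 0 S ?T "length x"] assms(2) by simp
  moreover have "?T(0 := (fst (input_tape x), length x - 1)) = stacks ?s0"
    by (auto simp: stacks_def stk_def input_tape_def fun_eq_iff blank_tape_def)
  ultimately have 0: "ex S (To_end 0) ?T (stacks ?s0)" by simp
  have g0: "good S ?s0" using assms(2) by (auto simp: good_def)
  have 1: "sx S (Move 0 is_tok 2) ?s0 ?s1"
    by (rule sx_eq[OF sx_Move_all[of 0 2 S ?s0]]) (use g0 assms(2) in \<open>auto simp: fun_eq_iff\<close>)
  have dia: "TDia 0 0 \<in> legal" by (rule legal_toks(1)) (simp add: tok_ok_def)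
  have tag: "TPhase Tag \<in> legal" by (rule legal_toks(2)) simp
  have 2: "sx S (pushes 3 [TDia 0 0]) ?s1 ?s2"
    by (rule sx_eq[OF sx_pushes[of 3 S ?s1]]) (use sx_good(2)[OF 1] assms(2) dia in auto)
  have 3: "sx S (pushes 8 [TSep]) ?s2 ?s3"
    by (rule sx_eq[OF sx_pushes[of 8 S ?s2]]) (use sx_good(2)[OF 2] assms(2) legal_toks(3) in auto)
  have 4: "sx S (pushes 9 [TPhase Tag]) ?s3 ?s4"
    by (rule sx_eq[OF sx_pushes[of 9 S ?s3]]) (use sx_good(2)[OF 3] assms(2) tag in auto)
  obtain ph B D where parse: "foldl (pstep A n) (Tag, [TDia 0 0], 1) x = (ph, B, D)" by (metis prod_cases3)
  let ?s5 = "?e(3 := B, 8 := replicate D TSep, 9 := [TPhase ph])"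
  have 5: "sx S Parse ?s4 ?s5"
    by (rule sx_eq[OF sx_Parse[of S ?s4 x 1 Tag ph B D]])
      (use sx_good(2)[OF 4] assms(2) parse in \<open>auto simp: fun_eq_iff\<close>)
  let ?fin = "\<lambda>p d. if p = Some (TPhase Tag) \<and> d = None then Seq (Pop 9) Search else Push 0 (TBit False)"
  have "\<exists>s. sx S (?fin (Some (TPhase ph)) (peek (replicate D TSep))) ?s5 s \<and> s 0 = [TBit (x \<in> language)]"
  proof (cases "ph = Tag \<and> D = 0")
    case True
    then obtain \<phi> where \<phi>: "x = encode \<phi>" "\<forall>c \<in> modalities \<phi>. c + n \<le> A"
      using parse parse_iff[of A n "[TDia 0 0]" x] by auto
    let ?\<beta> = "zero (Dia 0 (shift n \<phi>))"
    have B: "B = rev (toks ?\<beta>)" using parse_encode[OF \<phi>(2), of "[TDia 0 0]" 0] parse \<phi>(1) by simp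
    have "sx S (Pop 9) ?s5 (only B)"
      by (rule sx_eq[OF sx_Pop[of 9 S ?s5]]) (use sx_good(2)[OF 5] True in \<open>auto simp: only_def fun_eq_iff\<close>)
    moreover have "length (toks ?\<beta>) \<le> Suc (length x)" using length_parse[OF parse] B by simp
    then have "enough S (length (toks ?\<beta>))" using assms(1) enough_mono by blast
    then obtain s where "sx S Search (only B) s" "s 0 = [TBit (accepts (val (rev (toks ?\<beta>))) (Dia 0 (shift n \<phi>)))]"
      using sx_Search[of ?\<beta> "Dia 0 (shift n \<phi>)" S] digits_ok_zero[of "Dia 0 (shift n \<phi>)"] \<phi>(2) B
      by (auto simp: modalities_shift simp del: zero.simps)
    moreover have "accepts (val (rev (toks ?\<beta>))) (Dia 0 (shift n \<phi>)) \<longleftrightarrow> x \<in> language"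
      unfolding accepts_def val_zero language_def using \<phi> inj_encode by (auto simp: inj_eq)
    ultimately show ?thesis using True by (auto intro: sx_Seq)
  next
    case False
    have "x \<notin> language"
    proof
      assume "x \<in> language"
      then have "\<exists>B. foldl (pstep A n) (Tag, [TDia 0 0], 1) x = (Tag, B, 0)"
        unfolding parse_iff language_def by blast
      then show False using False parse by simp
    qed
    moreover have "sx S (Push 0 (TBit False)) ?s5 (?s5(0 := [TBit False]))"
      by (rule sx_eq[OF sx_Push[of 0 S ?s5]]) (use sx_good(2)[OF 5] assms(2) in auto)
    ultimately show ?thesis using False by (intro exI[of _ "?s5(0 := [TBit False])"]) (auto simp: peek_replicate)
  qed
  then obtain s where s: "sx S (?fin (Some (TPhase ph)) (peek (replicate D TSep))) ?s5 s" "s 0 = [TBit (x \<in> language)]"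
    by blast
  have 6: "sx S (On 9 (\<lambda>p. On 8 (?fin p))) ?s5 s"
    by (rule sx_On, simp, rule sx_On, simp) (use s(1) in simp)
  have "ex S Main ?T (stacks s)"
    using sx_Seq[OF 1 sx_Seq[OF 2 sx_Seq[OF 3 sx_Seq[OF 4 sx_Seq[OF 5 6]]]]]
    unfolding Main_def sx_def by (intro ex_Seq[OF 0]) simp
  moreover have "read_tape (stacks s 0) = Bit (x \<in> language)"
    by (simp add: stacks_def s(2) read_stk)
  ultimately show ?thesis by auto
qed

end

section \<open>The reduction\<close>

lemma poly_nat_mono: "x \<le> y \<Longrightarrow> poly p x \<le> poly p y" for p :: "nat poly"
  by (induction p) (auto intro: add_mono mult_mono)

lemma finite_tok_ok: "finite {t. tok_ok A t}"
proof (rule finite_subset)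
  show "{t. tok_ok A t} \<subseteq> {TBit True, TBit False, TEnd, TVar, TBot, TImp} \<union> (\<lambda>(c, d). TDia c d) ` ({..A} \<times> {..<4})"
  proof (intro subsetI, elim CollectE)
    fix t
    assume "tok_ok A t"
    then show "t \<in> {TBit True, TBit False, TEnd, TVar, TBot, TImp} \<union> (\<lambda>(c, d). TDia c d) ` ({..A} \<times> {..<4})"
      by (cases t) (auto simp: tok_ok_def)
  qed
qed auto

lemma language_reduces:
  assumes "otm_wf M" "decides M Q R" "poly_space M Q"
  shows "PSPACE_Turing_reducible
    {encode \<phi> | \<phi>. (\<forall>c \<in> modalities \<phi>. c + n \<le> A) \<and> (\<exists>\<gamma>. erase \<gamma> = Dia 0 (shift n \<phi>) \<and> digits_ok \<gamma> \<and>
       encode (query a True \<gamma>) \<in> Q \<and> encode (query a False \<gamma>) \<in> R)} Q"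
proof -
  \<comment> \<open>Everything that stacks and simulated state have to store besides the written
    symbols of \<open>M\<close>; finite thanks to the bounds on modalities and phases.\<close>
  define X where "X = {t. tok_ok A t} \<union> TPhase ` {ph. phase_ok A ph} \<union> TState ` states M \<union> {TSep, TMark True, TMark False}"
  define \<Gamma> where "\<Gamma> = {Blank, Bit False, Bit True} \<union> enc ` X \<union> wr ` alphabet M"
  define k where "k = 11 + num_tapes M"
  have "finite (states M) \<and> finite (alphabet M) \<and> 2 \<le> num_tapes M"
    using assms(1) unfolding otm_wf_def by (elim conjE) (intro conjI)
  then have fin: "finite (states M)" "finite (alphabet M)" "2 \<le> num_tapes M" by simp_all
  have "finite X" using fin finite_tok_ok finite_phase_ok by (simp add: X_def)
  then have "finite \<Gamma>" using fin by (simp add: \<Gamma>_def)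
  interpret oracle_programs k \<Gamma> Q
    by unfold_locales (use \<open>finite \<Gamma>\<close> in \<open>simp_all add: \<Gamma>_def k_def\<close>)
  have X: "t \<in> legal" if "t \<in> X" for t
    using that unfolding legal_def by (simp add: \<Gamma>_def)
  interpret sum_machine k \<Gamma> Q M A a n R
  proof unfold_locales
    show "wr x \<in> \<Gamma>" if "x \<in> alphabet M" for x using that by (simp add: \<Gamma>_def)
    show "TState q \<in> legal" if "q \<in> states M" for q using that by (intro X) (simp add: X_def)
    show "TMark b \<in> legal" for b by (intro X) (cases b; simp add: X_def)
    show "t \<in> legal" if "tok_ok A t" for t using that by (intro X) (simp add: X_def)
    show "TPhase ph \<in> legal" if "phase_ok A ph" for ph using that by (intro X) (simp add: X_def)
    show "TSep \<in> legal" by (intro X) (simp add: X_def)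
  qed (use assms in \<open>simp_all add: k_def\<close>)
  obtain p where p: "\<And>x i t. t \<in> set (snd (run M Q x i)) \<Longrightarrow> snd t < poly p (length x)"
    using assms(3) unfolding poly_space_def by blast
  \<comment> \<open>\<open>q\<close> is \<open>space (Suc N)\<close> for inputs of length
    \<open>N\<close>: at most \<open>N\<close> parsed tokens and the extra diamond. \<open>r\<close>
    adds the space of \<open>M\<close> on words of length up to that, and \<open>N + 3\<close>,
    which makes the bound strict and leaves room for the input.\<close>
  define q where "q = [:12:] + [:3, 1:] * [:3, 1:] * [:K:]"
  define r where "r = q + pcompose p q + [:3, 1:]"
  have q: "poly q N = space (Suc N)" for N
    by (simp add: q_def space_def algebra_simps)
  have r: "poly r N = space (Suc N) + poly p (space (Suc N)) + 3 + N" for N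
    by (simp add: r_def poly_pcompose q)
  have enough: "enough (poly r N) (Suc N)" for N
    unfolding enough_def
  proof (intro exI[of _ "space (Suc N) + poly p (space (Suc N))"] conjI allI impI ballI)
    fix y i t
    assume y: "length y \<le> space (Suc N)" and t: "t \<in> set (snd (run M Q y i))"
    have "snd t < poly p (length y)" using t by (rule p)
    also have "\<dots> \<le> poly p (space (Suc N))" using y by (rule poly_nat_mono)
    finally show "snd t < space (Suc N) + poly p (space (Suc N))" by simp
  qed (simp_all add: r)
  have "PSPACE_Turing_reducible language Q"
  proof (rule program_reduces)
    show "\<exists>T. ex (poly r (length x)) Main (\<lambda>r. if r = 0 then input_tape x else blank_tape) T \<and>
        (read_tape (T 0) = Bit True \<longleftrightarrow> x \<in> language)" for x
      by (rule ex_Main[OF enough]) (simp add: r)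
  qed
  then show ?thesis unfolding language_def passes_def .
qed

lemma encode_in_image [simp]: "encode \<phi> \<in> encode ` X \<longleftrightarrow> \<phi> \<in> X"
  using inj_encode by (auto simp: inj_def)

lemma sum_reduces:
  assumes "\<forall>X \<in> F. is_frame A X" "\<forall>Y \<in> G. is_frame A Y" "a < A"
    and red: "Sat (Suc A) (univ_class G) \<le>\<^sub>T\<^sub>P\<^sub>S\<^sub>P\<^sub>A\<^sub>C\<^sub>E Sat (Suc A) (univ_class F)"
  shows "Sat (Suc A) (univ_class (class_sum a F G)) \<le>\<^sub>T\<^sub>P\<^sub>S\<^sub>P\<^sub>A\<^sub>C\<^sub>E Sat (Suc A) (univ_class F)"
    and "Sat A (class_sum a F G) \<le>\<^sub>T\<^sub>P\<^sub>S\<^sub>P\<^sub>A\<^sub>C\<^sub>E Sat (Suc A) (univ_class F)"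
proof -
  let ?Q = "encode ` Sat (Suc A) (univ_class F)" and ?R = "encode ` Sat (Suc A) (univ_class G)"
  obtain M where M: "otm_wf M" "decides M ?Q ?R" "poly_space M ?Q"
    using red unfolding PSPACE_Turing_reducible_def by blast
  have mod: "(\<forall>c \<in> modalities \<phi>. c + n \<le> A) \<longleftrightarrow> modalities (shift n \<phi>) \<subseteq> {..<Suc A}" for \<phi> n
    by (auto simp: modalities_shift)
  have "{encode \<phi> | \<phi>. (\<forall>c \<in> modalities \<phi>. c + n \<le> A) \<and> (\<exists>\<gamma>. erase \<gamma> = Dia 0 (shift n \<phi>) \<and> digits_ok \<gamma> \<and>
       encode (query a True \<gamma>) \<in> ?Q \<and> encode (query a False \<gamma>) \<in> ?R)}
     = encode ` {\<phi>. shift n \<phi> \<in> Sat (Suc A) (univ_class (class_sum a F G))}" for n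
    unfolding Sat_sum_iff[OF assms(1-3)] mod encode_in_image by auto
  then have *: "PSPACE_Turing_reducible (encode ` {\<phi>. shift n \<phi> \<in> Sat (Suc A) (univ_class (class_sum a F G))}) ?Q" for n
    using language_reduces[OF M, of n A a] by (simp only:)
  show "Sat (Suc A) (univ_class (class_sum a F G)) \<le>\<^sub>T\<^sub>P\<^sub>S\<^sub>P\<^sub>A\<^sub>C\<^sub>E Sat (Suc A) (univ_class F)"
    using *[of 0] by simp
  show "Sat A (class_sum a F G) \<le>\<^sub>T\<^sub>P\<^sub>S\<^sub>P\<^sub>A\<^sub>C\<^sub>E Sat (Suc A) (univ_class F)"
    using *[of 1] unfolding Sat_shift by simp
qed

text \<open>\<open>query_free\<close> speaks about readings over the alphabet only, so the invariant
  carries along that the tapes stay within it. Then \<open>Query\<close> is never entered and the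
  oracle never consulted.\<close>

lemma run_query_free:
  assumes wf: "otm_wf M" and free: "query_free M"
  shows "run M Q x i = run M {} x i"
proof -
  have closed: "\<forall>q \<in> states M. \<forall>xs. length xs = num_tapes M \<and> set xs \<subseteq> alphabet M \<longrightarrow>
        (case delta M q xs of (q', as) \<Rightarrow>
           q' \<in> states M \<and> length as = num_tapes M \<and> fst ` set as \<subseteq> alphabet M)"
    and start: "Start \<in> states M" and blank: "Blank \<in> alphabet M"
    and bits: "{Blank, Bit False, Bit True} \<subseteq> alphabet M" and tapes: "2 \<le> num_tapes M"
  proof -
    have *: "2 \<le> num_tapes M \<and> {Start, Query, Yes, No, Accept, Reject} \<subseteq> states M
        \<and> {Blank, Bit False, Bit True} \<subseteq> alphabet M"
      using wf unfolding otm_wf_def by (elim conjE) (intro conjI)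
    then show "Start \<in> states M" "Blank \<in> alphabet M" "{Blank, Bit False, Bit True} \<subseteq> alphabet M"
      "2 \<le> num_tapes M" by simp_all
  qed (use wf in \<open>unfold otm_wf_def, elim conjE\<close>)
  define inv where "inv cf \<longleftrightarrow> fst cf \<in> states M - {Query} \<and> length (snd cf) = num_tapes M \<and>
    (\<forall>t \<in> set (snd cf). range (fst t) \<subseteq> alphabet M)" for cf :: config
  have bit: "Bit b \<in> alphabet M" for b using bits by (cases b) simp_all
  have init: "inv (init_config M x)"
    using start blank bit tapes by (auto simp: inv_def init_config_def input_tape_def blank_tape_def)
  have step: "inv (step M Q cf) \<and> step M Q cf = step M {} cf" if cf: "inv cf" for cf
  proof -
    obtain q ts where qt: "cf = (q, ts)" by fastforce
    have q: "q \<in> states M" "q \<noteq> Query" "length ts = num_tapes M" "\<And>t. t \<in> set ts \<Longrightarrow> range (fst t) \<subseteq> alphabet M"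
      using cf by (simp_all add: inv_def qt)
    have read: "length (map read_tape ts) = num_tapes M \<and> set (map read_tape ts) \<subseteq> alphabet M"
      using q(3,4) by (fastforce simp: read_tape_def image_subset_iff)
    obtain q' as where delta: "delta M q (map read_tape ts) = (q', as)" by fastforce
    have "case delta M q (map read_tape ts) of (q', as) \<Rightarrow>
           q' \<in> states M \<and> length as = num_tapes M \<and> fst ` set as \<subseteq> alphabet M"
      by (rule mp[OF spec[OF bspec[OF closed q(1)]] read])
    then have as: "q' \<in> states M" "length as = num_tapes M" "fst ` set as \<subseteq> alphabet M"
      unfolding delta by simp_all
    have "fst (delta M q (map read_tape ts)) \<noteq> Query"
      using free q(1) read unfolding query_free_def by blast
    then have q': "q' \<noteq> Query" by (simp add: delta)
    have tapes': "range (fst t) \<subseteq> alphabet M" if t: "t \<in> set (map2 act as ts)" for t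
    proof -
      obtain z where z: "z \<in> set (zip as ts)" "t = (case z of (u, v) \<Rightarrow> act u v)"
        using t unfolding set_map by (elim imageE) blast
      obtain u v where "z = (u, v)" by (cases z)
      then have uv: "(u, v) \<in> set (zip as ts)" "t = act u v" using z by (simp_all only: prod.case)
      then have "u \<in> set as" "v \<in> set ts" by (meson set_zip_leftD set_zip_rightD)+
      moreover obtain f h where "v = (f, h)" by fastforce
      moreover obtain y d where "u = (y, d)" by fastforce
      ultimately show ?thesis using uv(2) as(3) q(4)[of v] by (force simp: fun_upd_def)
    qed
    show ?thesis
    proof (cases "q = Accept \<or> q = Reject")
      case True
      then show ?thesis using cf by (auto simp: qt)
    next
      case False
      then have "step M Z cf = (q', map2 act as ts)" for Z using q(2) delta by (simp add: qt)
      then show ?thesis using as(1,2) q' q(3) tapes' by (simp add: inv_def)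
    qed
  qed
  have "inv (run M Q x i) \<and> run M Q x i = run M {} x i"
  proof (induction i)
    case 0
    then show ?case using init by (simp add: run_def)
  next
    case (Suc i)
    have next_conf: "run M Z x (Suc i) = step M Z (run M Z x i)" for Z by (simp add: run_def)
    show ?case using step[OF conjunct1[OF Suc]] unfolding next_conf conjunct2[OF Suc] .
  qed
  then show ?thesis by simp
qed

lemma PSPACE_reducible:
  assumes "P \<in> PSPACE"
  shows "PSPACE_Turing_reducible P Q"
proof -
  obtain M where M: "otm_wf M" "query_free M" "decides M {} P" "poly_space M {}"
    using assms by (auto simp: PSPACE_def)
  have "decides M Q P" "poly_space M Q"
    using M(3,4) unfolding decides_def poly_space_def run_query_free[OF M(1,2), of Q] .
  then show ?thesis using M(1) unfolding PSPACE_Turing_reducible_def by blast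
qed

theorem theorem4p24:
  fixes A a :: nat
    and F :: "'w frame set"
    and G :: "'v frame set"
  assumes "\<forall>X \<in> F. is_frame A X"
    and "\<forall>Y \<in> G. is_frame A Y"
    and "a < A"
  shows "(Sat (Suc A) (univ_class G) \<le>\<^sub>T\<^sub>P\<^sub>S\<^sub>P\<^sub>A\<^sub>C\<^sub>E Sat (Suc A) (univ_class F) \<longrightarrow>
            Sat (Suc A) (univ_class (class_sum a F G)) \<le>\<^sub>T\<^sub>P\<^sub>S\<^sub>P\<^sub>A\<^sub>C\<^sub>E Sat (Suc A) (univ_class F) \<and>
            Sat A (class_sum a F G) \<le>\<^sub>T\<^sub>P\<^sub>S\<^sub>P\<^sub>A\<^sub>C\<^sub>E Sat (Suc A) (univ_class F)) \<and>
         (encode ` Sat (Suc A) (univ_class G) \<in> PSPACE \<longrightarrow>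
            Sat (Suc A) (univ_class G) \<le>\<^sub>T\<^sub>P\<^sub>S\<^sub>P\<^sub>A\<^sub>C\<^sub>E Sat (Suc A) (univ_class F) \<and>
            Sat (Suc A) (univ_class (class_sum a F G)) \<le>\<^sub>T\<^sub>P\<^sub>S\<^sub>P\<^sub>A\<^sub>C\<^sub>E Sat (Suc A) (univ_class F) \<and>
            Sat A (class_sum a F G) \<le>\<^sub>T\<^sub>P\<^sub>S\<^sub>P\<^sub>A\<^sub>C\<^sub>E Sat (Suc A) (univ_class F))"
proof (intro conjI impI)
  assume "encode ` Sat (Suc A) (univ_class G) \<in> PSPACE"
  then show "Sat (Suc A) (univ_class G) \<le>\<^sub>T\<^sub>P\<^sub>S\<^sub>P\<^sub>A\<^sub>C\<^sub>E Sat (Suc A) (univ_class F)"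
    by (rule PSPACE_reducible)
  then show "Sat (Suc A) (univ_class (class_sum a F G)) \<le>\<^sub>T\<^sub>P\<^sub>S\<^sub>P\<^sub>A\<^sub>C\<^sub>E Sat (Suc A) (univ_class F)"
    "Sat A (class_sum a F G) \<le>\<^sub>T\<^sub>P\<^sub>S\<^sub>P\<^sub>A\<^sub>C\<^sub>E Sat (Suc A) (univ_class F)"
    by (rule sum_reduces[OF assms])+
qed (rule sum_reduces[OF assms], assumption)+

end
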